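(* Let $m,n\ge 1$, let $\Phi:\mathbb R^n\to[0,\infty)$ and let $A_1(t),\dots,A_m(t)$ be real $n\times n$ matrices that are invertible for almost every $t$ in the support of $\Phi$, and assume there is $\rho_{\vec A}\ge1$ with $\|A_i(t)\|\,\|A_i^{-1}(t)\|\le\rho_{\vec A}$ for all $i=1,\dots,m$ and almost every $t\in\mathbb R^n$. Let $\gamma_1,\dots,\gamma_m\in\mathbb R$, $\gamma=\gamma_1+\cdots+\gamma_m$, $\omega_i(x)=|x|^{\gamma_i}$ for $i=1,\dots,m$, $\omega(x)=|x|^{\gamma}$. Let $q_1(\cdot),\dots,q_m(\cdot),q(\cdot)\in\mathcal P_b(\mathbb R^n)$ with $\frac1{q_1(\cdot)}+\cdots+\frac1{q_m(\cdot)}=\frac1{q(\cdot)}$, and let $\zeta>0$. Assume that for almost every $t\in\operatorname{supp}(\Phi)$ and all $i=1,\dots,m$, $$q_i(A_i^{-1}(t)\cdot)\le \zeta\, q_i(\cdot),\qquad \|1\|_{L^{r_i(t,\cdot)}}<\infty,\qquad\text{where }\frac1{r_i(t,\cdot)}=\frac1{q_i(A_i^{-1}(t)\cdot)}-\frac1{\zeta q_i(\cdot)},$$ and that $$\mathcal C_1=\int_{\mathbb R^n}\frac{\Phi(t)}{|t|^n}\prod_{i=1}^m c_{A_i,q_i,\gamma_i}(t)\,\|1\|_{L^{r_i(t,\cdot)}}\,dt<\infty,$$ where $$c_{A_i,q_i,\gamma_i}(t)=\max\big\{\|A_i(t)\|^{-\gamma_i},\|A_i^{-1}(t)\|^{\gamma_i}\big\}\max\big\{|\det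 A_i^{-1}(t)|^{\frac1{q_{i+}}},|\det A_i^{-1}(t)|^{\frac1{q_{i-}}}\big\}.$$ Assume in addition that for almost every $t\in\operatorname{supp}(\Phi)$ and all $i=1,\dots,m$, $$q_i(A_i^{-1}(t)\cdot)\le q_i(\cdot),\qquad \|1\|_{L^{r_{1i}(t,\cdot)}}<\infty,\qquad\text{where }\frac1{r_{1i}(t,\cdot)}=\frac1{q_i(A_i^{-1}(t)\cdot)}-\frac1{q_i(\cdot)}.$$ (a) If $$\mathcal C_2=\int_{\mathbb R^n}\frac{\Phi(t)}{|t|^n}\prod_{i=1}^m\max\Big\{\|A_i^{-1}(t)\|^{\frac n{q_{i+}}+\gamma_i},\|A_i^{-1}(t)\|^{\frac n{q_{i-}}+\gamma_i}\Big\}\|1\|_{L^{r_{1i}(t,\cdot)}}\,dt<\infty,$$ then $\|H_{\Phi,\vec A}(\vec f)\|_{L^{q(\cdot)}_\omega}\lesssim \mathcal C_2\prod_{i=1}^m\|f_i\|_{L^{q_i(\cdot)}_{\omega_i}}$. (b) Let $$\mathcal C_2^*=\int_{\mathbb R^n}\frac{\Phi(t)}{|t|^n}\prod_{i=1}^m\min\Big\{\|A_i^{-1}(t)\|^{\frac n{q_{i+}}+\gamma_i},\|A_i^{-1}(t)\|^{\frac n{q_{i-}}+\gamma_i}\Big\}\,dt.$$ Assume that $H_{\Phi,\vec A}$ is a bounded operator from $L^{q_1(\cdot)}_{\omega_1}\times\cdots\times L^{q_m(\cdot)}_{\omega_m}$ to $L^{q(\cdot)}_\omega$ and that $\frac1{q_{1-}}+\frac1{q_{2-}}+\cdots+\frac1{q_{m-}}=\frac1{q_+}$.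 Then $\mathcal C_2^*$ is finite and, moreover, $\|H_{\Phi,\vec A}\|_{L^{q_1(\cdot)}_{\omega_1}\times\cdots\times L^{q_m(\cdot)}_{\omega_m}\to L^{q(\cdot)}_\omega}\gtrsim\mathcal C_2^*$.
   Context: All functions and matrix-valued functions are Lebesgue measurable. The multilinear Hausdorff operator is $H_{\Phi,\vec A}(\vec f)(x)=\int_{\mathbb R^n}\frac{\Phi(t)}{|t|^n}\prod_{i=1}^m f_i(A_i(t)x)\,dt$, $x\in\mathbb R^n$, for $\vec f=(f_1,\dots,f_m)$ measurable functions $\mathbb R^n\to\mathbb C$, $\vec A=(A_1,\dots,A_m)$. Its operator norm is the least $C$ with $\|H_{\Phi,\vec A}(\vec f)\|\le C\prod_i\|f_i\|$. The notation $a\lesssim b$ (equivalently $b\gtrsim a$) means $a\le Cb$ with a positive constant $C$ independent of the main parameters. For a matrix $A=(a_{ij})$, $\|A\|=(\sum_{i,j}|a_{ij}|^2)^{1/2}$. $\mathcal P(\mathbb R^n)$ is the set of measurable $p(\cdot):\mathbb R^n\to[1,\infty]$. For $p(\cdot)\in\mathcal P(\mathbb R^n)$ let $\Omega_\infty=\{x:p(x)=\infty\}$ and $F_p(g)=\int_{\mathbb R^n\setminus\Omega_\infty}|g(x)|^{p(x)}dx+\|g\|_{L^\infty(\Omega_\infty)}$; $L^{p(\cdot)}=L^{p(\cdot)}(\mathbb R^n)$ is the set of complex-valued measurable $f$ with $F_p(f/\eta)<\infty$ for some $\eta>0$, with norm $\|f\|_{L^{p(\cdot)}}=\inf\{\eta>0:F_p(f/\eta)\le1\}$.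 For a weight $\omega\ge 0$, $L^{p(\cdot)}_\omega$ is the set of $f$ with $f\omega\in L^{p(\cdot)}$, and $\|f\|_{L^{p(\cdot)}_\omega}=\|f\omega\|_{L^{p(\cdot)}}$. $q_-=\operatorname{ess\,inf}q$, $q_+=\operatorname{ess\,sup}q$ ($q_{i\pm}$ for $q_i$); $\mathcal P_b(\mathbb R^n)$ is the class of $q(\cdot)\in\mathcal P(\mathbb R^n)$ with $1<q_-\le q(x)\le q_+<\infty$ for all $x$. An exponent $r$ with $1/r=0$ is read as $r=\infty$. *)

theory Defs
  imports "HOL-Analysis.Analysis" "HOL-Probability.Essential_Supremum"
begin

text \<open>
  Conventions. Exponents take values in \<^typ>\<open>ennreal\<close>, where \<^term>\<open>inverse (0::ennreal)\<close> is infinity.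
  Norms and nonnegative integrals are valued there too. The norm of the
  type \<open>real^'n^'n\<close> is the Frobenius norm, so it is used for matrices as it stands.
\<close>

definition essinf :: "'a measure \<Rightarrow> ('a \<Rightarrow> ennreal) \<Rightarrow> ennreal" where
  "essinf M f = Sup {c. AE x in M. c \<le> f x}"

definition var_exponents :: "(real^'n \<Rightarrow> ennreal) set" where
  "var_exponents = {p \<in> borel_measurable lebesgue. \<forall>x. 1 \<le> p x}"

definition bdd_var_exponents :: "(real^'n \<Rightarrow> ennreal) set" where
  "bdd_var_exponents = {q \<in> var_exponents. 1 < essinf lebesgue q \<and> esssup lebesgue q < \<infinity> \<and>
     (\<forall>x. essinf lebesgue q \<le> q x \<and> q x \<le> esssup lebesgue q)}"

definition var_modular :: "(real^'n \<Rightarrow> ennreal) \<Rightarrow> (real^'n \<Rightarrow> complex) \<Rightarrow> ennreal" where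
  "var_modular p g =
     (\<integral>\<^sup>+x\<in>{x. p x \<noteq> \<infinity>}. ennreal (norm (g x) powr enn2real (p x)) \<partial>lebesgue) +
     esssup (restrict_space lebesgue {x. p x = \<infinity>}) (\<lambda>x. ennreal (norm (g x)))"

definition var_Lp :: "(real^'n \<Rightarrow> ennreal) \<Rightarrow> (real^'n \<Rightarrow> complex) set" where
  "var_Lp p = {f \<in> borel_measurable lebesgue.
     \<exists>\<eta>>0. var_modular p (\<lambda>x. f x / complex_of_real \<eta>) < \<infinity>}"

definition var_norm :: "(real^'n \<Rightarrow> ennreal) \<Rightarrow> (real^'n \<Rightarrow> complex) \<Rightarrow> ennreal" where
  "var_norm p f =
     Inf {ennreal \<eta> | \<eta>. \<eta> > 0 \<and> var_modular p (\<lambda>x. f x / complex_of_real \<eta>) \<le> 1}"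

definition wvar_Lp ::
  "(real^'n \<Rightarrow> ennreal) \<Rightarrow> (real^'n \<Rightarrow> real) \<Rightarrow> (real^'n \<Rightarrow> complex) set" where
  "wvar_Lp p \<omega> = {f \<in> borel_measurable lebesgue. (\<lambda>x. f x * complex_of_real (\<omega> x)) \<in> var_Lp p}"

definition wvar_norm ::
  "(real^'n \<Rightarrow> ennreal) \<Rightarrow> (real^'n \<Rightarrow> real) \<Rightarrow> (real^'n \<Rightarrow> complex) \<Rightarrow> ennreal" where
  "wvar_norm p \<omega> f = var_norm p (\<lambda>x. f x * complex_of_real (\<omega> x))"

definition power_weight :: "real \<Rightarrow> real^'n \<Rightarrow> real" where
  "power_weight \<gamma> x = norm x powr \<gamma>"

text \<open>
  The \<open>m\<close>-tuples of functions, matrices and exponents are families over \<^typ>\<open>nat\<close>, of which only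
  the members with index in \<open>{1..m}\<close> matter.
\<close>

definition hausdorff_integrand ::
  "nat \<Rightarrow> (real^'n \<Rightarrow> real) \<Rightarrow> (nat \<Rightarrow> real^'n \<Rightarrow> real^'n^'n) \<Rightarrow>
   (nat \<Rightarrow> real^'n \<Rightarrow> complex) \<Rightarrow> real^'n \<Rightarrow> real^'n \<Rightarrow> complex" where
  "hausdorff_integrand m \<Phi> A f x t =
     complex_of_real (\<Phi> t / norm t ^ CARD('n)) * (\<Prod>i=1..m. f i (A i t *v x))"

definition hausdorff_op ::
  "nat \<Rightarrow> (real^'n \<Rightarrow> real) \<Rightarrow> (nat \<Rightarrow> real^'n \<Rightarrow> real^'n^'n) \<Rightarrow>
   (nat \<Rightarrow> real^'n \<Rightarrow> complex) \<Rightarrow> real^'n \<Rightarrow> complex" where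
  "hausdorff_op m \<Phi> A f x = (LINT t|lebesgue. hausdorff_integrand m \<Phi> A f x t)"

text \<open>
  The Bochner integral of a non-integrable function is 0 by convention, so it has to be said
  separately that the defining integral exists for almost every \<open>x\<close>.
\<close>

definition hausdorff_defined ::
  "nat \<Rightarrow> (real^'n \<Rightarrow> real) \<Rightarrow> (nat \<Rightarrow> real^'n \<Rightarrow> real^'n^'n) \<Rightarrow>
   (nat \<Rightarrow> real^'n \<Rightarrow> complex) \<Rightarrow> bool" where
  "hausdorff_defined m \<Phi> A f \<longleftrightarrow> (AE x in lebesgue. integrable lebesgue (hausdorff_integrand m \<Phi> A f x))"

definition hausdorff_bounded ::
  "nat \<Rightarrow> (real^'n \<Rightarrow> real) \<Rightarrow> (nat \<Rightarrow> real^'n \<Rightarrow> real^'n^'n) \<Rightarrow>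
   (nat \<Rightarrow> real^'n \<Rightarrow> ennreal) \<Rightarrow> (nat \<Rightarrow> real^'n \<Rightarrow> real) \<Rightarrow>
   (real^'n \<Rightarrow> ennreal) \<Rightarrow> (real^'n \<Rightarrow> real) \<Rightarrow> bool" where
  "hausdorff_bounded m \<Phi> A qs \<omega>s q \<omega> \<longleftrightarrow>
     (\<exists>C\<ge>0. \<forall>f. (\<forall>i\<in>{1..m}. f i \<in> wvar_Lp (qs i) (\<omega>s i)) \<longrightarrow>
        hausdorff_defined m \<Phi> A f \<and> hausdorff_op m \<Phi> A f \<in> wvar_Lp q \<omega> \<and>
        wvar_norm q \<omega> (hausdorff_op m \<Phi> A f)
          \<le> ennreal C * (\<Prod>i=1..m. wvar_norm (qs i) (\<omega>s i) (f i)))"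

definition hausdorff_norm ::
  "nat \<Rightarrow> (real^'n \<Rightarrow> real) \<Rightarrow> (nat \<Rightarrow> real^'n \<Rightarrow> real^'n^'n) \<Rightarrow>
   (nat \<Rightarrow> real^'n \<Rightarrow> ennreal) \<Rightarrow> (nat \<Rightarrow> real^'n \<Rightarrow> real) \<Rightarrow>
   (real^'n \<Rightarrow> ennreal) \<Rightarrow> (real^'n \<Rightarrow> real) \<Rightarrow> ennreal" where
  "hausdorff_norm m \<Phi> A qs \<omega>s q \<omega> =
     Inf {ennreal C | C. C \<ge> 0 \<and>
       (\<forall>f. (\<forall>i\<in>{1..m}. f i \<in> wvar_Lp (qs i) (\<omega>s i)) \<longrightarrow>
          wvar_norm q \<omega> (hausdorff_op m \<Phi> A f)
            \<le> ennreal C * (\<Prod>i=1..m. wvar_norm (qs i) (\<omega>s i) (f i)))}"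

text \<open>
  With \<open>B\<close> the matrix \<open>A\<^sub>i(t)\<close>, this is the exponent \<open>r\<^sub>i(t,\<sqdot>)\<close>, and for \<open>\<zeta> = 1\<close> the exponent
  \<open>r\<^sub>1\<^sub>i(t,\<sqdot>)\<close>. Subtraction on \<^typ>\<open>ennreal\<close> is truncated at 0, which has no effect where
  \<open>q (matrix_inv B *v x) \<le> \<zeta> * q x\<close>.
\<close>

definition quot_exponent :: "real \<Rightarrow> (real^'n \<Rightarrow> ennreal) \<Rightarrow> real^'n^'n \<Rightarrow> real^'n \<Rightarrow> ennreal" where
  "quot_exponent \<zeta> q B x = inverse (1 / q (matrix_inv B *v x) - 1 / (ennreal \<zeta> * q x))"

definition c_const :: "real^'n^'n \<Rightarrow> (real^'n \<Rightarrow> ennreal) \<Rightarrow> real \<Rightarrow> real" where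
  "c_const B q \<gamma> =
     max (norm B powr (- \<gamma>)) (norm (matrix_inv B) powr \<gamma>) *
     max (\<bar>det (matrix_inv B)\<bar> powr (1 / enn2real (esssup lebesgue q)))
         (\<bar>det (matrix_inv B)\<bar> powr (1 / enn2real (essinf lebesgue q)))"

definition C1_const ::
  "nat \<Rightarrow> (real^'n \<Rightarrow> real) \<Rightarrow> (nat \<Rightarrow> real^'n \<Rightarrow> real^'n^'n) \<Rightarrow>
   (nat \<Rightarrow> real^'n \<Rightarrow> ennreal) \<Rightarrow> (nat \<Rightarrow> real) \<Rightarrow> real \<Rightarrow> ennreal" where
  "C1_const m \<Phi> A qs \<gamma> \<zeta> =
     (\<integral>\<^sup>+t. ennreal (\<Phi> t / norm t ^ CARD('n)) *
        (\<Prod>i=1..m. ennreal (c_const (A i t) (qs i) (\<gamma> i)) *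
                   var_norm (quot_exponent \<zeta> (qs i) (A i t)) (\<lambda>_. 1)) \<partial>lebesgue)"

definition C2_const ::
  "nat \<Rightarrow> (real^'n \<Rightarrow> real) \<Rightarrow> (nat \<Rightarrow> real^'n \<Rightarrow> real^'n^'n) \<Rightarrow>
   (nat \<Rightarrow> real^'n \<Rightarrow> ennreal) \<Rightarrow> (nat \<Rightarrow> real) \<Rightarrow> ennreal" where
  "C2_const m \<Phi> A qs \<gamma> =
     (\<integral>\<^sup>+t. ennreal (\<Phi> t / norm t ^ CARD('n)) *
        (\<Prod>i=1..m. ennreal (max
             (norm (matrix_inv (A i t)) powr (CARD('n) / enn2real (esssup lebesgue (qs i)) + \<gamma> i))
             (norm (matrix_inv (A i t)) powr (CARD('n) / enn2real (essinf lebesgue (qs i)) + \<gamma> i))) *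
           var_norm (quot_exponent 1 (qs i) (A i t)) (\<lambda>_. 1)) \<partial>lebesgue)"

definition C2_star_const ::
  "nat \<Rightarrow> (real^'n \<Rightarrow> real) \<Rightarrow> (nat \<Rightarrow> real^'n \<Rightarrow> real^'n^'n) \<Rightarrow>
   (nat \<Rightarrow> real^'n \<Rightarrow> ennreal) \<Rightarrow> (nat \<Rightarrow> real) \<Rightarrow> ennreal" where
  "C2_star_const m \<Phi> A qs \<gamma> =
     (\<integral>\<^sup>+t. ennreal (\<Phi> t / norm t ^ CARD('n)) *
        (\<Prod>i=1..m. ennreal (min
             (norm (matrix_inv (A i t)) powr (CARD('n) / enn2real (esssup lebesgue (qs i)) + \<gamma> i))
             (norm (matrix_inv (A i t)) powr (CARD('n) / enn2real (essinf lebesgue (qs i)) + \<gamma> i))))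
        \<partial>lebesgue)"

end

theory Submission
  imports Defs
begin

text \<open>
  Part (a) is Minkowski's integral inequality. The operator is an integral over \<open>t\<close>, with
  nonnegative weight \<open>\<Phi>(t)/|t|\<^sup>n\<close>, of products of the dilated functions \<open>x \<mapsto> f\<^sub>i(A\<^sub>i(t)x)\<close>. So its
  norm is at most the integral of the norms of these products
  (\<open>luxemburg_Minkowski\<close>), and Hoelder's inequality for \<open>1/q = \<Sum>1/q\<^sub>i\<close> splits each product into its
  factors (\<open>luxemburg_prod_le\<close>). The norm of one dilated factor is estimated by the substitution
  \<open>y = A\<^sub>i(t)x\<close> (\<open>wvar_norm_dilation_le\<close>). It moves the exponent to \<open>q\<^sub>i(A\<^sub>i\<^sup>-\<^sup>1(t)\<sqdot>)\<close>, costs the Jacobian, which is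
  at most \<open>\<parallel>A\<^sub>i\<^sup>-\<^sup>1\<parallel>\<^sup>n\<close>, and replaces the weight \<open>|x|\<^sup>\<gamma>\<close> by \<open>|A\<^sub>i\<^sup>-\<^sup>1y|\<^sup>\<gamma>\<close>, which is \<open>\<parallel>A\<^sub>i\<^sup>-\<^sup>1\<parallel>\<^sup>\<gamma>|y|\<^sup>\<gamma>\<close> up to a power of
  \<open>\<rho>\<close>. One more use of Hoelder's inequality, with the constant function 1 in \<open>L\<close> with exponent \<open>r\<^sub>1\<^sub>i(t,\<sqdot>)\<close>, returns
  from the exponent \<open>q\<^sub>i(A\<^sub>i\<^sup>-\<^sup>1(t)\<sqdot>)\<close> to \<open>q\<^sub>i\<close>.

  All norms are treated through the modular, not through duality: a bound \<open>\<parallel>g\<parallel> \<le> \<eta>\<close> means that the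
  modular of \<open>g/\<eta>\<close> is at most 1, and convexity of \<open>u \<mapsto> u\<^sup>p\<close> for \<open>p \<ge> 1\<close> turns a bound \<open>k\<close> on the modular
  into a factor \<open>k\<close> in the norm. The integrand of \<open>C2_const\<close> enters only as a pointwise majorant of \<open>t \<mapsto> \<parallel>F(t,\<sqdot>)\<parallel>\<close>, where \<open>F(t,\<sqdot>)\<close> is the weighted product above.
  This function of \<open>t\<close> is measurable (\<open>borel_measurable_luxemburg\<close>), so its integral is
  bounded by the lower integral of the majorant (\<open>nn_integral_le_cmult\<close>).

  Part (b) is a statement about constant exponents: since \<open>q\<^sub>i \<ge> q\<^sub>i\<^sub>-\<close> and \<open>q \<le> q\<^sub>+\<close>, the
  equality \<open>\<Sum>1/q\<^sub>i\<^sub>- = 1/q\<^sub>+\<close> leaves no room between \<open>\<Sum>1/q\<^sub>i = 1/q\<close> and its extreme case, and every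
  \<open>q\<^sub>i\<close> equals \<open>p\<^sub>i = q\<^sub>i\<^sub>-\<close> (\<open>extremal_exponents_constant\<close>). For constant exponents the operator is tested on
  \<open>f\<^sub>i(x) = |x|\<close> to the power \<open>-(n+\<epsilon>)/p\<^sub>i-\<gamma>\<^sub>i\<close>, restricted to \<open>|x| \<ge> 1\<close>. These are almost eigenfunctions: on \<open>|x| \<ge> 1/\<epsilon>\<close> the image
  is bounded below by the same kind of power times an integral over \<open>t\<close>. By Fatou's lemma the lower limit of this
  integral as \<open>\<epsilon> \<rightarrow> 0\<close> dominates \<open>\<C>\<^sub>2\<^sup>*\<close>, up to a power of \<open>\<rho>\<close>. The loss from shrinking the domain is \<open>\<epsilon>\<close> to the power \<open>\<epsilon>/p\<close>, which
  stays away from 0 (\<open>hausdorff_lower_bound_const_exponents\<close>).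
\<close>

section \<open>Luxemburg functionals\<close>

definition modular :: "'a measure \<Rightarrow> ('a \<Rightarrow> real) \<Rightarrow> ('a \<Rightarrow> real) \<Rightarrow> ennreal" where
  "modular N p g = (\<integral>\<^sup>+x. ennreal (g x powr p x) \<partial>N)"

definition luxemburg :: "'a measure \<Rightarrow> ('a \<Rightarrow> real) \<Rightarrow> ('a \<Rightarrow> real) \<Rightarrow> ennreal" where
  "luxemburg N p g = Inf {ennreal \<eta> | \<eta>. 0 < \<eta> \<and> modular N p (\<lambda>x. g x / \<eta>) \<le> 1}"

lemma modular_mono_AE:
  assumes "AE x in N. 0 \<le> g x \<and> g x \<le> h x" and "\<And>x. 0 \<le> p x"
  shows "modular N p g \<le> modular N p h"
  unfolding modular_def
proof (rule nn_integral_mono_AE)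
  show "AE x in N. ennreal (g x powr p x) \<le> ennreal (h x powr p x)"
    using assms(1) by eventually_elim (auto intro!: ennreal_leI powr_mono2 assms(2))
qed

lemma modular_antimono_scale:
  assumes "\<And>x. 0 \<le> g x" "\<And>x. 0 \<le> p x" "0 < a" "a \<le> b"
  shows "modular N p (\<lambda>x. g x / b) \<le> modular N p (\<lambda>x. g x / a)"
  by (rule modular_mono_AE) (use assms in \<open>auto intro!: divide_left_mono AE_I2\<close>)

text \<open>
  The exponent is at least 1, so dividing the function by a factor \<open>b/a \<ge> 1\<close> divides the modular
  by at least this factor. This is how every bound on a modular becomes a bound on a norm.
\<close>
lemma modular_scale_le:
  assumes [measurable]: "g \<in> borel_measurable N" "p \<in> borel_measurable N"
    and g: "\<And>x. 0 \<le> g x" and p: "\<And>x. 1 \<le> p x" and ab: "0 < a" "a \<le> b"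
  shows "modular N p (\<lambda>x. g x / b) \<le> ennreal (a / b) * modular N p (\<lambda>x. g x / a)"
proof -
  have "(g x / b) powr p x \<le> a / b * (g x / a) powr p x" for x
  proof -
    have "(g x / b) powr p x = (a / b) powr p x * (g x / a) powr p x"
      using ab g[of x] by (subst powr_mult[symmetric]) auto
    also have "(a / b) powr p x \<le> (a / b) powr 1"
      using ab p[of x] by (intro powr_mono') auto
    finally show ?thesis using ab by (simp add: mult_right_mono)
  qed
  then have "modular N p (\<lambda>x. g x / b) \<le> (\<integral>\<^sup>+x. ennreal (a / b) * ennreal ((g x / a) powr p x) \<partial>N)"
    unfolding modular_def using ab
    by (intro nn_integral_mono) (simp add: ennreal_mult[symmetric])
  also have "\<dots> = ennreal (a / b) * modular N p (\<lambda>x. g x / a)"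
    unfolding modular_def by (rule nn_integral_cmult) measurable
  finally show ?thesis .
qed

lemma luxemburg_le:
  assumes "0 < \<eta>" "modular N p (\<lambda>x. g x / \<eta>) \<le> 1"
  shows "luxemburg N p g \<le> ennreal \<eta>"
  unfolding luxemburg_def using assms by (intro Inf_lower) auto

lemma modular_le_1_above:
  assumes "luxemburg N p g < ennreal \<eta>" "\<And>x. 0 \<le> g x" "\<And>x. 0 \<le> p x"
  shows "modular N p (\<lambda>x. g x / \<eta>) \<le> 1"
proof -
  from assms(1) obtain a where a: "0 < a" "modular N p (\<lambda>x. g x / a) \<le> 1" "ennreal a < ennreal \<eta>"
    unfolding luxemburg_def Inf_less_iff by auto
  have "modular N p (\<lambda>x. g x / \<eta>) \<le> modular N p (\<lambda>x. g x / a)"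
    using a assms by (intro modular_antimono_scale) (auto simp: ennreal_less_iff)
  with a show ?thesis by simp
qed

lemma luxemburg_mono_AE:
  assumes "AE x in N. 0 \<le> g x \<and> g x \<le> h x" "\<And>x. 0 \<le> p x"
  shows "luxemburg N p g \<le> luxemburg N p h"
  unfolding luxemburg_def
proof (rule Inf_superset_mono, safe)
  fix \<eta> :: real assume \<eta>: "0 < \<eta>" "modular N p (\<lambda>x. h x / \<eta>) \<le> 1"
  have "modular N p (\<lambda>x. g x / \<eta>) \<le> modular N p (\<lambda>x. h x / \<eta>)"
    proof (rule modular_mono_AE[OF _ assms(2)])
    show "AE x in N. 0 \<le> g x / \<eta> \<and> g x / \<eta> \<le> h x / \<eta>"
      using assms(1) by eventually_elim (use \<eta> in \<open>auto simp: divide_right_mono\<close>)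
  qed
  then show "\<exists>\<eta>'. ennreal \<eta> = ennreal \<eta>' \<and> 0 < \<eta>' \<and> modular N p (\<lambda>x. g x / \<eta>') \<le> 1"
    using \<eta> by auto
qed

lemma luxemburg_finite:
  assumes [measurable]: "g \<in> borel_measurable N" "p \<in> borel_measurable N"
    and g: "\<And>x. 0 \<le> g x" and p: "\<And>x. 1 \<le> p x"
    and "0 < a" "modular N p (\<lambda>x. g x / a) < \<infinity>"
  shows "luxemburg N p g < \<infinity>"
proof -
  obtain c where c: "modular N p (\<lambda>x. g x / a) = ennreal c" "0 \<le> c"
    using assms(6) by (cases "modular N p (\<lambda>x. g x / a)") auto
  have "modular N p (\<lambda>x. g x / (a * (1 + c))) \<le> ennreal (a / (a * (1 + c))) * ennreal c"
    using modular_scale_le[OF assms(1,2) g p assms(5), of "a * (1 + c)"] c assms(5) by auto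
  also have "\<dots> = ennreal (c / (1 + c))"
    using c assms(5) by (simp add: ennreal_mult[symmetric])
  also have "\<dots> \<le> 1"
    using c by (simp add: divide_le_eq_1)
  finally have "luxemburg N p g \<le> ennreal (a * (1 + c))"
    using c assms(5) by (intro luxemburg_le) auto
  then show ?thesis by (simp add: le_less_trans)
qed

text \<open>
  If all \<open>e > 0\<close> are admissible, then \<open>modular_scale_le\<close> bounds the modular of \<open>g\<close> itself by every \<open>e < 1\<close>.
\<close>
lemma luxemburg_zero_imp:
  assumes [measurable]: "g \<in> borel_measurable N" "p \<in> borel_measurable N"
    and g: "\<And>x. 0 \<le> g x" and p: "\<And>x. 1 \<le> p x"
    and z: "luxemburg N p g = 0"
  shows "AE x in N. g x = 0"
proof -
  have small: "modular N p (\<lambda>x. g x / 1) \<le> ennreal e" if e: "0 < e" "e < 1" for e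
  proof -
    have "modular N p (\<lambda>x. g x / 1) \<le> ennreal (e / 1) * modular N p (\<lambda>x. g x / e)"
      using e by (intro modular_scale_le assms) auto
    also have "modular N p (\<lambda>x. g x / e) \<le> 1"
      using e z g order_trans[OF zero_le_one p] by (intro modular_le_1_above) auto
    finally show ?thesis by (simp add: mult_left_mono)
  qed
  have eps: "modular N p (\<lambda>x. g x / 1) \<le> 0 + ennreal e" if "0 < e" for e
    using that order_trans[OF small[of "min e (1/2)"] ennreal_leI[of "min e (1/2)" e]] by simp
  have "modular N p (\<lambda>x. g x / 1) \<le> 0"
    by (rule ennreal_le_epsilon) (rule eps)
  then have "AE x in N. ennreal (g x powr p x) = 0"
    unfolding modular_def by (subst (asm) le_zero_eq, subst (asm) nn_integral_0_iff_AE) auto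
  then show ?thesis by eventually_elim (use g p in \<open>auto simp: ennreal_eq_0_iff\<close>)
qed

text \<open>
  The infimum that defines the norm is attained: all \<open>\<eta> > \<parallel>g\<parallel>\<close> are admissible, and Fatou's lemma
  passes to the limit \<open>\<eta> \<rightarrow> \<parallel>g\<parallel>\<close>.
\<close>
lemma modular_luxemburg_le_1:
  assumes [measurable]: "g \<in> borel_measurable N" "p \<in> borel_measurable N"
    and g: "\<And>x. 0 \<le> g x" and p: "\<And>x. 1 \<le> p x"
    and l: "luxemburg N p g = ennreal l" "0 < l"
  shows "modular N p (\<lambda>x. g x / l) \<le> 1"
proof -
  define e where "e k = l * (1 + 1 / real (Suc k))" for k
  have lim: "(\<lambda>k. (g x / e k) powr p x) \<longlonglongrightarrow> (g x / l) powr p x" for x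
  proof -
    have "(\<lambda>k. 1 / real (Suc k)) \<longlonglongrightarrow> 0" using LIMSEQ_Suc[OF lim_1_over_n] by simp
    then have "e \<longlonglongrightarrow> l * (1 + 0)" unfolding e_def by (intro tendsto_intros)
    then have "(\<lambda>k. g x / e k) \<longlonglongrightarrow> g x / l"
      using l by (intro tendsto_intros) auto
    then show ?thesis
      using g[of x] p[of x] l by (intro tendsto_powr2 tendsto_const) (auto simp: e_def intro!: always_eventually)
  qed
  have "modular N p (\<lambda>x. g x / l) = (\<integral>\<^sup>+x. liminf (\<lambda>k. ennreal ((g x / e k) powr p x)) \<partial>N)"
    unfolding modular_def
    by (intro nn_integral_cong lim_imp_Liminf[symmetric] tendsto_ennrealI lim) auto
  also have "\<dots> \<le> liminf (\<lambda>k. modular N p (\<lambda>x. g x / e k))"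
    unfolding modular_def by (intro nn_integral_liminf) measurable
  also have "\<dots> \<le> liminf (\<lambda>k::nat. 1)"
    using l g order_trans[OF zero_le_one p]
    by (intro Liminf_mono always_eventually allI modular_le_1_above)
       (auto simp: e_def ennreal_less_iff)
  finally show ?thesis by (simp add: Liminf_const)
qed

text \<open>
  The admissible \<open>\<eta>\<close> are upwards closed, so countably many of them decide whether the norm is below
  a given bound. This makes the norm a measurable function of a parameter.
\<close>
lemma luxemburg_less_iff:
  assumes "\<And>x. 0 \<le> g x" "\<And>x. 0 \<le> p x"
  shows "luxemburg N p g < y \<longleftrightarrow>
    (\<exists>r::rat. 0 < r \<and> ennreal (of_rat r) < y \<and> modular N p (\<lambda>x. g x / of_rat r) \<le> 1)"
proof
  assume "luxemburg N p g < y"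
  then obtain z where z: "luxemburg N p g < z" "z < y" using dense by blast
  then obtain a where a: "luxemburg N p g < ennreal a" "ennreal a < y" "0 < a"
    proof (cases z)
    case (real a)
    with z(1) have "a \<noteq> 0" by (intro notI) simp
    with real z that[of a] show ?thesis by auto
  qed (auto simp: top.not_eq_extremum)
  from a(1) obtain b where b: "0 < b" "modular N p (\<lambda>x. g x / b) \<le> 1" "b < a"
    unfolding luxemburg_def Inf_less_iff by (auto simp: ennreal_less_iff)
  obtain r where r: "b < of_rat r" "of_rat r < a" using of_rat_dense[OF b(3)] by auto
  have "modular N p (\<lambda>x. g x / of_rat r) \<le> modular N p (\<lambda>x. g x / b)"
    using r b by (intro modular_antimono_scale assms) auto
  moreover have "ennreal (of_rat r) < y"
    using r a b by (meson ennreal_leI less_eq_real_def order_le_less_trans)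
  moreover have "0 < r" using r b by (metis less_trans zero_less_of_rat_iff)
  ultimately show "\<exists>r::rat. 0 < r \<and> ennreal (of_rat r) < y \<and> modular N p (\<lambda>x. g x / of_rat r) \<le> 1"
    using b by (auto intro!: exI[of _ r])
next
  assume "\<exists>r::rat. 0 < r \<and> ennreal (of_rat r) < y \<and> modular N p (\<lambda>x. g x / of_rat r) \<le> 1"
  then show "luxemburg N p g < y" using luxemburg_le[of "of_rat _" N p g] by (auto intro: le_less_trans)
qed

lemma borel_measurable_luxemburg:
  assumes "sigma_finite_measure N"
    and F[measurable]: "(\<lambda>(t, x). F t x) \<in> borel_measurable (M \<Otimes>\<^sub>M N)"
    and [measurable]: "p \<in> borel_measurable N"
    and "\<And>t x. 0 \<le> F t x" "\<And>x. 0 \<le> p x"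
  shows "(\<lambda>t. luxemburg N p (F t)) \<in> borel_measurable M"
proof (rule borel_measurableI_less)
  fix y :: ennreal
  interpret N: sigma_finite_measure N by fact
  have "Measurable.pred M (\<lambda>t. luxemburg N p (F t) < y)"
    unfolding luxemburg_less_iff[OF assms(4,5)] modular_def by measurable
  then show "{t \<in> space M. luxemburg N p (F t) < y} \<in> sets M" by simp
qed

text \<open>
  The graph of \<open>h \<mapsto> h\<^sup>p\<close> lies above its tangent at \<open>b\<close>. With \<open>u = h/b\<close> this is convexity of the exponential
  function between \<open>0\<close> and \<open>p ln u\<close>.
\<close>
lemma powr_above_tangent:
  fixes b h p :: real
  assumes "1 \<le> p" "0 < b" "0 \<le> h"
  shows "p * b powr (p - 1) * h \<le> h powr p + (p - 1) * b powr p"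
proof (cases "h = 0")
  case True then show ?thesis using assms by simp
next
  case False
  define u where "u = h / b"
  have u: "0 < u" using False assms by (simp add: u_def)
  have "exp ((1 - 1/p) *\<^sub>R 0 + (1/p) *\<^sub>R (p * ln u)) \<le> (1 - 1/p) * exp 0 + (1/p) * exp (p * ln u)"
    using assms by (intro convex_onD[OF exp_convex[THEN convex_on_subset, of UNIV]]) (auto simp: field_simps)
  then have "u \<le> (1 - 1/p) + (1/p) * u powr p" using assms u by (simp add: powr_def)
  then have "p * u \<le> p * ((1 - 1/p) + (1/p) * u powr p)" using assms by (intro mult_left_mono) auto
  also have "\<dots> = (p - 1) + u powr p" using assms by (simp add: algebra_simps)
  finally have "p * u \<le> (p - 1) + u powr p" .
  then have "b powr p * (p * u) \<le> b powr p * ((p - 1) + u powr p)" by (intro mult_left_mono) auto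
  moreover have "b powr p * u powr p = h powr p"
    using assms u by (simp add: powr_mult[symmetric] u_def)
  moreover have "b powr p * u = b powr (p - 1) * h"
    using assms by (simp add: u_def powr_diff)
  ultimately show ?thesis by (simp add: algebra_simps)
qed

text \<open>
  Young's inequality without the sharp constants, for many factors at once: if \<open>S\<close> denotes the right-hand side, then
  \<open>a\<^sub>i\<close> is at most \<open>S\<close> to the power \<open>1/p\<^sub>i\<close>, and these exponents add up to \<open>1/s\<close>.
\<close>
lemma prod_powr_le_sum_powr:
  fixes a p :: "'i \<Rightarrow> real" and s :: real
  assumes "finite I" "I \<noteq> {}" and a: "\<And>i. i \<in> I \<Longrightarrow> 0 \<le> a i" and p: "\<And>i. i \<in> I \<Longrightarrow> 0 < p i"
    and s: "0 < s" "(\<Sum>i\<in>I. 1 / p i) = 1 / s"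
  shows "(\<Prod>i\<in>I. a i) powr s \<le> (\<Sum>i\<in>I. a i powr p i)"
proof -
  define S where "S = (\<Sum>i\<in>I. a i powr p i)"
  have le: "a i powr p i \<le> S" if "i \<in> I" for i
    unfolding S_def using that assms(1) by (intro member_le_sum) auto
  show ?thesis
  proof (cases "S = 0")
    case True
    obtain i where "i \<in> I" using assms(2) by auto
    with le[of i] True have "a i = 0" by simp
    with \<open>i \<in> I\<close> assms(1) have "(\<Prod>i\<in>I. a i) = 0" by auto
    with True show ?thesis unfolding S_def by simp
  next
    case False
    have "0 \<le> S" unfolding S_def by (intro sum_nonneg) auto
    with False have S: "0 < S" by simp
    have "a i \<le> S powr (1 / p i)" if "i \<in> I" for i
    proof -
      have "a i = (a i powr p i) powr (1 / p i)" using a[OF that] p[OF that] by (simp add: powr_powr)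
      also have "\<dots> \<le> S powr (1 / p i)" using le[OF that] p[OF that] by (intro powr_mono2) auto
      finally show ?thesis .
    qed
    then have "(\<Prod>i\<in>I. a i) \<le> (\<Prod>i\<in>I. S powr (1 / p i))" by (intro prod_mono) (auto simp: a)
    also have "\<dots> = S powr (1 / s)" using S s by (simp add: powr_sum[symmetric])
    finally have "(\<Prod>i\<in>I. a i) powr s \<le> (S powr (1 / s)) powr s"
      using s by (intro powr_mono2) (auto intro!: prod_nonneg a)
    then show ?thesis using S s by (simp add: powr_powr S_def)
  qed
qed

section \<open>The Minkowski integral inequality and the Hoelder inequality\<close>

text \<open>
  Jensen's inequality for the average of \<open>f/w\<close> with respect to the probability density \<open>w/L\<close>,
  obtained by integrating the tangent inequality at the point \<open>b = U/L\<close>, where \<open>U = \<integral>f\<close>. The tangent at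
  \<open>b = 1\<close> shows first that \<open>U\<close> is finite, which is part of the claim.
\<close>
lemma powr_average_le:
  fixes f w :: "'a \<Rightarrow> real"
  assumes [measurable]: "f \<in> borel_measurable M" "w \<in> borel_measurable M"
    and f: "\<And>t. 0 \<le> f t" and w: "\<And>t. 0 \<le> w t" and "1 \<le> p"
    and L: "(\<integral>\<^sup>+t. ennreal (w t) \<partial>M) = ennreal L" "0 < L"
    and z: "AE t in M. w t = 0 \<longrightarrow> f t = 0"
    and fin: "(\<integral>\<^sup>+t. ennreal ((f t / w t) powr p * w t) \<partial>M) < \<infinity>"
  shows "(\<integral>\<^sup>+t. ennreal (f t) \<partial>M) < \<infinity>"
    and "ennreal ((enn2real (\<integral>\<^sup>+t. ennreal (f t) \<partial>M) / L) powr p) * ennreal L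
      \<le> (\<integral>\<^sup>+t. ennreal ((f t / w t) powr p * w t) \<partial>M)"
proof -
  define V where "V = (\<integral>\<^sup>+t. ennreal ((f t / w t) powr p * w t) \<partial>M)"
  define U where "U = (\<integral>\<^sup>+t. ennreal (f t) \<partial>M)"
  have tang: "ennreal (p * b powr (p - 1)) * U \<le> V + ennreal ((p - 1) * b powr p) * ennreal L" if b: "0 < b" for b
  proof -
    have "ennreal (p * b powr (p - 1)) * U = (\<integral>\<^sup>+t. ennreal (p * b powr (p - 1)) * ennreal (f t) \<partial>M)"
      unfolding U_def by (rule nn_integral_cmult[symmetric]) measurable
    also have "\<dots> \<le> (\<integral>\<^sup>+t. ennreal ((f t / w t) powr p * w t) + ennreal ((p - 1) * b powr p) * ennreal (w t) \<partial>M)"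
    proof (rule nn_integral_mono_AE, use z in eventually_elim)
      fix t assume t: "w t = 0 \<longrightarrow> f t = 0"
      have "p * b powr (p - 1) * f t \<le> (f t / w t) powr p * w t + (p - 1) * b powr p * w t"
      proof (cases "w t = 0")
        case False
        with w[of t] have wt: "0 < w t" by simp
        have "p * b powr (p - 1) * (f t / w t) \<le> (f t / w t) powr p + (p - 1) * b powr p"
          using assms(5) b f wt by (intro powr_above_tangent) auto
        then have "(p * b powr (p - 1) * (f t / w t)) * w t \<le> ((f t / w t) powr p + (p - 1) * b powr p) * w t"
          using wt by (intro mult_right_mono) auto
        then show ?thesis using wt by (simp add: algebra_simps)
      qed (use t in auto)
      then show "ennreal (p * b powr (p - 1)) * ennreal (f t) \<le>
          ennreal ((f t / w t) powr p * w t) + ennreal ((p - 1) * b powr p) * ennreal (w t)"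
        using f w assms(5) by (simp add: ennreal_mult[symmetric] ennreal_plus[symmetric] del: ennreal_plus)
    qed
    also have "\<dots> = V + ennreal ((p - 1) * b powr p) * (\<integral>\<^sup>+t. ennreal (w t) \<partial>M)"
      unfolding V_def by (subst nn_integral_add) (auto simp: nn_integral_cmult)
    finally show ?thesis by (simp add: L)
  qed
  have "U < \<infinity>"
  proof (rule ccontr)
    assume "\<not> U < \<infinity>"
    then have "U = \<infinity>" by (simp add: less_top[symmetric])
    with tang[of 1] assms(5) have "V + ennreal (p - 1) * ennreal L = \<infinity>"
      by (simp add: ennreal_mult_top top_unique)
    with fin show False by (simp add: V_def ennreal_mult[symmetric] ennreal_add_eq_top ennreal_mult_eq_top_iff)
  qed
  then show "(\<integral>\<^sup>+t. ennreal (f t) \<partial>M) < \<infinity>" by (simp add: U_def)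
  obtain u where u: "U = ennreal u" "0 \<le> u" using \<open>U < \<infinity>\<close> by (cases U) auto
  obtain v where v: "V = ennreal v" "0 \<le> v" using fin by (cases V) (auto simp: V_def)
  have "(u / L) powr p * L \<le> v"
  proof (cases "u = 0")
    case False
    with u have u0: "0 < u" by simp
    have "ennreal (p * (u/L) powr (p - 1) * u) \<le> ennreal (v + (p - 1) * (u/L) powr p * L)"
      using tang[of "u/L"] u0 u v L assms(5)
      by (simp add: ennreal_mult[symmetric] ennreal_plus[symmetric] del: ennreal_plus)
    then have "p * (u/L) powr (p - 1) * u \<le> v + (p - 1) * (u/L) powr p * L"
      using v L assms(5) by (subst (asm) ennreal_le_iff) auto
    moreover have "(u/L) powr (p - 1) * u = (u/L) powr p * L"
      using u0 L by (simp add: powr_diff)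
    ultimately show ?thesis by (simp add: algebra_simps)
  qed (use v in auto)
  then show "ennreal ((enn2real (\<integral>\<^sup>+t. ennreal (f t) \<partial>M) / L) powr p) * ennreal L
      \<le> (\<integral>\<^sup>+t. ennreal ((f t / w t) powr p * w t) \<partial>M)"
    using u v L by (simp add: U_def[symmetric] V_def[symmetric] ennreal_mult[symmetric] ennreal_leI)
qed

text \<open>
  Divide \<open>F(t,\<sqdot>)\<close> by its norm \<open>w(t)\<close>, so that its modular becomes at most 1. The integral \<open>\<integral>F(t,x)dt\<close>, divided
  by \<open>L = \<integral>w\<close>, is the average of these quotients with respect to the density \<open>w/L\<close>. Jensen's
  inequality at each \<open>x\<close> and Tonelli's theorem bound its modular by the average of the modulars, hence by 1.
\<close>
theorem luxemburg_Minkowski: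
  fixes F :: "'a \<Rightarrow> 'b \<Rightarrow> real"
  assumes "sigma_finite_measure M" "sigma_finite_measure N"
    and F[measurable]: "(\<lambda>(t, x). F t x) \<in> borel_measurable (M \<Otimes>\<^sub>M N)"
    and p[measurable]: "p \<in> borel_measurable N"
    and F0: "\<And>t x. 0 \<le> F t x" and p1: "\<And>x. 1 \<le> p x"
    and fin: "(\<integral>\<^sup>+t. luxemburg N p (F t) \<partial>M) < \<infinity>"
  shows "AE x in N. (\<integral>\<^sup>+t. ennreal (F t x) \<partial>M) < \<infinity>"
    and "luxemburg N p (\<lambda>x. enn2real (\<integral>\<^sup>+t. ennreal (F t x) \<partial>M)) \<le> (\<integral>\<^sup>+t. luxemburg N p (F t) \<partial>M)"
proof -
  interpret M: sigma_finite_measure M by fact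
  interpret N: sigma_finite_measure N by fact
  interpret P: pair_sigma_finite M N ..
  have p0: "0 \<le> p x" for x using p1[of x] by simp
  have lux_meas[measurable]: "(\<lambda>t. luxemburg N p (F t)) \<in> borel_measurable M"
    by (rule borel_measurable_luxemburg) (use assms p0 in auto)
  define w where "w t = enn2real (luxemburg N p (F t))" for t
  have w[measurable]: "w \<in> borel_measurable M" and w0: "0 \<le> w t" for t
    unfolding w_def by auto
  have AE_fin: "AE t in M. luxemburg N p (F t) \<noteq> \<infinity>"
    using fin by (intro nn_integral_PInf_AE) auto
  have AE_eq: "AE t in M. luxemburg N p (F t) = ennreal (w t)"
    using AE_fin by eventually_elim (auto simp: w_def ennreal_enn2real_if)
  have int_w: "(\<integral>\<^sup>+t. ennreal (w t) \<partial>M) = (\<integral>\<^sup>+t. luxemburg N p (F t) \<partial>M)"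
    using AE_eq by (intro nn_integral_cong_AE) auto
  have zero_tx: "AE t in M. AE x in N. w t = 0 \<longrightarrow> F t x = 0"
    using AE_eq AE_space
  proof eventually_elim
    case (elim t)
    show ?case
    proof (cases "w t = 0")
      case True
      have [measurable]: "F t \<in> borel_measurable N" using elim(2) by measurable
      have "AE x in N. F t x = 0"
        using elim True by (intro luxemburg_zero_imp[OF _ p F0 p1]) auto
      then show ?thesis by eventually_elim auto
    qed auto
  qed
  have zero: "AE x in N. AE t in M. w t = 0 \<longrightarrow> F t x = 0"
    using zero_tx by (subst P.AE_commute[symmetric]) auto
  obtain L where L: "(\<integral>\<^sup>+t. ennreal (w t) \<partial>M) = ennreal L" "0 \<le> L"
    using fin unfolding int_w by (cases "\<integral>\<^sup>+t. luxemburg N p (F t) \<partial>M") auto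
  have "(AE x in N. (\<integral>\<^sup>+t. ennreal (F t x) \<partial>M) < \<infinity>) \<and>
    luxemburg N p (\<lambda>x. enn2real (\<integral>\<^sup>+t. ennreal (F t x) \<partial>M)) \<le> ennreal L"
  proof (cases "L = 0")
    case True
    with L(1) have "AE t in M. ennreal (w t) = 0" by (simp add: nn_integral_0_iff_AE)
    then have wz: "AE t in M. w t = 0" by eventually_elim (use w0 in \<open>auto simp: ennreal_eq_0_iff intro: antisym\<close>)
    have Z: "AE x in N. (\<integral>\<^sup>+t. ennreal (F t x) \<partial>M) = 0"
      using zero AE_space
    proof eventually_elim
      case (elim x)
      have [measurable]: "(\<lambda>t. F t x) \<in> borel_measurable M" using elim(2) by measurable
      have "AE t in M. ennreal (F t x) = 0" using elim(1) wz by eventually_elim auto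
      then show ?case using elim by (subst nn_integral_0_iff_AE) auto
    qed
    have small: "luxemburg N p (\<lambda>x. enn2real (\<integral>\<^sup>+t. ennreal (F t x) \<partial>M)) \<le> 0 + ennreal e" if "0 < e" for e
    proof -
      have "modular N p (\<lambda>x. enn2real (\<integral>\<^sup>+t. ennreal (F t x) \<partial>M) / e) = (\<integral>\<^sup>+x. 0 \<partial>N)"
        unfolding modular_def using Z by (intro nn_integral_cong_AE) (auto elim!: eventually_mono)
      then show ?thesis using that by (simp add: luxemburg_le)
    qed
    have "luxemburg N p (\<lambda>x. enn2real (\<integral>\<^sup>+t. ennreal (F t x) \<partial>M)) \<le> 0"
      by (rule ennreal_le_epsilon) (rule small)
    then show ?thesis using Z by (auto elim!: eventually_mono)
  next
    case False
    with L have L0: "0 < L" by simp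
    define V where "V x = (\<integral>\<^sup>+t. ennreal ((F t x / w t) powr p x * w t) \<partial>M)" for x
    have [measurable]: "V \<in> borel_measurable N"
      unfolding V_def by measurable
    have "(\<integral>\<^sup>+x. V x \<partial>N) = (\<integral>\<^sup>+t. (\<integral>\<^sup>+x. ennreal ((F t x / w t) powr p x * w t) \<partial>N) \<partial>M)"
      unfolding V_def by (rule P.Fubini') measurable
    also have "\<dots> \<le> (\<integral>\<^sup>+t. ennreal (w t) \<partial>M)"
    proof (rule nn_integral_mono_AE, use AE_eq AE_space in eventually_elim)
      fix t assume t: "luxemburg N p (F t) = ennreal (w t)" "t \<in> space M"
      have [measurable]: "F t \<in> borel_measurable N" using t(2) by measurable
      show "(\<integral>\<^sup>+x. ennreal ((F t x / w t) powr p x * w t) \<partial>N) \<le> ennreal (w t)"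
      proof (cases "w t = 0")
        case False
        with w0[of t] have wt: "0 < w t" by simp
        have "(\<integral>\<^sup>+x. ennreal ((F t x / w t) powr p x * w t) \<partial>N) = modular N p (\<lambda>x. F t x / w t) * ennreal (w t)"
          unfolding modular_def using wt
          by (subst nn_integral_multc[symmetric]) (auto simp: ennreal_mult)
        also have "\<dots> \<le> 1 * ennreal (w t)"
          using t wt by (intro mult_right_mono modular_luxemburg_le_1 F0 p1) auto
        finally show ?thesis by simp
      qed auto
    qed
    finally have V_int: "(\<integral>\<^sup>+x. V x \<partial>N) \<le> ennreal L" using L by simp
    have AE_V: "AE x in N. V x \<noteq> \<infinity>"
      using V_int by (intro nn_integral_PInf_AE) (auto simp: top_unique)
    have key: "AE x in N. (\<integral>\<^sup>+t. ennreal (F t x) \<partial>M) < \<infinity> \<and>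
        ennreal ((enn2real (\<integral>\<^sup>+t. ennreal (F t x) \<partial>M) / L) powr p x) * ennreal L \<le> V x"
      using AE_V zero AE_space
    proof eventually_elim
      case (elim x)
      have [measurable]: "(\<lambda>t. F t x) \<in> borel_measurable M" using elim(3) by measurable
      show ?case
        using powr_average_le[where f = "\<lambda>t. F t x" and w = w and p = "p x" and M = M and L = L] elim F0 w0 p1 L L0
        by (auto simp: V_def less_top[symmetric])
    qed
    have "modular N p (\<lambda>x. enn2real (\<integral>\<^sup>+t. ennreal (F t x) \<partial>M) / L) * ennreal L
        = (\<integral>\<^sup>+x. ennreal ((enn2real (\<integral>\<^sup>+t. ennreal (F t x) \<partial>M) / L) powr p x) * ennreal L \<partial>N)"
      unfolding modular_def by (rule nn_integral_multc[symmetric]) measurable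
    also have "\<dots> \<le> (\<integral>\<^sup>+x. V x \<partial>N)"
      using key by (intro nn_integral_mono_AE) (auto elim!: eventually_mono)
    also have "\<dots> \<le> ennreal L" by (rule V_int)
    finally have "modular N p (\<lambda>x. enn2real (\<integral>\<^sup>+t. ennreal (F t x) \<partial>M) / L) * ennreal L \<le> 1 * ennreal L"
      by simp
    then have "modular N p (\<lambda>x. enn2real (\<integral>\<^sup>+t. ennreal (F t x) \<partial>M) / L) \<le> 1"
      using L0 by (cases "modular N p (\<lambda>x. enn2real (\<integral>\<^sup>+t. ennreal (F t x) \<partial>M) / L)")
        (auto simp: ennreal_mult[symmetric] ennreal_top_mult top_unique)
    then show ?thesis
      using key L0 by (auto intro!: luxemburg_le elim!: eventually_mono)
  qed
  then show "AE x in N. (\<integral>\<^sup>+t. ennreal (F t x) \<partial>M) < \<infinity>"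
    "luxemburg N p (\<lambda>x. enn2real (\<integral>\<^sup>+t. ennreal (F t x) \<partial>M)) \<le> (\<integral>\<^sup>+t. luxemburg N p (F t) \<partial>M)"
    using L int_w by auto
qed

text \<open>
  Products of infima are awkward in \<^typ>\<open>ennreal\<close> because of \<open>0 \<sqdot> \<infinity>\<close>. With all factors finite, a bound by the product
  of arbitrary strictly larger reals passes to the limit.
\<close>
lemma le_prod_ennreal_finiteI:
  fixes X :: "'i \<Rightarrow> ennreal"
  assumes "finite I" and X: "\<And>i. i \<in> I \<Longrightarrow> X i < \<infinity>"
    and le: "\<And>y. (\<And>i. i \<in> I \<Longrightarrow> 0 < y i \<and> X i < ennreal (y i)) \<Longrightarrow> z \<le> ennreal (c * (\<Prod>i\<in>I. y i))"
    and "0 \<le> c"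
  shows "z \<le> ennreal c * (\<Prod>i\<in>I. X i)"
proof -
  define e where "e k = 1 / real (Suc k)" for k
  define y where "y k i = enn2real (X i) + e k" for k i
  have e: "e \<longlonglongrightarrow> 0" unfolding e_def using LIMSEQ_Suc[OF lim_1_over_n] by simp
  have Xi: "X i = ennreal (enn2real (X i))" if "i \<in> I" for i using X[OF that] by simp
  have "z \<le> ennreal (c * (\<Prod>i\<in>I. y k i))" for k
  proof (rule le)
    fix i assume "i \<in> I"
    have "0 < e k" by (simp add: e_def)
    then show "0 < y k i \<and> X i < ennreal (y k i)"
      by (subst Xi[OF \<open>i \<in> I\<close>]) (auto simp: y_def ennreal_less_iff add_nonneg_pos)
  qed
  moreover have "(\<lambda>k. ennreal (c * (\<Prod>i\<in>I. y k i))) \<longlonglongrightarrow> ennreal (c * (\<Prod>i\<in>I. enn2real (X i) + 0))"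
    unfolding y_def by (intro tendsto_ennrealI tendsto_intros e)
  ultimately have "z \<le> ennreal (c * (\<Prod>i\<in>I. enn2real (X i) + 0))"
    by (intro LIMSEQ_le_const) auto
  also have "\<dots> = ennreal c * (\<Prod>i\<in>I. ennreal (enn2real (X i)))"
    using assms(4) by (simp add: ennreal_mult prod_nonneg prod_ennreal)
  also have "\<dots> = ennreal c * (\<Prod>i\<in>I. X i)"
    by (intro arg_cong2[of _ _ _ _ "(*)"] prod.cong refl Xi[symmetric])
  finally show ?thesis .
qed

lemma luxemburg_cmult_le:
  assumes "0 \<le> c" "\<And>x. 0 \<le> g x" "\<And>x. 0 \<le> p x"
  shows "luxemburg N p (\<lambda>x. c * g x) \<le> ennreal c * luxemburg N p g"
proof (cases "c = 0 \<or> luxemburg N p g = \<infinity>")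
  case True
  then show ?thesis
  proof (cases "c = 0")
    case True
    have "luxemburg N p (\<lambda>x. c * g x) \<le> 0 + ennreal e" if "0 < e" for e
      using that True by (simp add: luxemburg_le modular_def)
    then have "luxemburg N p (\<lambda>x. c * g x) \<le> 0" by (rule ennreal_le_epsilon)
    then show ?thesis by simp
  qed (use assms(1) in \<open>auto simp: ennreal_mult_top\<close>)
next
  case False
  then have c: "0 < c" using assms(1) by simp
  have "luxemburg N p (\<lambda>x. c * g x) \<le> ennreal c * (\<Prod>i\<in>{()}. luxemburg N p g)"
  proof (rule le_prod_ennreal_finiteI)
    fix y :: "unit \<Rightarrow> real" assume "\<And>i. i \<in> {()} \<Longrightarrow> 0 < y i \<and> luxemburg N p g < ennreal (y i)"
    then have y: "0 < y ()" "luxemburg N p g < ennreal (y ())" by auto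
    have "modular N p (\<lambda>x. c * g x / (c * y ())) \<le> 1"
      using modular_le_1_above[OF y(2) assms(2,3)] c by simp
    then show "luxemburg N p (\<lambda>x. c * g x) \<le> ennreal (c * (\<Prod>i\<in>{()}. y i))"
      using c y by (intro luxemburg_le) auto
  qed (use False assms in \<open>auto simp: less_top\<close>)
  then show ?thesis by simp
qed

text \<open>
  After normalising each \<open>g\<^sub>i\<close> to modular at most 1, Young's inequality bounds the modular of the product by the
  number of factors.
\<close>
theorem luxemburg_prod_le:
  fixes p :: "'i \<Rightarrow> 'a \<Rightarrow> real" and g :: "'i \<Rightarrow> 'a \<Rightarrow> real"
  assumes I: "finite I" "I \<noteq> {}"
    and [measurable]: "\<And>i. i \<in> I \<Longrightarrow> g i \<in> borel_measurable N" "\<And>i. i \<in> I \<Longrightarrow> p i \<in> borel_measurable N"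
      "s \<in> borel_measurable N"
    and g: "\<And>i x. i \<in> I \<Longrightarrow> 0 \<le> g i x" and p: "\<And>i x. i \<in> I \<Longrightarrow> 1 \<le> p i x" and s: "\<And>x. 1 \<le> s x"
    and eq: "\<And>x. (\<Sum>i\<in>I. 1 / p i x) = 1 / s x"
    and fin: "\<And>i. i \<in> I \<Longrightarrow> luxemburg N (p i) (g i) < \<infinity>"
  shows "luxemburg N s (\<lambda>x. \<Prod>i\<in>I. g i x) \<le> ennreal (card I) * (\<Prod>i\<in>I. luxemburg N (p i) (g i))"
proof (rule le_prod_ennreal_finiteI[OF I(1) fin])
  fix y assume y: "\<And>i. i \<in> I \<Longrightarrow> 0 < y i \<and> luxemburg N (p i) (g i) < ennreal (y i)"
  define Y where "Y = (\<Prod>i\<in>I. y i)"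
  have Y: "0 < Y" unfolding Y_def using y by (intro prod_pos) auto
  have c: "1 \<le> card I" using I by (simp add: Suc_le_eq card_gt_0_iff)
  have pnn: "0 \<le> p i x" if "i \<in> I" for i x using p[OF that, of x] by simp
  have "modular N s (\<lambda>x. (\<Prod>i\<in>I. g i x) / (card I * Y)) \<le>
      ennreal (Y / (card I * Y)) * modular N s (\<lambda>x. (\<Prod>i\<in>I. g i x) / Y)"
    using Y c by (intro modular_scale_le s prod_nonneg g) auto
  also have "modular N s (\<lambda>x. (\<Prod>i\<in>I. g i x) / Y) \<le> (\<Sum>i\<in>I. modular N (p i) (\<lambda>x. g i x / y i))"
  proof -
    have "((\<Prod>i\<in>I. g i x) / Y) powr s x \<le> (\<Sum>i\<in>I. (g i x / y i) powr p i x)" for x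
    proof -
      have "(\<Prod>i\<in>I. g i x / y i) powr s x \<le> (\<Sum>i\<in>I. (g i x / y i) powr p i x)"
        using g y p s[of x] eq by (intro prod_powr_le_sum_powr I) (auto intro: less_le_trans[OF zero_less_one] simp: less_imp_le)
      then show ?thesis by (simp add: Y_def prod_dividef)
    qed
    then have "modular N s (\<lambda>x. (\<Prod>i\<in>I. g i x) / Y) \<le> (\<integral>\<^sup>+x. (\<Sum>i\<in>I. ennreal ((g i x / y i) powr p i x)) \<partial>N)"
      unfolding modular_def by (intro nn_integral_mono) (simp add: sum_ennreal ennreal_leI)
    also have "\<dots> = (\<Sum>i\<in>I. modular N (p i) (\<lambda>x. g i x / y i))"
      unfolding modular_def by (rule nn_integral_sum) measurable
    finally show ?thesis .
  qed
  also have "(\<Sum>i\<in>I. modular N (p i) (\<lambda>x. g i x / y i)) \<le> (\<Sum>i\<in>I. 1)"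
    using y g pnn by (intro sum_mono modular_le_1_above) auto
  also have "ennreal (Y / (card I * Y)) * (\<Sum>i\<in>I. 1) = 1"
    using Y c by (simp add: ennreal_of_nat_eq_real_of_nat ennreal_mult[symmetric])
  finally show "luxemburg N s (\<lambda>x. \<Prod>i\<in>I. g i x) \<le> ennreal (card I * (\<Prod>i\<in>I. y i))"
    using Y c unfolding Y_def[symmetric] by (intro luxemburg_le) (auto simp: mult_left_mono)
qed auto

section \<open>Linear substitutions in Lebesgue measure\<close>

lemma norm_matrix_vector_mult_le:
  fixes A :: "real^'n^'m"
  shows "norm (A *v x) \<le> norm A * norm x"
proof -
  have "norm ((A *v x) $ i) \<le> norm (A $ i) * norm x" for i
    by (simp add: matrix_vector_mul_component Cauchy_Schwarz_ineq2)
  then have "norm (A *v x) \<le> L2_set (\<lambda>i. norm (A $ i) * norm x) UNIV"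
    unfolding norm_vec_def[of "A *v x"] by (intro L2_set_mono) auto
  also have "\<dots> = norm A * norm x"
    unfolding norm_vec_def[of A] by (rule L2_set_left_distrib[symmetric]) simp
  finally show ?thesis .
qed

lemma sigma_finite_lebesgue: "sigma_finite_measure (lebesgue :: 'a::euclidean_space measure)"
proof
  obtain A :: "'a set set" where A: "countable A" "A \<subseteq> sets lborel" "\<Union>A = space lborel"
      "\<forall>a\<in>A. emeasure lborel a \<noteq> \<infinity>"
    using lborel.sigma_finite_countable by blast
  then show "\<exists>A::'a set set. countable A \<and> A \<subseteq> sets lebesgue \<and> \<Union>A = space lebesgue \<and> (\<forall>a\<in>A. emeasure lebesgue a \<noteq> \<infinity>)"
    by (intro exI[of _ A]) (auto simp: subset_iff)
qed

text \<open>
  The Jacobian bound for a bijective linear substitution, without determinants. For a second function \<open>k\<close>,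
  consider the double integral of \<open>h(Ax) k(y - Ax)\<close>. Integrated over \<open>y\<close> first, it is \<open>\<integral>h(Ax)dx \<sqdot> \<integral>k\<close>.
  After shifting \<open>x\<close> by \<open>By\<close> the integrand is \<open>h(y + Ax) k(-Ax)\<close>, and integrated over \<open>y\<close> first it is
  \<open>\<integral>h \<sqdot> \<integral>k(-Ax)dx\<close>. For the indicator \<open>k\<close> of the unit ball, the last factor is at most the volume of the ball
  of radius \<open>b\<close>.
\<close>
lemma nn_integral_linear_le_borel:
  fixes A B :: "'a::euclidean_space \<Rightarrow> 'a" and h :: "'a \<Rightarrow> ennreal"
  assumes lin: "linear A" and AB: "\<And>x. A (B x) = x" and BA: "\<And>x. B (A x) = x"
    and b: "0 \<le> b" "\<And>x. norm (B x) \<le> b * norm x"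
    and h[measurable]: "h \<in> borel_measurable borel"
  shows "(\<integral>\<^sup>+x. h (A x) \<partial>lborel) \<le> ennreal (b ^ DIM('a)) * (\<integral>\<^sup>+x. h x \<partial>lborel)"
proof -
  define k :: "'a \<Rightarrow> ennreal" where "k = indicator (ball 0 1)"
  define v where "v = unit_ball_vol (real DIM('a))"
  have v: "0 < v" unfolding v_def by simp
  have [measurable]: "k \<in> borel_measurable borel" unfolding k_def by (intro borel_measurable_indicator) auto
  have [measurable]: "(\<lambda>x. A x) \<in> borel_measurable borel"
    using lin by (intro borel_measurable_continuous_onI linear_continuous_on) (simp add: linear_linear)
  have shift: "(\<integral>\<^sup>+y. f (c + y) \<partial>lborel) = (\<integral>\<^sup>+y. f y \<partial>lborel)"
    if [measurable]: "f \<in> borel_measurable borel" for f :: "'a \<Rightarrow> ennreal" and c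
    by (subst (2) lborel_distr_plus[of c, symmetric], subst nn_integral_distr) auto
  have int_k: "(\<integral>\<^sup>+x. k x \<partial>lborel) = ennreal v"
    by (simp add: k_def v_def emeasure_ball)
  have "ennreal v * (\<integral>\<^sup>+x. h (A x) \<partial>lborel) = (\<integral>\<^sup>+x. h (A x) * (\<integral>\<^sup>+y. k (- (A x) + y) \<partial>lborel) \<partial>lborel)"
    by (simp only: shift[OF \<open>k \<in> _\<close>] int_k) (simp add: nn_integral_cmult mult.commute)
  also have "\<dots> = (\<integral>\<^sup>+x. (\<integral>\<^sup>+y. h (A x) * k (- (A x) + y) \<partial>lborel) \<partial>lborel)"
    by (subst nn_integral_cmult) auto
  also have "\<dots> = (\<integral>\<^sup>+y. (\<integral>\<^sup>+x. h (A x) * k (- (A x) + y) \<partial>lborel) \<partial>lborel)"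
    by (rule lborel_pair.Fubini'[symmetric]) measurable
  also have "\<dots> = (\<integral>\<^sup>+y. (\<integral>\<^sup>+x. h (y + A x) * k (- (A x)) \<partial>lborel) \<partial>lborel)"
  proof (rule nn_integral_cong)
    fix y
    have "(\<integral>\<^sup>+x. h (A x) * k (- (A x) + y) \<partial>lborel) =
        (\<integral>\<^sup>+x. h (A (B y + x)) * k (- (A (B y + x)) + y) \<partial>lborel)"
      by (rule shift[symmetric]) measurable
    then show "(\<integral>\<^sup>+x. h (A x) * k (- (A x) + y) \<partial>lborel) = (\<integral>\<^sup>+x. h (y + A x) * k (- (A x)) \<partial>lborel)"
      by (simp add: linear_add[OF lin] AB)
  qed
  also have "\<dots> = (\<integral>\<^sup>+x. (\<integral>\<^sup>+y. h (y + A x) * k (- (A x)) \<partial>lborel) \<partial>lborel)"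
    by (rule lborel_pair.Fubini') measurable
  also have "\<dots> = (\<integral>\<^sup>+x. (\<integral>\<^sup>+y. h y \<partial>lborel) * k (- (A x)) \<partial>lborel)"
  proof (rule nn_integral_cong)
    fix x
    have "(\<integral>\<^sup>+y. h (y + A x) \<partial>lborel) = (\<integral>\<^sup>+y. h y \<partial>lborel)"
      using shift[OF h, of "A x"] by (simp add: add.commute)
    then show "(\<integral>\<^sup>+y. h (y + A x) * k (- (A x)) \<partial>lborel) = (\<integral>\<^sup>+y. h y \<partial>lborel) * k (- (A x))"
      by (simp add: nn_integral_multc)
  qed
  also have "\<dots> = (\<integral>\<^sup>+y. h y \<partial>lborel) * (\<integral>\<^sup>+x. k (- (A x)) \<partial>lborel)"
    by (rule nn_integral_cmult) measurable
  finally have eq: "ennreal v * (\<integral>\<^sup>+x. h (A x) \<partial>lborel) =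
      (\<integral>\<^sup>+y. h y \<partial>lborel) * (\<integral>\<^sup>+x. k (- (A x)) \<partial>lborel)" .
  have "(\<integral>\<^sup>+x. k (- (A x)) \<partial>lborel) \<le> (\<integral>\<^sup>+x. indicator (cball (0::'a) b) x \<partial>lborel)"
  proof (rule nn_integral_mono)
    fix x
    have "norm x \<le> b" if "norm (A x) < 1"
    proof -
      have "norm x \<le> b * norm (A x)"
        using b(2)[of "A x"] by (simp add: BA)
      also have "\<dots> \<le> b * 1" using that b(1) by (intro mult_left_mono) auto
      finally show ?thesis by simp
    qed
    then show "k (- (A x)) \<le> indicator (cball 0 b) x"
      by (auto simp: k_def indicator_def)
  qed
  also have "\<dots> = ennreal (v * b ^ DIM('a))"
    using b(1) by (simp add: emeasure_cball v_def)
  finally have "ennreal v * (\<integral>\<^sup>+x. h (A x) \<partial>lborel) \<le> (\<integral>\<^sup>+y. h y \<partial>lborel) * ennreal (v * b ^ DIM('a))"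
    unfolding eq by (intro mult_left_mono) auto
  then have "ennreal v * (\<integral>\<^sup>+x. h (A x) \<partial>lborel) \<le> ennreal v * (ennreal (b ^ DIM('a)) * (\<integral>\<^sup>+x. h x \<partial>lborel))"
    using v b(1) by (simp add: ennreal_mult mult_ac)
  then show ?thesis using v by (subst (asm) ennreal_mult_le_mult_iff) auto
qed

context
  fixes A B :: "real^'n^'n"
  assumes AB: "\<And>x. A *v (B *v x) = x" and BA: "\<And>x. B *v (A *v x) = x"
begin

text \<open>
  Preimages of null sets are null. This makes it possible to substitute in Lebesgue measurable functions, which
  are Borel functions only up to null sets.
\<close>
lemma linear_vimage_null_sets:
  assumes "N \<in> null_sets lborel"
  shows "{x. A *v x \<in> N} \<in> null_sets lborel"
proof -
  have [measurable]: "(\<lambda>x. A *v x) \<in> borel_measurable borel"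
    by (intro borel_measurable_continuous_onI linear_continuous_on matrix_vector_mul_bounded_linear)
  have [measurable]: "N \<in> sets borel" using assms by (auto simp: null_sets_def)
  have "(\<integral>\<^sup>+x. indicator N (A *v x) \<partial>lborel) \<le> ennreal (norm B ^ CARD('n)) * (\<integral>\<^sup>+x. indicator N x \<partial>lborel)"
    using nn_integral_linear_le_borel[OF matrix_vector_mul_linear[of A] AB BA norm_ge_zero norm_matrix_vector_mult_le,
      of "indicator N"] by simp
  also have "\<dots> = 0" using assms by (simp add: null_setsD1)
  also have "(\<integral>\<^sup>+x. indicator N (A *v x) \<partial>lborel) = (\<integral>\<^sup>+x. indicator {x. A *v x \<in> N} x \<partial>lborel)"
    by (intro nn_integral_cong) (auto simp: indicator_def)
  also have "\<dots> = emeasure lborel {x. A *v x \<in> N}"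
    by (rule nn_integral_indicator) measurable
  finally show ?thesis by (auto simp: null_sets_def)
qed

lemma measurable_linear_lebesgue: "(\<lambda>x. A *v x) \<in> lebesgue \<rightarrow>\<^sub>M lebesgue"
proof (rule completion.measurable_completion2)
  show "(\<lambda>x. A *v x) \<in> lebesgue \<rightarrow>\<^sub>M lborel"
    by (intro measurable_completion)
      (simp add: borel_measurable_continuous_onI linear_continuous_on matrix_vector_mul_bounded_linear)
  then have f: "(\<lambda>x. A *v x) \<in> lebesgue \<rightarrow>\<^sub>M lborel" .
  show "null_sets lborel \<subseteq> null_sets (distr lebesgue lborel (\<lambda>x. A *v x))"
  proof
    fix N :: "(real^'n) set" assume N: "N \<in> null_sets lborel"
    have "(\<lambda>x. A *v x) -` N \<inter> space lebesgue \<in> null_sets lebesgue"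
      using linear_vimage_null_sets[OF N] by (intro null_sets_completionI) (simp add: vimage_def)
    then show "N \<in> null_sets (distr lebesgue lborel (\<lambda>x. A *v x))"
      using N f by (auto simp: null_sets_def emeasure_distr)
  qed
qed

lemma AE_lebesgue_linear:
  assumes "AE x in lebesgue. P x"
  shows "AE x in lebesgue. P (A *v x)"
proof -
  from assms have "AE x in lborel. P x" by (simp add: AE_completion_iff)
  then obtain N where N: "{x. \<not> P x} \<subseteq> N" "N \<in> null_sets lborel"
    by (auto simp: eventually_ae_filter)
  have "AE x in lborel. P (A *v x)"
    by (rule AE_I'[OF linear_vimage_null_sets[OF N(2)]]) (use N(1) in auto)
  then show ?thesis by (rule AE_completion)
qed

lemma nn_integral_linear_le:
  assumes h: "h \<in> borel_measurable lebesgue"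
  shows "(\<integral>\<^sup>+x. h (A *v x) \<partial>lebesgue) \<le> ennreal (norm B ^ CARD('n)) * (\<integral>\<^sup>+x. h x \<partial>lebesgue)"
proof -
  obtain g where g: "g \<in> borel_measurable lborel" "AE x in lborel. h x = g x"
    using completion_ex_borel_measurable[OF h] by auto
  have AE: "AE x in lebesgue. h x = g x" using g(2) by (rule AE_completion)
  have "(\<integral>\<^sup>+x. h (A *v x) \<partial>lebesgue) = (\<integral>\<^sup>+x. g (A *v x) \<partial>lebesgue)"
    using AE_lebesgue_linear[OF AE] by (rule nn_integral_cong_AE)
  also have "\<dots> \<le> ennreal (norm B ^ CARD('n)) * (\<integral>\<^sup>+x. g x \<partial>lebesgue)"
    unfolding nn_integral_completion
    using g(1) nn_integral_linear_le_borel[OF matrix_vector_mul_linear[of A] AB BA norm_ge_zero norm_matrix_vector_mult_le]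
    by simp
  also have "(\<integral>\<^sup>+x. g x \<partial>lebesgue) = (\<integral>\<^sup>+x. h x \<partial>lebesgue)"
    using AE by (intro nn_integral_cong_AE) auto
  finally show ?thesis .
qed

end

lemma invertible_matrix_inv_apply:
  fixes B :: "real^'n^'n"
  assumes "invertible B"
  shows "B *v (matrix_inv B *v x) = x" "matrix_inv B *v (B *v x) = x"
  using someI_ex[OF assms[unfolded invertible_def]]
  by (simp_all add: matrix_vector_mul_assoc matrix_inv_def)

lemma borel_measurable_norm_lebesgue: "norm \<in> borel_measurable (lebesgue :: ('a::euclidean_space) measure)"
  by (intro measurable_completion) simp

lemma AE_lebesgue_nonzero: "AE x in (lebesgue :: (real^'n) measure). x \<noteq> 0"
  by (rule AE_completion) (rule AE_I'[of "{0}"], auto)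

text \<open>
  With condition number at most \<open>\<rho>\<close>, a matrix stretches every vector by its norm up to the factor \<open>\<rho>\<close>, and so
  does its inverse.
\<close>
lemma norm_bounds_invertible:
  fixes B :: "real^'n^'n"
  assumes "invertible B" "norm B * norm (matrix_inv B) \<le> \<rho>"
  shows "0 < norm B" "0 < norm (matrix_inv B)" "1 \<le> norm B * norm (matrix_inv B)"
    and "norm (B *v x) \<le> norm B * norm x" "norm B * norm x \<le> \<rho> * norm (B *v x)"
    and "norm (matrix_inv B *v x) \<le> norm (matrix_inv B) * norm x"
      "norm (matrix_inv B) * norm x \<le> \<rho> * norm (matrix_inv B *v x)"
proof -
  let ?I = "matrix_inv B"
  obtain e :: "real^'n" where e: "norm e = 1" using norm_axis_1 by blast
  have "norm e \<le> norm B * (norm ?I * norm e)"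
    using norm_matrix_vector_mult_le[of B "?I *v e"] norm_matrix_vector_mult_le[of ?I e]
    by (simp add: invertible_matrix_inv_apply[OF assms(1)] order_trans mult_left_mono)
  then show one: "1 \<le> norm B * norm ?I" using e by simp
  then show "0 < norm B" "0 < norm ?I"
    by (auto intro!: Nat.gr0I simp: zero_less_mult_iff less_le_trans[OF zero_less_one])
  show "norm (B *v x) \<le> norm B * norm x" "norm (?I *v x) \<le> norm ?I * norm x"
    by (rule norm_matrix_vector_mult_le)+
  have "norm B * norm x \<le> norm B * (norm ?I * norm (B *v x))"
    using norm_matrix_vector_mult_le[of ?I "B *v x"]
    by (simp add: invertible_matrix_inv_apply[OF assms(1)] mult_left_mono)
  also have "\<dots> \<le> \<rho> * norm (B *v x)" using mult_right_mono[OF assms(2), of "norm (B *v x)"] by (simp add: mult.assoc)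
  finally show "norm B * norm x \<le> \<rho> * norm (B *v x)" .
  have "norm ?I * norm x \<le> norm ?I * (norm B * norm (?I *v x))"
    using norm_matrix_vector_mult_le[of B "?I *v x"]
    by (simp add: invertible_matrix_inv_apply[OF assms(1)] mult_left_mono)
  also have "\<dots> \<le> \<rho> * norm (?I *v x)" using mult_right_mono[OF assms(2), of "norm (?I *v x)"] by (simp add: mult_ac)
  finally show "norm ?I * norm x \<le> \<rho> * norm (?I *v x)" .
qed

section \<open>Dilations in variable exponent spaces\<close>

text \<open>
  For finite exponents the supremum part of the modular is taken over the empty set.
\<close>
lemma var_modular_eq_modular:
  assumes "\<And>x. q x \<noteq> \<infinity>"
  shows "var_modular q g = modular lebesgue (\<lambda>x. enn2real (q x)) (\<lambda>x. norm (g x))"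
proof -
  have fin: "{x. q x \<noteq> \<infinity>} = UNIV" "{x. q x = \<infinity>} = {}" using assms by auto
  have "esssup (restrict_space lebesgue {}) (\<lambda>x. ennreal (norm (g x))) = 0"
    by (simp add: esssup_def ae_filter_eq_bot_iff[THEN iffD2] measurable_def space_restrict_space
        bot_ennreal emeasure_restrict_space)
  then show ?thesis unfolding var_modular_def modular_def fin by simp
qed

lemma var_norm_eq_luxemburg:
  assumes "\<And>x. q x \<noteq> \<infinity>"
  shows "var_norm q f = luxemburg lebesgue (\<lambda>x. enn2real (q x)) (\<lambda>x. norm (f x))"
proof -
  have "var_modular q (\<lambda>x. f x / complex_of_real \<eta>) =
      modular lebesgue (\<lambda>x. enn2real (q x)) (\<lambda>x. norm (f x) / \<eta>)" if "0 < \<eta>" for \<eta>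
    unfolding var_modular_eq_modular[OF assms] using that by (simp add: norm_divide)
  then show ?thesis unfolding var_norm_def luxemburg_def by (metis (no_types, lifting))
qed

lemma wvar_norm_eq_luxemburg:
  assumes "\<And>x. q x \<noteq> \<infinity>"
  shows "wvar_norm q (power_weight \<gamma>) g = luxemburg lebesgue (\<lambda>x. enn2real (q x)) (\<lambda>x. norm (g x) * norm x powr \<gamma>)"
  unfolding wvar_norm_def var_norm_eq_luxemburg[OF assms] by (simp add: power_weight_def norm_mult)

lemma bdd_var_exponentsD:
  assumes "q \<in> bdd_var_exponents"
  shows "q \<in> borel_measurable lebesgue" and "q x \<noteq> \<infinity>" and "q x = ennreal (enn2real (q x))"
    and "1 < enn2real (essinf lebesgue q)" and "enn2real (essinf lebesgue q) \<le> enn2real (q x)"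
    and "enn2real (q x) \<le> enn2real (esssup lebesgue q)" and "1 \<le> enn2real (q x)"
    and "essinf lebesgue q = ennreal (enn2real (essinf lebesgue q))"
    and "esssup lebesgue q = ennreal (enn2real (esssup lebesgue q))"
proof -
  let ?a = "essinf lebesgue q" and ?b = "esssup lebesgue q"
  have q: "1 < ?a" "?b < \<infinity>" "?a \<le> q x" "q x \<le> ?b" and m: "q \<in> borel_measurable lebesgue"
    using assms by (auto simp: bdd_var_exponents_def var_exponents_def)
  obtain b where b: "?b = ennreal b" "0 \<le> b" using q(2) by (cases ?b) auto
  obtain p where p: "q x = ennreal p" "0 \<le> p" using q(4) b by (cases "q x") (auto simp: top_unique)
  obtain a where a: "?a = ennreal a" "0 \<le> a" using q(3) p by (cases ?a) (auto simp: top_unique)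
  have "1 < a" using q(1) a by (metis ennreal_1 ennreal_less_iff zero_le_one)
  moreover have "a \<le> p" "p \<le> b" using q(3,4) a b p by simp_all
  ultimately show "q \<in> borel_measurable lebesgue" "q x \<noteq> \<infinity>" "q x = ennreal (enn2real (q x))"
    "1 < enn2real (essinf lebesgue q)" "enn2real (essinf lebesgue q) \<le> enn2real (q x)"
    "enn2real (q x) \<le> enn2real (esssup lebesgue q)" "1 \<le> enn2real (q x)"
    "essinf lebesgue q = ennreal (enn2real (essinf lebesgue q))"
    "esssup lebesgue q = ennreal (enn2real (esssup lebesgue q))"
    using m by (simp_all add: a b p)
qed

text \<open>
  The pointwise form of Hoelder's inequality with the constant function \<open>1/a\<close> and the exponent \<open>1/r = 1/s - 1/p\<close>.
  Where \<open>s = p\<close>, the exponent \<open>r\<close> is infinite and the constant itself has to be at most 1.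
\<close>
lemma Hoelder_powr_le:
  fixes a v s p :: real
  assumes "0 < a" "0 \<le> v" "0 < s" "s \<le> p" and a1: "s = p \<Longrightarrow> 1 / a \<le> 1"
  shows "(v / a) powr s \<le> (if s = p then 0 else (1 / a) powr (1 / (1 / s - 1 / p))) + v powr p"
proof (cases "s = p")
  case True
  have "(v / a) powr s \<le> v powr s"
    using assms True mult_left_mono[OF a1[OF True], of v] by (intro powr_mono2) auto
  with True show ?thesis by simp
next
  case False
  let ?r = "1 / (1 / s - 1 / p)"
  have r: "0 < 1 / s - 1 / p" using assms False by (simp add: divide_strict_left_mono)
  have "(\<Prod>i\<in>(UNIV::bool set). if i then v else 1 / a) powr s \<le>
      (\<Sum>i\<in>(UNIV::bool set). (if i then v else 1 / a) powr (if i then p else ?r))"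
    using assms r by (intro prod_powr_le_sum_powr) (auto simp: UNIV_bool)
  then show ?thesis using False by (simp add: UNIV_bool add.commute)
qed

lemma quot_exponent_eq:
  assumes "q (matrix_inv B *v x) = ennreal s" "q x = ennreal p" "0 < s" "s \<le> p"
  shows "quot_exponent 1 q B x = (if s = p then \<infinity> else ennreal (1 / (1 / s - 1 / p)))"
proof -
  have "1 / q (matrix_inv B *v x) - 1 / (ennreal 1 * q x) = ennreal (1 / s - 1 / p)"
  proof -
    have "1 / ennreal s = ennreal (1 / s)" "1 / ennreal p = ennreal (1 / p)"
      using assms(3,4) divide_ennreal[of 1 s] divide_ennreal[of 1 p] by simp_all
    then show ?thesis using assms by (simp add: ennreal_minus)
  qed
  then have *: "quot_exponent 1 q B x = inverse (ennreal (1 / s - 1 / p))"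
    unfolding quot_exponent_def by simp
  show ?thesis
  proof (cases "s = p")
    case False
    then have "0 < 1 / s - 1 / p" using assms by (simp add: divide_strict_left_mono)
    then show ?thesis unfolding * using False by (simp add: inverse_ennreal inverse_eq_divide)
  qed (simp add: *)
qed

lemma powr_comparable:
  fixes x y e \<rho> :: real
  assumes "0 < x" "0 < y" "x \<le> \<rho> * y" "y \<le> \<rho> * x"
  shows "x powr e \<le> \<rho> powr \<bar>e\<bar> * y powr e"
proof -
  have \<rho>: "0 < \<rho>" using assms by (metis less_le_trans zero_less_mult_pos2)
  show ?thesis
  proof (cases "0 \<le> e")
    case True
    have "x powr e \<le> (\<rho> * y) powr e" using assms True by (intro powr_mono2) auto
    then show ?thesis using True by (simp add: powr_mult)
  next
    case False
    have "x powr e \<le> (y / \<rho>) powr e"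
      using assms False \<rho> by (intro powr_mono2') (auto simp: field_simps)
    then show ?thesis using False assms \<rho> by (simp add: powr_divide powr_minus field_simps)
  qed
qed

lemma norm_matrix_inv_powr_le:
  fixes B :: "real^'n^'n"
  assumes B: "invertible B" "norm B * norm (matrix_inv B) \<le> \<rho>" and "1 \<le> \<rho>" "x \<noteq> 0"
  shows "norm (matrix_inv B *v x) powr \<gamma> \<le> \<rho> powr \<bar>\<gamma>\<bar> * norm (matrix_inv B) powr \<gamma> * norm x powr \<gamma>"
proof -
  note b = norm_bounds_invertible[OF B]
  define u where "u = norm (matrix_inv B) * norm x"
  have u: "0 < u" using b(2) assms(4) by (simp add: u_def)
  have w: "norm (matrix_inv B *v x) \<le> u" "u \<le> \<rho> * norm (matrix_inv B *v x)"
    using b(6,7)[of x] by (auto simp: u_def)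
  have "0 < norm (matrix_inv B *v x)" using less_le_trans[OF u w(2)] assms(3) by (auto simp: zero_less_mult_iff)
  moreover have "norm (matrix_inv B *v x) \<le> \<rho> * u"
    using w(1) mult_right_mono[OF assms(3) less_imp_le[OF u]] by simp
  ultimately have "norm (matrix_inv B *v x) powr \<gamma> \<le> \<rho> powr \<bar>\<gamma>\<bar> * u powr \<gamma>"
    using u w(2) by (intro powr_comparable)
  then show ?thesis by (simp add: u_def powr_mult mult.assoc)
qed

text \<open>
  The norm of a dilated function. The substitution \<open>y = Bx\<close> turns the modular with exponent \<open>q\<close> into one with exponent
  \<open>s(y) = q(B\<^sup>-\<^sup>1y)\<close>. The Jacobian \<open>\<beta>\<^sup>n\<close> with \<open>\<beta> = \<parallel>B\<^sup>-\<^sup>1\<parallel>\<close> is absorbed into the base as \<open>\<beta>\<close> to the power \<open>n/s(y)\<close>.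
  As \<open>n/s(y)\<close> lies between \<open>n/q\<^sub>+\<close> and \<open>n/q\<^sub>-\<close>, this and the factor \<open>\<beta>\<^sup>\<gamma>\<close> from the weight are together at most the
  maximum \<open>K\<close>. Hoelder's inequality between \<open>s\<close> and \<open>q\<close> costs the norm of the constant 1, and the factor 2
  comes from the two terms on its right-hand side.
\<close>
theorem wvar_norm_dilation_le:
  fixes B :: "real^'n^'n" and q :: "real^'n \<Rightarrow> ennreal" and f :: "real^'n \<Rightarrow> complex"
  assumes q: "q \<in> bdd_var_exponents"
    and B: "invertible B" "norm B * norm (matrix_inv B) \<le> \<rho>" and \<rho>: "1 \<le> \<rho>"
    and le: "\<And>x. q (matrix_inv B *v x) \<le> q x"
    and f[measurable]: "f \<in> borel_measurable lebesgue"
    and fin1: "var_norm (quot_exponent 1 q B) (\<lambda>_. 1) < \<infinity>"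
    and fin2: "wvar_norm q (power_weight \<gamma>) f < \<infinity>"
  defines "K \<equiv> max (norm (matrix_inv B) powr (CARD('n) / enn2real (esssup lebesgue q) + \<gamma>))
                    (norm (matrix_inv B) powr (CARD('n) / enn2real (essinf lebesgue q) + \<gamma>))"
  shows "wvar_norm q (power_weight \<gamma>) (\<lambda>x. f (B *v x)) \<le>
    ennreal (2 * \<rho> powr \<bar>\<gamma>\<bar> * K) * (var_norm (quot_exponent 1 q B) (\<lambda>_. 1) * wvar_norm q (power_weight \<gamma>) f)"
proof -
  define l u where "l = enn2real (essinf lebesgue q)" and "u = enn2real (esssup lebesgue q)"
  note qD = bdd_var_exponentsD[OF q]
  have l: "1 < l" and ql: "\<And>x. l \<le> enn2real (q x)" and qu: "\<And>x. enn2real (q x) \<le> u"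
    unfolding l_def u_def by (rule qD)+
  note qm[measurable] = qD(1) and qf = qD(2) and qe = qD(3)
  define P where "P x = enn2real (q x)" for x
  let ?I = "matrix_inv B"
  define \<beta> where "\<beta> = norm ?I"
  define s where "s y = P (?I *v y)" for y
  note nb = norm_bounds_invertible[OF B]
  have \<beta>: "0 < \<beta>" using nb(2) by (simp add: \<beta>_def)
  have [measurable]: "P \<in> borel_measurable lebesgue" unfolding P_def by measurable
  have lin[measurable]: "(\<lambda>x. ?I *v x) \<in> lebesgue \<rightarrow>\<^sub>M lebesgue" "(\<lambda>x. B *v x) \<in> lebesgue \<rightarrow>\<^sub>M lebesgue"
    by (rule measurable_linear_lebesgue[OF invertible_matrix_inv_apply(2,1)[OF B(1)]]
      measurable_linear_lebesgue[OF invertible_matrix_inv_apply[OF B(1)]])+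
  have [measurable]: "s \<in> borel_measurable lebesgue" unfolding s_def by measurable
  have [measurable]: "norm \<in> borel_measurable (lebesgue :: (real^'n) measure)"
    by (rule borel_measurable_norm_lebesgue)
  have P: "l \<le> P x" "P x \<le> u" "1 \<le> P x" for x using ql[of x] qu[of x] l by (auto simp: P_def)
  have s: "l \<le> s x" "s x \<le> u" "1 \<le> s x" for x using P by (auto simp: s_def)
  have sP: "s x \<le> P x" for x
    using le[of x] qe qf P(3)[of x] unfolding s_def P_def by (intro enn2real_mono) (auto simp: less_top)
  have uK: "K = max (\<beta> powr (CARD('n) / u + \<gamma>)) (\<beta> powr (CARD('n) / l + \<gamma>))"
    by (simp add: K_def l_def u_def \<beta>_def)
  have K: "0 < K" unfolding uK using \<beta> by (simp add: less_max_iff_disj)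
  have Ks: "\<beta> powr (CARD('n) / s y) * \<beta> powr \<gamma> \<le> K" for y
  proof -
    have e: "CARD('n) / u + \<gamma> \<le> CARD('n) / s y + \<gamma>" "CARD('n) / s y + \<gamma> \<le> CARD('n) / l + \<gamma>"
      using s[of y] l by (auto intro!: divide_left_mono mult_pos_pos)
    have "\<beta> powr (CARD('n) / s y + \<gamma>) \<le> K"
    proof (cases "1 \<le> \<beta>")
      case True
      then have "\<beta> powr (CARD('n) / s y + \<gamma>) \<le> \<beta> powr (CARD('n) / l + \<gamma>)"
        using e by (intro powr_mono) auto
      then show ?thesis by (simp add: uK)
    next
      case False
      then have "\<beta> powr (CARD('n) / s y + \<gamma>) \<le> \<beta> powr (CARD('n) / u + \<gamma>)"
        using e \<beta> by (intro powr_mono') auto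
      then show ?thesis by (simp add: uK)
    qed
    then show ?thesis using \<beta> by (simp add: powr_add)
  qed
  define c where "c = \<rho> powr \<bar>\<gamma>\<bar>"
  have c: "0 < c" using \<rho> by (simp add: c_def)
  let ?N = "var_norm (quot_exponent 1 q B) (\<lambda>_. 1)"
  let ?M = "wvar_norm q (power_weight \<gamma>) f"
  let ?Z = "wvar_norm q (power_weight \<gamma>) (\<lambda>x. f (B *v x))"
  have wl: "wvar_norm q (power_weight \<gamma>) g = luxemburg lebesgue P (\<lambda>x. norm (g x) * norm x powr \<gamma>)" for g
    unfolding P_def by (rule wvar_norm_eq_luxemburg[OF qf])
  have core: "?Z \<le> ennreal (2 * c * K * a * \<eta>)"
    if a: "0 < a" "var_modular (quot_exponent 1 q B) (\<lambda>x. 1 / complex_of_real a) \<le> 1"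
      and \<eta>: "0 < \<eta>" "?M < ennreal \<eta>" for a \<eta>
  proof -
    define E where "E = 2 * c * K * a * \<eta>"
    have E: "0 < E" using a \<eta> c K by (simp add: E_def)
    define r where "r y = 1 / (1 / s y - 1 / P y)" for y
    define v where "v y = norm (f y) * norm y powr \<gamma> / \<eta>" for y
    have [measurable]: "r \<in> borel_measurable lebesgue" "v \<in> borel_measurable lebesgue"
      unfolding r_def v_def by measurable
    have re: "quot_exponent 1 q B x = (if s x = P x then \<infinity> else ennreal (r x))" for x
      unfolding r_def using s[of x] sP[of x] qe by (intro quot_exponent_eq) (auto simp: s_def P_def)
    have r0: "0 \<le> r x" if "s x \<noteq> P x" for x
      using sP[of x] s(3)[of x] by (auto simp: r_def intro!: divide_left_mono)
    define S where "S = {x. s x = P x}"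
    have Sm: "S \<in> sets lebesgue"
    proof -
      have "{x \<in> space lebesgue. s x = P x} \<in> sets lebesgue" by measurable
      then show ?thesis by (simp add: S_def)
    qed
    have inf: "{x. quot_exponent 1 q B x = \<infinity>} = S" "{x. quot_exponent 1 q B x \<noteq> \<infinity>} = - S"
      by (auto simp: re S_def)
    have mod1: "(\<integral>\<^sup>+x. ennreal (if s x = P x then 0 else (1 / a) powr r x) \<partial>lebesgue) \<le> 1"
      and ess: "esssup (restrict_space lebesgue S) (\<lambda>x. ennreal (1 / a)) \<le> 1"
    proof -
      have eq: "var_modular (quot_exponent 1 q B) (\<lambda>x. 1 / complex_of_real a) =
        (\<integral>\<^sup>+x. ennreal (if s x = P x then 0 else (1 / a) powr r x) \<partial>lebesgue) +
        esssup (restrict_space lebesgue S) (\<lambda>x. ennreal (1 / a))"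
        unfolding var_modular_def inf using a(1)
        by (intro arg_cong2[of _ _ _ _ "(+)"] nn_integral_cong)
           (auto simp: re S_def norm_divide indicator_def r0)
      show "(\<integral>\<^sup>+x. ennreal (if s x = P x then 0 else (1 / a) powr r x) \<partial>lebesgue) \<le> 1"
        "esssup (restrict_space lebesgue S) (\<lambda>x. ennreal (1 / a)) \<le> 1"
        using a(2) unfolding eq by (auto intro: order_trans[rotated])
    qed
    have AE1: "AE x in lebesgue. s x = P x \<longrightarrow> 1 / a \<le> 1"
    proof -
      have "AE x in restrict_space lebesgue S. ennreal (1 / a) \<le> 1"
        using esssup_AE[where f = "\<lambda>x. ennreal (1 / a)" and M = "restrict_space lebesgue S"]
        by eventually_elim (rule order_trans[OF _ ess])
      then have "AE x in lebesgue. x \<in> S \<longrightarrow> ennreal (1 / a) \<le> 1"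
        using Sm by (subst (asm) AE_restrict_space_iff) auto
      then show ?thesis by eventually_elim (use a in \<open>auto simp: S_def\<close>)
    qed
    have modv: "(\<integral>\<^sup>+x. ennreal (v x powr P x) \<partial>lebesgue) \<le> 1"
      using modular_le_1_above[of lebesgue P "\<lambda>x. norm (f x) * norm x powr \<gamma>" \<eta>] \<eta> P(3)
      by (auto simp: wl modular_def v_def order_trans[OF zero_le_one])
    define h where "h y = (norm (f y) * norm (?I *v y) powr \<gamma> / E) powr s y" for y
    have [measurable]: "h \<in> borel_measurable lebesgue" unfolding h_def by measurable
    have hle: "AE y in lebesgue. \<beta> ^ CARD('n) * h y \<le>
        1/2 * ((if s y = P y then 0 else (1 / a) powr r y) + v y powr P y)"
      using AE1 AE_lebesgue_nonzero
    proof eventually_elim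
      case (elim y)
      have s0: "0 < s y" using s(3)[of y] by simp
      have v0: "0 \<le> v y" using \<eta> by (simp add: v_def)
      have "\<beta> ^ CARD('n) * h y = (\<beta> powr (CARD('n) / s y)) powr s y * h y"
        using \<beta> s0 by (simp add: powr_powr powr_realpow)
      also have "\<dots> = (\<beta> powr (CARD('n) / s y) * (norm (f y) * norm (?I *v y) powr \<gamma> / E)) powr s y"
        using E unfolding h_def by (subst powr_mult[symmetric]) auto
      also have "\<dots> \<le> ((v y / a) / 2) powr s y"
      proof (rule powr_mono2)
        have "\<beta> powr (CARD('n) / s y) * (norm (f y) * norm (?I *v y) powr \<gamma> / E) \<le>
            \<beta> powr (CARD('n) / s y) * (norm (f y) * (c * \<beta> powr \<gamma> * norm y powr \<gamma>) / E)"
          using norm_matrix_inv_powr_le[OF B \<rho> elim(2), of \<gamma>] E unfolding c_def \<beta>_def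
          by (intro mult_left_mono divide_right_mono) auto
        also have "\<dots> = (\<beta> powr (CARD('n) / s y) * \<beta> powr \<gamma>) * (norm (f y) * norm y powr \<gamma> * c / E)"
          by simp
        also have "\<dots> \<le> K * (norm (f y) * norm y powr \<gamma> * c / E)"
          using E c by (intro mult_right_mono Ks) auto
        also have "\<dots> = (v y / a) / 2"
          using K c a \<eta> by (simp add: E_def v_def)
        finally show "\<beta> powr (CARD('n) / s y) * (norm (f y) * norm (?I *v y) powr \<gamma> / E) \<le> (v y / a) / 2" .
      qed (use E s0 in auto)
      also have "\<dots> = (1/2) powr s y * (v y / a) powr s y"
        using v0 a by (subst powr_mult[symmetric]) (auto simp: mult.commute)
      also have "\<dots> \<le> (1/2) powr 1 * (v y / a) powr s y"
        using s(3) by (intro mult_right_mono powr_mono') auto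
      also have "(v y / a) powr s y \<le> (if s y = P y then 0 else (1 / a) powr r y) + v y powr P y"
        unfolding r_def using a v0 s0 sP elim by (intro Hoelder_powr_le) auto
      finally show ?case by simp
    qed
    have "modular lebesgue P (\<lambda>x. norm (f (B *v x)) * norm x powr \<gamma> / E) = (\<integral>\<^sup>+x. ennreal (h (B *v x)) \<partial>lebesgue)"
      unfolding modular_def h_def s_def by (simp add: invertible_matrix_inv_apply[OF B(1)])
    also have "\<dots> \<le> ennreal (\<beta> ^ CARD('n)) * (\<integral>\<^sup>+y. ennreal (h y) \<partial>lebesgue)"
      unfolding \<beta>_def by (intro nn_integral_linear_le invertible_matrix_inv_apply[OF B(1)]) measurable
    also have "\<dots> = (\<integral>\<^sup>+y. ennreal (\<beta> ^ CARD('n) * h y) \<partial>lebesgue)"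
      using \<beta> by (subst nn_integral_cmult[symmetric]) (auto simp: ennreal_mult h_def)
    also have "\<dots> \<le> (\<integral>\<^sup>+y. ennreal (1/2) * (ennreal (if s y = P y then 0 else (1 / a) powr r y) + ennreal (v y powr P y)) \<partial>lebesgue)"
    proof (rule nn_integral_mono_AE, use hle in eventually_elim)
      fix y
      let ?A = "if s y = P y then 0 else (1 / a) powr r y" and ?B = "v y powr P y"
      assume "\<beta> ^ CARD('n) * h y \<le> 1/2 * (?A + ?B)"
      then have "ennreal (\<beta> ^ CARD('n) * h y) \<le> ennreal (1/2 * (?A + ?B))" by (rule ennreal_leI)
      also have "\<dots> = ennreal (1/2) * (ennreal ?A + ennreal ?B)"
        by (subst ennreal_mult, simp, simp, subst ennreal_plus) auto
      finally show "ennreal (\<beta> ^ CARD('n) * h y) \<le> \<dots>" .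
    qed
    also have "\<dots> = ennreal (1/2) * ((\<integral>\<^sup>+y. ennreal (if s y = P y then 0 else (1 / a) powr r y) \<partial>lebesgue) + (\<integral>\<^sup>+y. ennreal (v y powr P y) \<partial>lebesgue))"
      by (subst nn_integral_cmult) (auto simp: nn_integral_add)
    also have "\<dots> \<le> ennreal (1/2) * (1 + 1)"
      by (intro mult_left_mono add_mono mod1 modv) auto
    also have "\<dots> = 1"
    proof -
      have "ennreal (1/2) * (1 + 1) = ennreal (1/2) * ennreal 2" by simp
      also have "\<dots> = ennreal (1/2 * 2)" by (rule ennreal_mult[symmetric]) auto
      finally show ?thesis by simp
    qed
    finally show ?thesis unfolding wl E_def[symmetric] by (intro luxemburg_le E)
  qed
  have "?Z \<le> ennreal (2 * c * K) * (\<Prod>i\<in>(UNIV::bool set). if i then ?N else ?M)"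
  proof (rule le_prod_ennreal_finiteI)
    fix y :: "bool \<Rightarrow> real"
    assume y: "\<And>i. i \<in> UNIV \<Longrightarrow> 0 < y i \<and> (if i then ?N else ?M) < ennreal (y i)"
    from y[of True] obtain a where a: "0 < a" "var_modular (quot_exponent 1 q B) (\<lambda>x. 1 / complex_of_real a) \<le> 1" "a < y True"
      by (auto simp: var_norm_def Inf_less_iff ennreal_less_iff)
    have "?Z \<le> ennreal (2 * c * K * a * y False)"
      using y[of False] by (intro core a) auto
    also have "\<dots> \<le> ennreal (2 * c * K * (\<Prod>i\<in>UNIV. y i))"
      using a y[of False] y[of True] c K by (intro ennreal_leI) (simp add: UNIV_bool mult_ac mult_left_mono)
    finally show "?Z \<le> ennreal (2 * c * K * (\<Prod>i\<in>UNIV. y i))" .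
  qed (use fin1 fin2 c K in auto)
  then show ?thesis by (simp add: UNIV_bool c_def mult_ac)
qed

section \<open>The upper bound\<close>

lemma sum_inverse_ennreal_iff:
  fixes a :: "'i \<Rightarrow> real"
  assumes a: "\<And>i. i \<in> I \<Longrightarrow> 0 < a i" and b: "0 < b"
  shows "(\<Sum>i\<in>I. 1 / ennreal (a i)) = 1 / ennreal b \<longleftrightarrow> (\<Sum>i\<in>I. 1 / a i) = 1 / b"
proof -
  have inv: "1 / ennreal y = ennreal (1 / y)" if "0 < y" for y
    using divide_ennreal[of 1 y] that by simp
  have "(\<Sum>i\<in>I. 1 / ennreal (a i)) = (\<Sum>i\<in>I. ennreal (1 / a i))"
    by (intro sum.cong refl inv a)
  also have "\<dots> = ennreal (\<Sum>i\<in>I. 1 / a i)"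
    using a by (intro sum_ennreal) (auto simp: less_imp_le)
  finally have "(\<Sum>i\<in>I. 1 / ennreal (a i)) = ennreal (\<Sum>i\<in>I. 1 / a i)" .
  moreover have "0 \<le> (\<Sum>i\<in>I. 1 / a i)" using a by (intro sum_nonneg) (auto simp: less_imp_le)
  ultimately show ?thesis using b by (simp add: inv)
qed

lemma lebesgue_measurable_AE_cong:
  fixes f g :: "'a::euclidean_space \<Rightarrow> 'b::topological_space"
  assumes g: "g \<in> borel_measurable lebesgue" and AE: "AE x in lebesgue. f x = g x"
  shows "f \<in> borel_measurable lebesgue"
proof (rule measurableI)
  fix S :: "'b set" assume S: "S \<in> sets borel"
  show "f -` S \<inter> space lebesgue \<in> sets lebesgue"
  proof (rule completion.in_sets_AE)
    show "AE x in lebesgue. (x \<in> g -` S \<inter> space lebesgue) = (x \<in> f -` S \<inter> space lebesgue)"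
      using AE by eventually_elim auto
    show "g -` S \<inter> space lebesgue \<in> sets lebesgue" using g S by (rule measurable_sets)
  qed auto
qed auto

lemma completion_ex_borel_measurable_complex:
  fixes g :: "'a \<Rightarrow> complex"
  assumes [measurable]: "g \<in> borel_measurable (completion M)"
  shows "\<exists>g'\<in>borel_measurable M. AE x in M. g x = g' x"
proof -
  obtain a where a: "a \<in> borel_measurable M" "AE x in M. Re (g x) = a x"
    using completion_ex_borel_measurable_real[of "\<lambda>x. Re (g x)" M] by auto
  obtain b where b: "b \<in> borel_measurable M" "AE x in M. Im (g x) = b x"
    using completion_ex_borel_measurable_real[of "\<lambda>x. Im (g x)" M] by auto
  have "AE x in M. g x = Complex (a x) (b x)"
    using a(2) b(2) by eventually_elim (simp add: complex_eq_iff)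
  moreover have "(\<lambda>x. Complex (a x) (b x)) \<in> borel_measurable M"
    using a(1) b(1) unfolding Complex_eq by measurable
  ultimately show ?thesis by (intro bexI)
qed

lemma borel_measurable_matrix_vector_mult:
  fixes A :: "'a \<Rightarrow> real^'n^'m" and v :: "'a \<Rightarrow> real^'n"
  assumes "A \<in> borel_measurable M" "v \<in> borel_measurable M"
  shows "(\<lambda>x. A x *v v x) \<in> borel_measurable M"
  using assms
proof (rule borel_measurable_continuous_Pair)
  show "continuous_on UNIV (\<lambda>z. (fst z :: real^'n^'m) *v snd z)"
    unfolding matrix_vector_mult_def
    by (intro continuous_on_vec_lambda continuous_intros)
qed

lemma wvar_norm_cong_AE:
  assumes "\<And>x. q x \<noteq> \<infinity>" "AE x in lebesgue. f x = g x"
  shows "wvar_norm q (power_weight \<gamma>) f = wvar_norm q (power_weight \<gamma>) g"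
  unfolding wvar_norm_eq_luxemburg[OF assms(1)]
proof (intro antisym luxemburg_mono_AE)
  show "AE x in lebesgue. 0 \<le> norm (f x) * norm x powr \<gamma> \<and> norm (f x) * norm x powr \<gamma> \<le> norm (g x) * norm x powr \<gamma>"
    and "AE x in lebesgue. 0 \<le> norm (g x) * norm x powr \<gamma> \<and> norm (g x) * norm x powr \<gamma> \<le> norm (f x) * norm x powr \<gamma>"
    using assms(2) by (eventually_elim, simp)+
qed auto

text \<open>
  Membership asks for a finite modular and the norm for a modular of at most 1. By \<open>luxemburg_finite\<close> rescaling
  leads from one to the other.
\<close>
lemma in_wvar_Lp_iff:
  fixes f :: "real^'n \<Rightarrow> complex"
  assumes q: "q \<in> bdd_var_exponents"
  shows "f \<in> wvar_Lp q (power_weight \<gamma>) \<longleftrightarrow>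
    f \<in> borel_measurable lebesgue \<and> wvar_norm q (power_weight \<gamma>) f < \<infinity>"
proof -
  note [measurable] = bdd_var_exponentsD(1)[OF q]
  note qf = bdd_var_exponentsD(2)[OF q] and p1 = bdd_var_exponentsD(7)[OF q]
  have [measurable]: "norm \<in> borel_measurable (lebesgue :: (real^'n) measure)"
    by (rule borel_measurable_norm_lebesgue)
  let ?p = "\<lambda>x. enn2real (q x)"
  have fw: "(\<lambda>x. f x * complex_of_real (power_weight \<gamma> x)) \<in> borel_measurable lebesgue"
    if [measurable]: "f \<in> borel_measurable lebesgue"
    unfolding power_weight_def by measurable
  have mod: "var_modular q (\<lambda>x. f x * complex_of_real (power_weight \<gamma> x) / complex_of_real \<eta>) =
      modular lebesgue ?p (\<lambda>x. norm (f x) * norm x powr \<gamma> / \<eta>)" if "0 < \<eta>" for \<eta>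
    unfolding var_modular_eq_modular[OF qf] using that
    by (simp add: norm_mult norm_divide power_weight_def)
  have "wvar_norm q (power_weight \<gamma>) f < \<infinity>"
    if [measurable]: "f \<in> borel_measurable lebesgue" and \<eta>: "0 < \<eta>"
      "modular lebesgue ?p (\<lambda>x. norm (f x) * norm x powr \<gamma> / \<eta>) < \<infinity>" for \<eta>
    unfolding wvar_norm_eq_luxemburg[OF qf]
    by (rule luxemburg_finite[OF _ _ _ p1 \<eta>]) auto
  moreover have "\<exists>\<eta>>0. modular lebesgue ?p (\<lambda>x. norm (f x) * norm x powr \<gamma> / \<eta>) < \<infinity>"
    if less: "wvar_norm q (power_weight \<gamma>) f < \<infinity>"
  proof -
    obtain \<eta> where "0 < \<eta>" "modular lebesgue ?p (\<lambda>x. norm (f x) * norm x powr \<gamma> / \<eta>) \<le> 1"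
      using less unfolding wvar_norm_eq_luxemburg[OF qf] luxemburg_def Inf_less_iff by auto
    moreover have "(1::ennreal) < \<infinity>" by simp
    ultimately show ?thesis by (blast intro: le_less_trans)
  qed
  ultimately have fin_iff: "(\<exists>\<eta>>0. modular lebesgue ?p (\<lambda>x. norm (f x) * norm x powr \<gamma> / \<eta>) < \<infinity>) \<longleftrightarrow>
      wvar_norm q (power_weight \<gamma>) f < \<infinity>" if "f \<in> borel_measurable lebesgue"
    using that by meson
  have "(\<exists>\<eta>>0. var_modular q (\<lambda>x. f x * complex_of_real (power_weight \<gamma> x) / complex_of_real \<eta>) < \<infinity>) \<longleftrightarrow>
      (\<exists>\<eta>>0. modular lebesgue ?p (\<lambda>x. norm (f x) * norm x powr \<gamma> / \<eta>) < \<infinity>)"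
    by (rule ex_cong1) (simp add: mod cong: conj_cong)
  then show ?thesis
    unfolding wvar_Lp_def var_Lp_def mem_Collect_eq using fw fin_iff by argo
qed

text \<open>
  For a nonmeasurable majorant \<open>g\<close> the right-hand side is a lower integral. The scaling by \<open>K\<close> is
  therefore carried out on the side of \<open>f\<close>.
\<close>
lemma nn_integral_le_cmult:
  fixes f g :: "'a \<Rightarrow> ennreal"
  assumes [measurable]: "f \<in> borel_measurable M" and le: "AE x in M. f x \<le> K * g x" and K: "K < \<infinity>"
  shows "(\<integral>\<^sup>+x. f x \<partial>M) \<le> K * (\<integral>\<^sup>+x. g x \<partial>M)"
proof (cases "K = 0")
  case True
  with le have "(\<integral>\<^sup>+x. f x \<partial>M) \<le> (\<integral>\<^sup>+x. 0 \<partial>M)" by (intro nn_integral_mono_AE) auto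
  then show ?thesis by simp
next
  case False
  then obtain k where k: "K = ennreal k" "0 < k" using K by (cases K) auto
  have inv: "ennreal k * ennreal (1 / k) = 1" "ennreal (1 / k) * ennreal k = 1"
    using k by (simp_all add: ennreal_mult[symmetric])
  have "(\<integral>\<^sup>+x. ennreal (1 / k) * f x \<partial>M) \<le> (\<integral>\<^sup>+x. g x \<partial>M)"
  proof (rule nn_integral_mono_AE, use le in eventually_elim)
    fix x assume "f x \<le> K * g x"
    then have "ennreal (1 / k) * f x \<le> ennreal (1 / k) * (K * g x)" by (rule mult_left_mono) simp
    then show "ennreal (1 / k) * f x \<le> g x" by (simp add: k inv mult.assoc[symmetric])
  qed
  then have "ennreal k * (ennreal (1 / k) * (\<integral>\<^sup>+x. f x \<partial>M)) \<le> K * (\<integral>\<^sup>+x. g x \<partial>M)"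
    using k by (simp add: nn_integral_cmult mult_left_mono)
  then show ?thesis by (simp add: inv mult.assoc[symmetric])
qed

lemma prod_less_top_ennreal:
  fixes f :: "'i \<Rightarrow> ennreal"
  assumes "finite I" "\<And>i. i \<in> I \<Longrightarrow> f i < \<infinity>"
  shows "(\<Prod>i\<in>I. f i) < \<infinity>"
  using assms by (induction I rule: finite_induct) (auto simp: ennreal_mult_less_top)

text \<open>
  The constants come from \<open>luxemburg_prod_le\<close>, which gives \<open>m\<close>, and from one use of \<open>wvar_norm_dilation_le\<close> for each \<open>i\<close>.

  The functions \<open>f\<^sub>i\<close> are Lebesgue measurable, and composing them with \<open>(t,x) \<mapsto> A\<^sub>i(t)x\<close> gives something measurable
  only up to null sets. They are therefore replaced by Borel functions \<open>f'\<^sub>i\<close>. The exceptional set is null in \<open>x\<close> for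
  almost every \<open>t\<close> because \<open>A\<^sub>i(t)\<close> is invertible, hence null in \<open>t\<close> for almost every \<open>x\<close> by Fubini's theorem, which
  is the form that the operator needs.
\<close>
theorem hausdorff_upper_bound:
  fixes \<Phi> :: "real^'n \<Rightarrow> real" and A :: "nat \<Rightarrow> real^'n \<Rightarrow> real^'n^'n"
    and qs :: "nat \<Rightarrow> real^'n \<Rightarrow> ennreal" and q :: "real^'n \<Rightarrow> ennreal" and \<gamma> :: "nat \<Rightarrow> real"
  assumes m: "1 \<le> m" and \<rho>: "1 \<le> \<rho>"
    and qs: "\<And>i. i \<in> {1..m} \<Longrightarrow> qs i \<in> bdd_var_exponents" and q: "q \<in> bdd_var_exponents"
    and sum_q: "\<And>x. (\<Sum>i=1..m. 1 / qs i x) = 1 / q x"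
    and \<Phi>[measurable]: "\<Phi> \<in> borel_measurable lebesgue" and \<Phi>0: "\<And>t. 0 \<le> \<Phi> t"
    and A: "\<And>i. i \<in> {1..m} \<Longrightarrow> A i \<in> borel_measurable lebesgue"
    and Ainv: "AE t in lebesgue. \<Phi> t \<noteq> 0 \<longrightarrow> (\<forall>i\<in>{1..m}. invertible (A i t))"
    and A\<rho>: "AE t in lebesgue. \<forall>i\<in>{1..m}. invertible (A i t) \<longrightarrow>
       norm (A i t) * norm (matrix_inv (A i t)) \<le> \<rho>"
    and quot: "AE t in lebesgue. \<Phi> t \<noteq> 0 \<longrightarrow> (\<forall>i\<in>{1..m}.
       (\<forall>x. qs i (matrix_inv (A i t) *v x) \<le> qs i x) \<and>
       var_norm (quot_exponent 1 (qs i) (A i t)) (\<lambda>_. 1) < \<infinity>)"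
    and C2: "C2_const m \<Phi> A qs \<gamma> < \<infinity>"
    and f: "\<And>i. i \<in> {1..m} \<Longrightarrow> f i \<in> wvar_Lp (qs i) (power_weight (\<gamma> i))"
  defines "\<Gamma> \<equiv> (\<Sum>i=1..m. \<gamma> i)"
  shows "hausdorff_defined m \<Phi> A f"
    and "hausdorff_op m \<Phi> A f \<in> wvar_Lp q (power_weight \<Gamma>)"
    and "wvar_norm q (power_weight \<Gamma>) (hausdorff_op m \<Phi> A f) \<le>
      ennreal (m * (\<Prod>i=1..m. 2 * \<rho> powr \<bar>\<gamma> i\<bar>)) * C2_const m \<Phi> A qs \<gamma> *
        (\<Prod>i=1..m. wvar_norm (qs i) (power_weight (\<gamma> i)) (f i))"
proof -
  let ?L = "lebesgue :: (real^'n) measure"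
  interpret L: sigma_finite_measure ?L by (rule sigma_finite_lebesgue)
  interpret LL: pair_sigma_finite ?L ?L ..
  define I where "I = {1..m}"
  have I: "finite I" "I \<noteq> {}" "card I = m" using m by (auto simp: I_def)
  define P where "P x = enn2real (q x)" for x
  define Ps where "Ps i x = enn2real (qs i x)" for i x
  have qP: "q x = ennreal (P x)" "1 \<le> P x" "q x \<noteq> \<infinity>" for x
    using bdd_var_exponentsD(2,3,7)[OF q, of x] unfolding P_def by auto
  have qsP: "qs i x = ennreal (Ps i x)" "1 \<le> Ps i x" "qs i x \<noteq> \<infinity>" if "i \<in> I" for i x
    using bdd_var_exponentsD(2,3,7)[OF qs[OF that[unfolded I_def]], of x] unfolding Ps_def by auto
  have qm[measurable]: "q \<in> borel_measurable lebesgue" by (rule bdd_var_exponentsD(1)[OF q])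
  have qsm[measurable]: "qs i \<in> borel_measurable lebesgue" if "i \<in> I" for i
    by (rule bdd_var_exponentsD(1)[OF qs[OF that[unfolded I_def]]])
  have Pm[measurable]: "P \<in> borel_measurable lebesgue" unfolding P_def by measurable
  have [measurable]: "Ps i \<in> borel_measurable lebesgue" if "i \<in> I" for i
    using qsm[OF that] unfolding Ps_def by measurable
  have sumP: "(\<Sum>i\<in>I. 1 / Ps i x) = 1 / P x" for x
  proof -
    have "(\<Sum>i\<in>I. 1 / ennreal (Ps i x)) = 1 / ennreal (P x)"
      using sum_q[of x] qsP(1)[of _ x] qP(1)[of x] by (simp add: I_def)
    then show ?thesis
      using qsP(2) qP(2) by (subst (asm) sum_inverse_ennreal_iff) (auto intro: less_le_trans[OF zero_less_one])
  qed
  have fm: "f i \<in> borel_measurable lebesgue" "wvar_norm (qs i) (power_weight (\<gamma> i)) (f i) < \<infinity>" if "i \<in> I" for i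
    using f[of i] in_wvar_Lp_iff[OF qs] that by (auto simp: I_def)
  have "\<exists>g. g \<in> borel_measurable borel \<and> (AE x in ?L. f i x = g x)" if "i \<in> I" for i
    using completion_ex_borel_measurable_complex[OF fm(1)[OF that]] AE_completion by auto
  then obtain f' where f'm[measurable]: "\<And>i. i \<in> I \<Longrightarrow> f' i \<in> borel_measurable borel"
    and f'eq: "\<And>i. i \<in> I \<Longrightarrow> AE x in ?L. f i x = f' i x"
    by metis
  have "AE x in lborel. \<forall>i\<in>I. f i x = f' i x"
    using f'eq I(1) by (subst AE_finite_all) (auto simp: AE_completion_iff)
  then obtain N where N: "{x. \<not> (\<forall>i\<in>I. f i x = f' i x)} \<subseteq> N" "N \<in> null_sets lborel"
    by (auto simp: eventually_ae_filter)
  have Nb[measurable]: "N \<in> sets borel" using N(2) by (auto simp: null_sets_def)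
  have snd_m[measurable]: "(\<lambda>z. snd z) \<in> borel_measurable (?L \<Otimes>\<^sub>M ?L)"
    by (rule measurable_compose[OF measurable_snd]) (simp add: measurable_completion)
  have Am[measurable]: "(\<lambda>z. A i (fst z) *v snd z) \<in> borel_measurable (?L \<Otimes>\<^sub>M ?L)" if "i \<in> I" for i
    using A[of i] that by (intro borel_measurable_matrix_vector_mult measurable_compose[OF measurable_fst] snd_m)
      (auto simp: I_def)
  have nm[measurable]: "norm \<in> borel_measurable ?L" by (rule borel_measurable_norm_lebesgue)
  define K where "K t = \<Phi> t / norm t ^ CARD('n)" for t
  have [measurable]: "K \<in> borel_measurable lebesgue" unfolding K_def by measurable
  have K0: "0 \<le> K t" for t using \<Phi>0[of t] by (simp add: K_def)
  have hi: "hausdorff_integrand m \<Phi> A g x t = complex_of_real (K t) * (\<Prod>i\<in>I. g i (A i t *v x))" for g x t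
    by (simp add: hausdorff_integrand_def K_def I_def)
  have hm: "(\<lambda>z. hausdorff_integrand m \<Phi> A f' (snd z) (fst z)) \<in> borel_measurable (?L \<Otimes>\<^sub>M ?L)"
    unfolding hi by (intro borel_measurable_times borel_measurable_prod measurable_compose[OF Am f'm]) measurable
  define F where "F t x = norm (hausdorff_integrand m \<Phi> A f' x t) * norm x powr \<Gamma>" for t x
  have Fm: "(\<lambda>(t, x). F t x) \<in> borel_measurable (?L \<Otimes>\<^sub>M ?L)"
    unfolding F_def split_beta using hm by measurable
  have F0: "0 \<le> F t x" for t x by (simp add: F_def)

  have good: "AE t in ?L. \<Phi> t \<noteq> 0 \<longrightarrow> (\<forall>i\<in>I. invertible (A i t) \<and>
      norm (A i t) * norm (matrix_inv (A i t)) \<le> \<rho> \<and>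
      (\<forall>x. qs i (matrix_inv (A i t) *v x) \<le> qs i x) \<and>
      var_norm (quot_exponent 1 (qs i) (A i t)) (\<lambda>_. 1) < \<infinity>)"
    using Ainv A\<rho> quot by eventually_elim (auto simp: I_def)

  \<comment> \<open>The exceptional set is null for almost every \<open>t\<close>, hence for almost every \<open>x\<close>.\<close>
  have "AE t in ?L. AE x in ?L. \<Phi> t \<noteq> 0 \<longrightarrow> (\<forall>i\<in>I. A i t *v x \<notin> N)"
    using good
  proof eventually_elim
    case (elim t)
    show ?case
    proof (cases "\<Phi> t = 0")
      case False
      have "AE x in ?L. x \<notin> N" using N(2) by (intro AE_completion AE_not_in)
      then have "AE x in ?L. A i t *v x \<notin> N" if "i \<in> I" for i
        using elim False that by (intro AE_lebesgue_linear[OF invertible_matrix_inv_apply]) auto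
      then have "AE x in ?L. \<forall>i\<in>I. A i t *v x \<notin> N" using I(1) by (simp add: AE_finite_all)
      then show ?thesis by eventually_elim auto
    qed auto
  qed
  then have swap: "AE x in ?L. AE t in ?L. \<Phi> t \<noteq> 0 \<longrightarrow> (\<forall>i\<in>I. A i t *v x \<notin> N)"
  proof (subst (asm) LL.AE_commute)
    have "Measurable.pred (?L \<Otimes>\<^sub>M ?L) (\<lambda>z. \<Phi> (fst z) \<noteq> 0 \<longrightarrow> (\<forall>i\<in>I. A i (fst z) *v snd z \<notin> N))"
      using I(1) by measurable
    then show "{z \<in> space (?L \<Otimes>\<^sub>M ?L). \<Phi> (fst z) \<noteq> 0 \<longrightarrow> (\<forall>i\<in>I. A i (fst z) *v snd z \<notin> N)} \<in> sets (?L \<Otimes>\<^sub>M ?L)"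
      by simp
  qed auto
  have eq_int: "AE x in ?L. AE t in ?L. hausdorff_integrand m \<Phi> A f x t = hausdorff_integrand m \<Phi> A f' x t"
    using swap
  proof eventually_elim
    case (elim x)
    then show ?case
    proof eventually_elim
      case (elim t)
      show ?case
      proof (cases "\<Phi> t = 0")
        case False
        then have "f i (A i t *v x) = f' i (A i t *v x)" if "i \<in> I" for i
          using elim N(1) that by blast
        then show ?thesis unfolding hi by simp
      qed (simp add: hi K_def)
    qed
  qed

  \<comment> \<open>Hoelder and dilation at a fixed \<open>t\<close>. Where \<open>\<Phi>(t) = 0\<close> nothing is known about \<open>A\<^sub>i(t)\<close>, but there \<open>F(t,\<sqdot>)\<close> vanishes.\<close>
  define W where "W = (\<Prod>i\<in>I. wvar_norm (qs i) (power_weight (\<gamma> i)) (f i))"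
  define c where "c = m * (\<Prod>i\<in>I. 2 * \<rho> powr \<bar>\<gamma> i\<bar>)"
  have c0: "0 \<le> c" unfolding c_def by (intro mult_nonneg_nonneg prod_nonneg) auto
  have c_eq: "ennreal c = ennreal m * (\<Prod>i\<in>I. ennreal (2 * \<rho> powr \<bar>\<gamma> i\<bar>))"
    unfolding c_def by (subst ennreal_mult) (auto simp: prod_ennreal intro!: prod_nonneg)
  define k where "k i t = max
      (norm (matrix_inv (A i t)) powr (CARD('n) / enn2real (esssup lebesgue (qs i)) + \<gamma> i))
      (norm (matrix_inv (A i t)) powr (CARD('n) / enn2real (essinf lebesgue (qs i)) + \<gamma> i))" for i t
  have k0: "0 \<le> k i t" for i t by (simp add: k_def le_max_iff_disj)
  define X where "X t = ennreal (K t) * (\<Prod>i\<in>I. ennreal (k i t) *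
      var_norm (quot_exponent 1 (qs i) (A i t)) (\<lambda>_. 1))" for t
  have C2_eq: "C2_const m \<Phi> A qs \<gamma> = (\<integral>\<^sup>+t. X t \<partial>lebesgue)"
    unfolding C2_const_def X_def K_def k_def I_def ..
  have Wfin: "W < \<infinity>" unfolding W_def using I(1) fm(2) by (intro prod_less_top_ennreal) auto
  have bound: "AE t in ?L. luxemburg ?L P (F t) \<le> (ennreal c * W) * X t"
    using good
  proof eventually_elim
    case (elim t)
    show ?case
    proof (cases "\<Phi> t = 0")
      case True
      have "luxemburg ?L P (F t) \<le> ennreal 0 * luxemburg ?L P (F t)"
        using luxemburg_cmult_le[of 0 "F t" P ?L] F0 order_trans[OF zero_le_one qP(2)] True
        by (simp add: F_def[abs_def] hi K_def)
      then show ?thesis by simp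
    next
      case False
      define g where "g i x = norm (f' i (A i t *v x)) * norm x powr \<gamma> i" for i x
      have gm[measurable]: "g i \<in> borel_measurable ?L" if i: "i \<in> I" for i
      proof -
        have "(\<lambda>x. A i t *v x) \<in> borel_measurable ?L"
          by (rule borel_measurable_matrix_vector_mult) (auto simp: measurable_completion)
        from measurable_compose[OF this f'm[OF i]] show ?thesis unfolding g_def by measurable
      qed
      have lux_g: "luxemburg ?L (Ps i) (g i) \<le> ennreal (2 * \<rho> powr \<bar>\<gamma> i\<bar>) *
          ((ennreal (k i t) * var_norm (quot_exponent 1 (qs i) (A i t)) (\<lambda>_. 1)) *
           wvar_norm (qs i) (power_weight (\<gamma> i)) (f i))"
        and lux_fin: "luxemburg ?L (Ps i) (g i) < \<infinity>" if i: "i \<in> I" for i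
      proof -
        have e: "wvar_norm (qs i) (power_weight (\<gamma> i)) (f' i) = wvar_norm (qs i) (power_weight (\<gamma> i)) (f i)"
          by (rule wvar_norm_cong_AE[OF qsP(3)[OF i]]) (use f'eq[OF i] in \<open>auto elim!: eventually_mono\<close>)
        have f'l: "f' i \<in> borel_measurable lebesgue" using f'm[OF i] by (auto intro: measurable_completion)
        have "luxemburg ?L (Ps i) (g i) = wvar_norm (qs i) (power_weight (\<gamma> i)) (\<lambda>x. f' i (A i t *v x))"
          unfolding wvar_norm_eq_luxemburg[OF qsP(3)[OF i]] Ps_def g_def ..
        also have "\<dots> \<le> ennreal (2 * \<rho> powr \<bar>\<gamma> i\<bar> * k i t) *
            (var_norm (quot_exponent 1 (qs i) (A i t)) (\<lambda>_. 1) * wvar_norm (qs i) (power_weight (\<gamma> i)) (f' i))"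
          unfolding k_def
          using elim False i fm(2)[OF i] by (intro wvar_norm_dilation_le qs \<rho> f'l) (auto simp: e I_def)
        also have "\<dots> = ennreal (2 * \<rho> powr \<bar>\<gamma> i\<bar>) *
          ((ennreal (k i t) * var_norm (quot_exponent 1 (qs i) (A i t)) (\<lambda>_. 1)) *
           wvar_norm (qs i) (power_weight (\<gamma> i)) (f i))"
          using k0 by (simp add: ennreal_mult e mult.assoc)
        finally show le: "luxemburg ?L (Ps i) (g i) \<le> \<dots>" .
        have "\<dots> < \<infinity>"
          using fm(2)[OF i] elim False i by (simp add: ennreal_mult_less_top)
        with le show "luxemburg ?L (Ps i) (g i) < \<infinity>" by (rule le_less_trans)
      qed
      have F_eq: "AE x in ?L. F t x = K t * (\<Prod>i\<in>I. g i x)"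
        using AE_lebesgue_nonzero
      proof eventually_elim
        case (elim x)
        have "norm x powr \<Gamma> = (\<Prod>i\<in>I. norm x powr \<gamma> i)"
          using elim by (simp add: \<Gamma>_def I_def powr_sum)
        then show ?case
          using K0 by (simp add: F_def hi g_def norm_mult prod_norm[symmetric] prod.distrib)
      qed
      have "luxemburg ?L P (F t) \<le> luxemburg ?L P (\<lambda>x. K t * (\<Prod>i\<in>I. g i x))"
        by (rule luxemburg_mono_AE)
          (use F_eq F0[of t] order_trans[OF zero_le_one qP(2)] in \<open>auto elim!: eventually_mono simp: less_imp_le\<close>)
      also have "\<dots> \<le> ennreal (K t) * luxemburg ?L P (\<lambda>x. \<Prod>i\<in>I. g i x)"
        by (rule luxemburg_cmult_le)
          (auto simp: K0 g_def intro!: prod_nonneg order_trans[OF zero_le_one qP(2)])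
      also have "\<dots> \<le> ennreal (K t) * (ennreal (card I) * (\<Prod>i\<in>I. luxemburg ?L (Ps i) (g i)))"
        by (intro mult_left_mono luxemburg_prod_le I lux_fin qsP(2) qP(2) sumP)
          (use gm in \<open>auto simp: g_def[abs_def]\<close>)
      also have "\<dots> \<le> ennreal (K t) * (ennreal m * (\<Prod>i\<in>I. ennreal (2 * \<rho> powr \<bar>\<gamma> i\<bar>) *
          ((ennreal (k i t) * var_norm (quot_exponent 1 (qs i) (A i t)) (\<lambda>_. 1)) *
           wvar_norm (qs i) (power_weight (\<gamma> i)) (f i))))"
        unfolding I(3) by (intro mult_left_mono prod_mono_ennreal lux_g) auto
      also have "\<dots> = (ennreal c * W) * X t"
        unfolding prod.distrib W_def X_def c_eq by (simp only: mult_ac)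
      finally show ?thesis .
    qed
  qed
  have lux_m: "(\<lambda>t. luxemburg ?L P (F t)) \<in> borel_measurable ?L"
    by (rule borel_measurable_luxemburg[OF sigma_finite_lebesgue Fm])
      (auto simp: F0 intro: order_trans[OF zero_le_one qP(2)])
  have int_le: "(\<integral>\<^sup>+t. luxemburg ?L P (F t) \<partial>?L) \<le> (ennreal c * W) * C2_const m \<Phi> A qs \<gamma>"
    unfolding C2_eq using lux_m bound Wfin
    by (intro nn_integral_le_cmult) (auto simp: ennreal_mult_less_top)
  also have "\<dots> < \<infinity>" using Wfin C2 by (simp add: ennreal_mult_less_top)
  finally have int_fin: "(\<integral>\<^sup>+t. luxemburg ?L P (F t) \<partial>?L) < \<infinity>" .
  note Mink = luxemburg_Minkowski[OF sigma_finite_lebesgue sigma_finite_lebesgue Fm Pm F0 qP(2) int_fin]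

  \<comment> \<open>Finiteness of \<open>\<integral>F(t,x)dt\<close> for almost every \<open>x\<close> is what makes the defining integral of the operator exist.\<close>
  have hmx: "hausdorff_integrand m \<Phi> A f' x \<in> borel_measurable ?L" for x
    using measurable_compose[OF measurable_Pair2'[of x ?L ?L] hm]
    by simp
  have hmx_f: "AE x in ?L. hausdorff_integrand m \<Phi> A f x \<in> borel_measurable ?L"
    using eq_int by eventually_elim (rule lebesgue_measurable_AE_cong[OF hmx])
  have Fx: "(\<integral>\<^sup>+t. ennreal (F t x) \<partial>?L) =
      ennreal (norm x powr \<Gamma>) * (\<integral>\<^sup>+t. ennreal (norm (hausdorff_integrand m \<Phi> A f' x t)) \<partial>?L)" for x
    using hmx[of x] unfolding F_def
    by (subst nn_integral_cmult[symmetric]) (auto simp: ennreal_mult mult.commute)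
  have ptw: "AE x in ?L. integrable ?L (hausdorff_integrand m \<Phi> A f x) \<and>
      hausdorff_op m \<Phi> A f x = hausdorff_op m \<Phi> A f' x \<and>
      norm (hausdorff_op m \<Phi> A f x) * norm x powr \<Gamma> \<le> enn2real (\<integral>\<^sup>+t. ennreal (F t x) \<partial>?L)"
    using eq_int hmx_f Mink(1) AE_lebesgue_nonzero
  proof eventually_elim
    case (elim x)
    have x: "0 < norm x powr \<Gamma>" using elim(4) by simp
    have "(\<integral>\<^sup>+t. ennreal (norm (hausdorff_integrand m \<Phi> A f' x t)) \<partial>?L) < \<infinity>"
      using elim(3) x unfolding Fx by (auto simp: ennreal_mult_less_top)
    then have i': "integrable ?L (hausdorff_integrand m \<Phi> A f' x)"
      using hmx by (simp add: integrable_iff_bounded)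
    then have i: "integrable ?L (hausdorff_integrand m \<Phi> A f x)"
      using integrable_cong_AE[OF elim(2) hmx elim(1)] by simp
    have e: "hausdorff_op m \<Phi> A f x = hausdorff_op m \<Phi> A f' x"
      unfolding hausdorff_op_def using elim hmx by (intro integral_cong_AE)
    have "ennreal (norm (hausdorff_op m \<Phi> A f' x) * norm x powr \<Gamma>) \<le> (\<integral>\<^sup>+t. ennreal (F t x) \<partial>?L)"
      using integral_norm_bound_ennreal[OF i'] unfolding Fx hausdorff_op_def
      by (simp add: ennreal_mult mult.commute mult_left_mono)
    then have "norm (hausdorff_op m \<Phi> A f' x) * norm x powr \<Gamma> \<le> enn2real (\<integral>\<^sup>+t. ennreal (F t x) \<partial>?L)"
      using elim(3) by (subst (asm) ennreal_enn2real[symmetric]) auto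
    then show ?case using i e by simp
  qed
  then show "hausdorff_defined m \<Phi> A f"
    unfolding hausdorff_defined_def by eventually_elim simp
  have H'm: "hausdorff_op m \<Phi> A f' \<in> borel_measurable ?L"
  proof -
    have "(\<lambda>(x, t). hausdorff_integrand m \<Phi> A f' x t) \<in> borel_measurable (?L \<Otimes>\<^sub>M ?L)"
      using measurable_compose[OF measurable_pair_swap'[of ?L ?L] hm] by (simp add: split_beta)
    then show ?thesis unfolding hausdorff_op_def[abs_def]
      by (intro L.borel_measurable_lebesgue_integral)
  qed
  have Hm: "hausdorff_op m \<Phi> A f \<in> borel_measurable ?L"
    by (rule lebesgue_measurable_AE_cong[OF H'm]) (use ptw in \<open>auto elim!: eventually_mono\<close>)
  have le1: "wvar_norm q (power_weight \<Gamma>) (hausdorff_op m \<Phi> A f) \<le>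
      luxemburg ?L P (\<lambda>x. enn2real (\<integral>\<^sup>+t. ennreal (F t x) \<partial>?L))"
    unfolding wvar_norm_eq_luxemburg[OF qP(3)] P_def[symmetric, abs_def]
    by (rule luxemburg_mono_AE)
      (use ptw order_trans[OF zero_le_one qP(2)] in \<open>auto elim!: eventually_mono\<close>)
  also have le2: "\<dots> \<le> (\<integral>\<^sup>+t. luxemburg ?L P (F t) \<partial>?L)"
    by (rule Mink(2))
  finally have le: "wvar_norm q (power_weight \<Gamma>) (hausdorff_op m \<Phi> A f) \<le> \<dots>" .
  then show "hausdorff_op m \<Phi> A f \<in> wvar_Lp q (power_weight \<Gamma>)"
    using Hm int_fin by (simp add: in_wvar_Lp_iff[OF q] le_less_trans)
  show "wvar_norm q (power_weight \<Gamma>) (hausdorff_op m \<Phi> A f) \<le>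
      ennreal (m * (\<Prod>i=1..m. 2 * \<rho> powr \<bar>\<gamma> i\<bar>)) * C2_const m \<Phi> A qs \<gamma> *
        (\<Prod>i=1..m. wvar_norm (qs i) (power_weight (\<gamma> i)) (f i))"
    using order_trans[OF le int_le] unfolding c_def W_def I_def by (simp add: mult_ac)
qed

section \<open>Radial power functions\<close>

text \<open>
  The integral that gives the norms of the test functions for the lower bound. Only its finiteness and its behaviour in
  \<open>R\<close> are used, never its value.
\<close>
definition norm_powr_tail :: "'a::euclidean_space itself \<Rightarrow> real \<Rightarrow> real \<Rightarrow> ennreal" where
  "norm_powr_tail _ R \<epsilon> = (\<integral>\<^sup>+x. ennreal (if R \<le> norm x then norm x powr - (real DIM('a) + \<epsilon>) else 0) \<partial>(lborel :: 'a measure))"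

text \<open>
  Compared with the dyadic balls, the integral is at most a geometric series with ratio \<open>2\<close> to the power \<open>-\<epsilon>\<close>.
\<close>
lemma norm_powr_tail_finite:
  assumes "0 < \<epsilon>"
  shows "norm_powr_tail TYPE('a::euclidean_space) 1 \<epsilon> < \<infinity>"
proof -
  let ?n = "real DIM('a)"
  define h where "h j x = ennreal ((2 ^ j) powr - (?n + \<epsilon>)) * indicator (ball (0::'a) (2 ^ Suc j)) x" for j :: nat and x
  have le: "ennreal (if 1 \<le> norm x then norm x powr - (?n + \<epsilon>) else 0) \<le> (\<Sum>j. h j x)" for x :: 'a
  proof (cases "1 \<le> norm x")
    case True
    define j where "j = nat \<lfloor>log 2 (norm x)\<rfloor>"
    have l0: "0 \<le> log 2 (norm x)" using True by (subst zero_le_log_cancel_iff) auto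
    have j: "real j \<le> log 2 (norm x)" "log 2 (norm x) < real (Suc j)"
      using l0 unfolding j_def by linarith+
    have l: "2 powr log 2 (norm x) = norm x" using True by (intro powr_log_cancel) auto
    have "2 powr real j \<le> 2 powr log 2 (norm x)" "2 powr log 2 (norm x) < 2 powr real (Suc j)"
      using j by simp_all
    then have "2 powr real j \<le> norm x" "norm x < 2 powr real (Suc j)" unfolding l .
    then have x: "2 ^ j \<le> norm x" "norm x < 2 ^ Suc j"
      by (simp_all only: powr_realpow zero_less_numeral)
    have "ennreal (norm x powr - (?n + \<epsilon>)) \<le> ennreal ((2 ^ j) powr - (?n + \<epsilon>))"
      using x(1) assms by (intro ennreal_leI powr_mono2') auto
    also have "\<dots> = h j x" using x(2) by (simp add: h_def)
    also have "\<dots> = (\<Sum>i\<in>{j}. h i x)" by simp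
    also have "\<dots> \<le> (\<Sum>i. h i x)" by (intro sum_le_suminf) auto
    finally show ?thesis using True by simp
  qed simp
  have hm[measurable]: "h j \<in> borel_measurable lborel" for j
    unfolding h_def by (intro borel_measurable_times_ennreal borel_measurable_const borel_measurable_indicator) simp
  define v where "v = unit_ball_vol ?n * 2 ^ DIM('a)"
  have v: "0 \<le> v" unfolding v_def by simp
  have int_h: "(\<integral>\<^sup>+x. h j x \<partial>lborel) = ennreal (v * (2 powr - \<epsilon>) ^ j)" for j
  proof -
    have "(\<integral>\<^sup>+x. h j x \<partial>lborel) = ennreal ((2 ^ j) powr - (?n + \<epsilon>)) * ennreal (unit_ball_vol ?n * (2 ^ Suc j) ^ DIM('a))"
      unfolding h_def by (subst nn_integral_cmult_indicator) (auto simp: emeasure_ball)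
    also have "\<dots> = ennreal ((2 ^ j) powr - (?n + \<epsilon>) * (unit_ball_vol ?n * (2 ^ Suc j) ^ DIM('a)))"
      by (rule ennreal_mult[symmetric]) auto
    also have "(2 ^ j) powr - (?n + \<epsilon>) * (unit_ball_vol ?n * (2 ^ Suc j) ^ DIM('a)) = v * (2 powr - \<epsilon>) ^ j"
    proof -
      have e: "(2 ^ j) powr - (?n + \<epsilon>) = 2 powr (- real j * ?n) * 2 powr (- real j * \<epsilon>)"
        by (simp add: powr_realpow[symmetric] powr_powr powr_add[symmetric] algebra_simps)
      have e2: "(2 ^ Suc j) ^ DIM('a) = 2 powr (real j * ?n) * (2::real) ^ DIM('a)"
        by (simp add: powr_realpow[symmetric] powr_powr powr_add[symmetric] algebra_simps power_mult_distrib)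
      have e3: "(2 powr - \<epsilon>) ^ j = 2 powr (- real j * \<epsilon>)"
        by (simp add: powr_realpow[symmetric] powr_powr mult.commute)
      have e4: "2 powr (- real j * ?n) * 2 powr (real j * ?n) = (1::real)"
        by (simp add: powr_add[symmetric])
      have "(2 ^ j) powr - (?n + \<epsilon>) * (unit_ball_vol ?n * (2 ^ Suc j) ^ DIM('a)) =
          (2 powr (- real j * ?n) * 2 powr (real j * ?n)) * (v * (2 powr - \<epsilon>) ^ j)"
        unfolding e e2 e3 v_def by (simp only: mult_ac)
      then show ?thesis unfolding e4 by simp
    qed
    finally show ?thesis .
  qed
  have q: "2 powr - \<epsilon> < 1" using assms powr_less_mono[of "- \<epsilon>" 0 2] by simp
  have "norm_powr_tail TYPE('a) 1 \<epsilon> \<le> (\<integral>\<^sup>+x. (\<Sum>j. h j x) \<partial>lborel)"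
    unfolding norm_powr_tail_def by (intro nn_integral_mono le)
  also have "\<dots> = (\<Sum>j. ennreal (v * (2 powr - \<epsilon>) ^ j))"
    by (subst nn_integral_suminf) (simp_all only: hm int_h)
  also have "\<dots> = ennreal (\<Sum>j. v * (2 powr - \<epsilon>) ^ j)"
    using v q by (intro suminf_ennreal2) (auto intro!: summable_mult summable_geometric)
  also have "\<dots> < \<infinity>" by simp
  finally show ?thesis .
qed

lemma AE_not_outside_ball:
  assumes "AE x in lborel. norm (x::'a::euclidean_space) < R"
  shows False
proof -
  obtain e :: 'a where e: "norm e = 1" using norm_Basis nonempty_Basis by blast
  define c where "c = (\<bar>R\<bar> + 1) *\<^sub>R e"
  have "AE x in lborel. x \<notin> ball c 1"
    using assms
  proof eventually_elim
    case (elim x)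
    show ?case
    proof
      assume "x \<in> ball c 1"
      then have "norm (c - x) < 1" by (simp add: dist_norm)
      moreover have "norm c = \<bar>R\<bar> + 1" using e by (simp add: c_def)
      ultimately show False using elim norm_triangle_ineq2[of c x] by linarith
    qed
  qed
  then have "emeasure lborel (ball c 1) = 0"
    by (subst (asm) AE_iff_measurable[OF _ refl]) (simp_all add: ball_def)
  then have "unit_ball_vol (real DIM('a)) \<le> 0" by (simp add: emeasure_ball ennreal_eq_0_iff)
  moreover have "0 < unit_ball_vol (real DIM('a))" by simp
  ultimately show False by linarith
qed

lemma norm_powr_tail_pos: "0 < norm_powr_tail TYPE('a::euclidean_space) 1 \<epsilon>"
proof (rule ccontr)
  assume "\<not> ?thesis"
  then have "AE x::'a in lborel. ennreal (if 1 \<le> norm x then norm x powr - (real DIM('a) + \<epsilon>) else 0) = 0"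
    unfolding norm_powr_tail_def by (subst nn_integral_0_iff_AE[symmetric]) auto
  then have "AE x::'a in lborel. norm x < 1"
    by eventually_elim (auto simp: ennreal_eq_0_iff split: if_splits)
  then show False by (rule AE_not_outside_ball)
qed

text \<open>
  The substitution \<open>x \<mapsto> Rx\<close>.
\<close>
lemma norm_powr_tail_scale:
  assumes "0 < R"
  shows "ennreal (R powr - \<epsilon>) * norm_powr_tail TYPE('a::euclidean_space) 1 \<epsilon> \<le> norm_powr_tail TYPE('a) R \<epsilon>"
proof -
  let ?n = "real DIM('a)"
  define h where "h x = ennreal (if R \<le> norm x then norm x powr - (?n + \<epsilon>) else 0)" for x :: 'a
  have [measurable]: "h \<in> borel_measurable borel" unfolding h_def by measurable
  have "(\<integral>\<^sup>+x. h (R *\<^sub>R x) \<partial>lborel) \<le> ennreal ((1 / R) ^ DIM('a)) * (\<integral>\<^sup>+x. h x \<partial>lborel)"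
    using assms by (intro nn_integral_linear_le_borel[where B = "\<lambda>x. (1 / R) *\<^sub>R x"]) auto
  moreover have "h (R *\<^sub>R x) = ennreal (R powr - (?n + \<epsilon>)) * ennreal (if 1 \<le> norm x then norm x powr - (?n + \<epsilon>) else 0)" for x
    using assms by (simp add: h_def powr_mult ennreal_mult)
  ultimately have "ennreal (R powr - (?n + \<epsilon>)) * norm_powr_tail TYPE('a) 1 \<epsilon> \<le>
      ennreal ((1 / R) ^ DIM('a)) * norm_powr_tail TYPE('a) R \<epsilon>"
    unfolding norm_powr_tail_def h_def by (simp add: nn_integral_cmult)
  then have "ennreal (R ^ DIM('a)) * (ennreal (R powr - (?n + \<epsilon>)) * norm_powr_tail TYPE('a) 1 \<epsilon>) \<le>
      ennreal (R ^ DIM('a)) * (ennreal ((1 / R) ^ DIM('a)) * norm_powr_tail TYPE('a) R \<epsilon>)"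
    by (rule mult_left_mono) simp
  moreover have "ennreal (R ^ DIM('a)) * ennreal (R powr - (?n + \<epsilon>)) = ennreal (R powr - \<epsilon>)"
    using assms by (simp add: ennreal_mult[symmetric] powr_realpow[symmetric] powr_add[symmetric])
  moreover have "ennreal (R ^ DIM('a)) * ennreal ((1 / R) ^ DIM('a)) = 1"
    using assms by (simp add: ennreal_mult[symmetric] power_divide)
  ultimately show ?thesis by (simp add: mult.assoc[symmetric])
qed

section \<open>The lower bound\<close>

lemma prod_powr_eq_powr_sum:
  fixes x :: real
  assumes "0 < x"
  shows "(\<Prod>i\<in>I. x powr a i) = x powr (\<Sum>i\<in>I. a i)"
  using assms by (simp add: powr_sum)

text \<open>
  With \<open>\<epsilon> = 1/\<kappa>\<close> and \<open>\<kappa> = k + 1\<close>, test on \<open>f\<^sub>i(x) = |x|\<close> to the power \<open>-E\<^sub>i\<close> for \<open>|x| \<ge> 1\<close>, where \<open>E\<^sub>i = \<alpha>\<^sub>i + \<epsilon>/p\<^sub>i\<close>. The norm of \<open>f\<^sub>i\<close>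
  is \<open>J\<close> to the power \<open>1/p\<^sub>i\<close>, where \<open>J\<close> is the integral of \<open>|x|\<close> to the power \<open>-n-\<epsilon>\<close> over \<open>|x| \<ge> 1\<close>, so the product of the norms is \<open>J\<close> to the
  power \<open>1/P\<close>. If \<open>|x| \<ge> \<kappa>\<close> and \<open>\<parallel>A\<^sub>i(t)\<parallel> \<ge> \<rho>/\<kappa>\<close>, then \<open>|A\<^sub>i(t)x| \<ge> 1\<close>, so the cutoff in \<open>f\<^sub>i\<close> is inactive and
  \<open>f\<^sub>i(A\<^sub>i(t)x)\<close> is comparable to a power of \<open>\<parallel>A\<^sub>i(t)\<parallel>\<close> times the same power of \<open>|x|\<close>. The image is thus at
  least a constant times \<open>|x|\<close> to the power \<open>-(n+\<epsilon>)/P-\<gamma>\<close> times the integral of \<open>X\<^sub>k\<close>, the truncated integrand. The norm of that power over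
  \<open>|x| \<ge> \<kappa>\<close> is at least \<open>J\<close> to the power \<open>1/P\<close> times \<open>\<kappa>\<close> to the power \<open>-\<epsilon>/P\<close>, and the last factor is at least \<open>1/e\<close>.

  Everything is written with \<open>\<parallel>A\<^sub>i\<parallel>\<close> in place of \<open>1/\<parallel>A\<^sub>i\<^sup>-\<^sup>1\<parallel>\<close>, which is comparable: then the measurability
  that Fatou's lemma needs is that of \<open>A\<^sub>i\<close>.
\<close>
theorem hausdorff_lower_bound_const_exponents:
  fixes \<Phi> :: "real^'n \<Rightarrow> real" and A :: "nat \<Rightarrow> real^'n \<Rightarrow> real^'n^'n"
    and qs :: "nat \<Rightarrow> real^'n \<Rightarrow> ennreal" and q :: "real^'n \<Rightarrow> ennreal"
    and \<gamma> p :: "nat \<Rightarrow> real" and P \<rho> C :: real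
  assumes \<rho>: "1 \<le> \<rho>"
    and qs_bdd: "\<And>i. i \<in> {1..m} \<Longrightarrow> qs i \<in> bdd_var_exponents"
    and qs: "\<And>i x. i \<in> {1..m} \<Longrightarrow> qs i x = ennreal (p i)" and p: "\<And>i. i \<in> {1..m} \<Longrightarrow> 1 \<le> p i"
    and q: "\<And>x. q x = ennreal P" and P: "1 \<le> P" and sum_p: "(\<Sum>i=1..m. 1 / p i) = 1 / P"
    and \<Phi>[measurable]: "\<Phi> \<in> borel_measurable lebesgue" and \<Phi>0: "\<And>t. 0 \<le> \<Phi> t"
    and A: "\<And>i. i \<in> {1..m} \<Longrightarrow> A i \<in> borel_measurable lebesgue"
    and Ainv: "AE t in lebesgue. \<Phi> t \<noteq> 0 \<longrightarrow> (\<forall>i\<in>{1..m}. invertible (A i t))"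
    and A\<rho>: "AE t in lebesgue. \<forall>i\<in>{1..m}. invertible (A i t) \<longrightarrow>
       norm (A i t) * norm (matrix_inv (A i t)) \<le> \<rho>"
    and C: "0 \<le> C"
    and defd: "\<And>f. (\<And>i. i \<in> {1..m} \<Longrightarrow> f i \<in> wvar_Lp (qs i) (power_weight (\<gamma> i))) \<Longrightarrow> hausdorff_defined m \<Phi> A f"
    and bound: "\<And>f. (\<And>i. i \<in> {1..m} \<Longrightarrow> f i \<in> wvar_Lp (qs i) (power_weight (\<gamma> i))) \<Longrightarrow>
       wvar_norm q (power_weight (\<Sum>i=1..m. \<gamma> i)) (hausdorff_op m \<Phi> A f)
         \<le> ennreal C * (\<Prod>i=1..m. wvar_norm (qs i) (power_weight (\<gamma> i)) (f i))"
  defines "\<alpha> \<equiv> (\<lambda>i. CARD('n) / p i + \<gamma> i)"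
  shows "(\<integral>\<^sup>+t. ennreal (\<Phi> t / norm t ^ CARD('n)) * (\<Prod>i=1..m. ennreal (norm (matrix_inv (A i t)) powr \<alpha> i)) \<partial>lebesgue)
    \<le> ennreal (exp 1 * \<rho> powr (\<Sum>i=1..m. 2 * \<bar>\<alpha> i\<bar> + 1) * C)"
proof -
  let ?L = "lebesgue :: (real^'n) measure"
  let ?n = "real CARD('n)"
  define I where "I = {1..m}"
  have I: "finite I" by (simp add: I_def)
  define K where "K t = \<Phi> t / norm t ^ CARD('n)" for t
  have nm[measurable]: "norm \<in> borel_measurable ?L" by (rule borel_measurable_norm_lebesgue)
  have Km[measurable]: "K \<in> borel_measurable lebesgue" unfolding K_def by measurable
  have K0: "0 \<le> K t" for t using \<Phi>0[of t] by (simp add: K_def)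
  have Am[measurable]: "A i \<in> borel_measurable ?L" if "i \<in> I" for i using A that by (simp add: I_def)
  have p': "1 \<le> p i" if "i \<in> I" for i using p that by (simp add: I_def)
  define \<Gamma> where "\<Gamma> = (\<Sum>i\<in>I. \<gamma> i)"
  have sumP: "(\<Sum>i\<in>I. 1 / p i) = 1 / P" using sum_p by (simp add: I_def)
  have hi: "hausdorff_integrand m \<Phi> A g x t = complex_of_real (K t) * (\<Prod>i\<in>I. g i (A i t *v x))" for g x t
    by (simp add: hausdorff_integrand_def K_def I_def)
  have good: "AE t in ?L. \<Phi> t \<noteq> 0 \<longrightarrow> (\<forall>i\<in>I. invertible (A i t) \<and>
      norm (A i t) * norm (matrix_inv (A i t)) \<le> \<rho>)"
    using Ainv A\<rho> by eventually_elim (auto simp: I_def)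
  define E where "E k i = \<alpha> i + 1 / (real (Suc k) * p i)" for k i
  have E_abs: "\<bar>E k i\<bar> \<le> \<bar>\<alpha> i\<bar> + 1" if "i \<in> I" for k i
  proof -
    have "1 * 1 \<le> real (Suc k) * p i" using p'[OF that] by (intro mult_mono) auto
    then have "\<bar>1 / (real (Suc k) * p i)\<bar> \<le> 1" by (simp add: divide_le_eq_1)
    then show ?thesis unfolding E_def by linarith
  qed
  define X where "X k t = K t * (\<Prod>i\<in>I. if \<rho> / real (Suc k) \<le> norm (A i t) then norm (A i t) powr - E k i else 0)" for k t
  have X0: "0 \<le> X k t" for k t unfolding X_def using K0 by (intro mult_nonneg_nonneg prod_nonneg) auto
  have Xm[measurable]: "X k \<in> borel_measurable lebesgue" for k
  proof -
    have "(\<lambda>t. if \<rho> / real (Suc k) \<le> norm (A i t) then norm (A i t) powr - E k i else 0) \<in> borel_measurable ?L"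
      if "i \<in> I" for i
      using Am[OF that] by measurable
    then show ?thesis unfolding X_def by (intro borel_measurable_times borel_measurable_prod Km)
  qed
  define c where "c = \<rho> powr (\<Sum>i\<in>I. \<bar>\<alpha> i\<bar> + 1)"
  have c: "0 < c" using \<rho> by (simp add: c_def)

  have test: "(\<integral>\<^sup>+t. ennreal (X k t) \<partial>?L) \<le> ennreal (c * exp 1 * C)" for k
  proof -
    define \<kappa> where "\<kappa> = real (Suc k)"
    define \<epsilon> where "\<epsilon> = 1 / \<kappa>"
    have \<kappa>: "1 \<le> \<kappa>" "0 < \<kappa>" by (simp_all add: \<kappa>_def)
    have \<epsilon>: "0 < \<epsilon>" using \<kappa> by (simp add: \<epsilon>_def)
    have Ee: "E k i = \<alpha> i + \<epsilon> / p i" for i by (simp add: E_def \<epsilon>_def \<kappa>_def)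
    define f where "f i x = complex_of_real (if 1 \<le> norm x then norm x powr - E k i else 0)" for i and x :: "real^'n"
    have fm: "f i \<in> borel_measurable lebesgue" for i unfolding f_def by measurable
    obtain J where J: "norm_powr_tail TYPE(real^'n) 1 \<epsilon> = ennreal J" "0 < J"
      using norm_powr_tail_finite[OF \<epsilon>, where 'a = "real^'n"] norm_powr_tail_pos[of \<epsilon>, where 'a = "real^'n"]
      by (cases "norm_powr_tail TYPE(real^'n) 1 \<epsilon>") auto
    have f_norm: "wvar_norm (qs i) (power_weight (\<gamma> i)) (f i) \<le> ennreal (J powr (1 / p i))" if i: "i \<in> I" for i
    proof -
      have qi: "qs i x = ennreal (p i)" for x using qs i by (simp add: I_def)
      have qf: "qs i x \<noteq> \<infinity>" for x by (simp add: qi)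
      have pi: "0 < p i" using p'[OF i] by simp
      have pe: "enn2real (qs i x) = p i" for x using pi by (simp add: qi)
      let ?\<eta> = "J powr (1 / p i)"
      have pw: "(norm (f i x) * norm x powr \<gamma> i / ?\<eta>) powr p i =
          (if 1 \<le> norm x then norm x powr - (real DIM(real^'n) + \<epsilon>) else 0) * (1 / J)" for x
      proof (cases "1 \<le> norm x")
        case True
        have "norm (f i x) * norm x powr \<gamma> i = norm x powr (- E k i + \<gamma> i)"
          using True by (simp add: f_def powr_add[symmetric])
        also have "- E k i + \<gamma> i = - (?n + \<epsilon>) / p i"
          by (simp add: Ee \<alpha>_def add_divide_distrib diff_divide_distrib)
        finally show ?thesis
          using True pi J(2) by (simp add: powr_divide powr_powr)
      qed (use pi in \<open>simp add: f_def\<close>)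
      have "modular lebesgue (\<lambda>x. enn2real (qs i x)) (\<lambda>x. norm (f i x) * norm x powr \<gamma> i / ?\<eta>) =
          (\<integral>\<^sup>+x. ennreal (if 1 \<le> norm x then norm x powr - (real DIM(real^'n) + \<epsilon>) else 0) * ennreal (1 / J) \<partial>?L)"
        unfolding modular_def pe pw using J(2) by (intro nn_integral_cong ennreal_mult) auto
      also have "\<dots> = norm_powr_tail TYPE(real^'n) 1 \<epsilon> * ennreal (1 / J)"
        unfolding norm_powr_tail_def nn_integral_completion by (rule nn_integral_multc) measurable
      also have "\<dots> = 1" using J by (simp add: ennreal_mult[symmetric])
      finally show ?thesis
        unfolding wvar_norm_eq_luxemburg[OF qf] using J by (intro luxemburg_le) auto
    qed
    have f_in: "f i \<in> wvar_Lp (qs i) (power_weight (\<gamma> i))" if "i \<in> {1..m}" for i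
      unfolding in_wvar_Lp_iff[OF qs_bdd[OF that]] using fm f_norm[of i] that
      by (auto simp: I_def intro: le_less_trans)
    let ?G = "hausdorff_op m \<Phi> A f"
    have G_le: "wvar_norm q (power_weight \<Gamma>) ?G \<le> ennreal (C * J powr (1 / P))"
    proof -
      have "wvar_norm q (power_weight \<Gamma>) ?G \<le> ennreal C * (\<Prod>i\<in>I. wvar_norm (qs i) (power_weight (\<gamma> i)) (f i))"
        using bound[of f, OF f_in] by (simp add: I_def \<Gamma>_def)
      also have "\<dots> \<le> ennreal C * (\<Prod>i\<in>I. ennreal (J powr (1 / p i)))"
        by (intro mult_left_mono prod_mono_ennreal f_norm) auto
      also have "\<dots> = ennreal (C * J powr (1 / P))"
        using C J by (simp add: prod_ennreal ennreal_mult prod_powr_eq_powr_sum sumP)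
      finally show ?thesis .
    qed
    define B where "B x = norm x powr - ((?n + \<epsilon>) / P)" for x :: "real^'n"
    have "hausdorff_defined m \<Phi> A f" by (rule defd) (rule f_in)
    then have AE_int: "AE x in ?L. integrable ?L (hausdorff_integrand m \<Phi> A f x)"
      unfolding hausdorff_defined_def .
    have ptw: "AE x in ?L. \<kappa> \<le> norm x \<longrightarrow>
        ennreal (1 / c * B x) * (\<integral>\<^sup>+t. ennreal (X k t) \<partial>?L) \<le> ennreal (norm (?G x) * norm x powr \<Gamma>)"
      using AE_int
    proof eventually_elim
      case (elim x)
      show ?case
      proof
        assume x\<kappa>: "\<kappa> \<le> norm x"
        then have x: "0 < norm x" "x \<noteq> 0" using \<kappa> by auto
        define g where "g t = K t * (\<Prod>i\<in>I. if 1 \<le> norm (A i t *v x) then norm (A i t *v x) powr - E k i else 0)" for t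
        have g0: "0 \<le> g t" for t unfolding g_def using K0 by (intro mult_nonneg_nonneg prod_nonneg) auto
        have hg: "hausdorff_integrand m \<Phi> A f x t = complex_of_real (g t)" for t
          unfolding hi g_def f_def by simp
        have ig: "integrable ?L g"
          using elim unfolding hg by (simp add: complex_of_real_integrable_eq)
        have "?G x = complex_of_real (LINT t|?L. g t)"
          unfolding hausdorff_op_def hg by simp
        moreover have "0 \<le> (LINT t|?L. g t)" by (intro integral_nonneg_AE) (simp add: g0)
        ultimately have nG: "norm (?G x) = (LINT t|?L. g t)" by simp
        have gG: "(\<integral>\<^sup>+t. ennreal (g t) \<partial>?L) = ennreal (norm (?G x))"
          unfolding nG using ig by (intro nn_integral_eq_integral) (auto simp: g0)
        have Bx: "1 / c * B x = (\<Prod>i\<in>I. \<rho> powr - (\<bar>\<alpha> i\<bar> + 1) * norm x powr - E k i) * norm x powr \<Gamma>"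
        proof -
          have "(\<Sum>i\<in>I. - E k i) + \<Gamma> = - ((?n + \<epsilon>) / P)"
          proof -
            have "(\<Sum>i\<in>I. - E k i) + \<Gamma> = (\<Sum>i\<in>I. - (?n + \<epsilon>) * (1 / p i))"
              unfolding \<Gamma>_def sum.distrib[symmetric]
              by (intro sum.cong refl) (simp add: Ee \<alpha>_def add_divide_distrib diff_divide_distrib)
            also have "\<dots> = - (?n + \<epsilon>) * (1 / P)" unfolding sum_distrib_left[symmetric] sumP ..
            also have "\<dots> = - ((?n + \<epsilon>) / P)" by (simp only: mult_minus_left times_divide_eq_right mult_1_right)
            finally show ?thesis .
          qed
          then have "(\<Prod>i\<in>I. norm x powr - E k i) * norm x powr \<Gamma> = B x"
            using x by (simp add: prod_powr_eq_powr_sum powr_add[symmetric] B_def)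
          moreover have "(\<Prod>i\<in>I. \<rho> powr - (\<bar>\<alpha> i\<bar> + 1)) = 1 / c"
            using \<rho> by (subst prod_powr_eq_powr_sum) (simp_all add: c_def sum_negf powr_minus_divide del: minus_add_distrib)
          ultimately show ?thesis by (simp add: prod.distrib)
        qed
        have le_g: "AE t in ?L. (1 / c * B x) * X k t \<le> g t * norm x powr \<Gamma>"
          using good
        proof eventually_elim
          case (elim t)
          show ?case
          proof (cases "\<Phi> t = 0")
            case False
            have "(\<Prod>i\<in>I. \<rho> powr - (\<bar>\<alpha> i\<bar> + 1) * norm x powr - E k i) *
                (\<Prod>i\<in>I. if \<rho> / real (Suc k) \<le> norm (A i t) then norm (A i t) powr - E k i else 0) \<le>
                (\<Prod>i\<in>I. if 1 \<le> norm (A i t *v x) then norm (A i t *v x) powr - E k i else 0)"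
              unfolding prod.distrib[symmetric]
            proof (rule prod_mono, safe)
              fix i assume i: "i \<in> I"
              have inv: "invertible (A i t)" "norm (A i t) * norm (matrix_inv (A i t)) \<le> \<rho>"
                using elim False i by auto
              note nb = norm_bounds_invertible[OF inv]
              show "0 \<le> \<rho> powr - (\<bar>\<alpha> i\<bar> + 1) * norm x powr - E k i *
                (if \<rho> / real (Suc k) \<le> norm (A i t) then norm (A i t) powr - E k i else 0)" by simp
              show "\<rho> powr - (\<bar>\<alpha> i\<bar> + 1) * norm x powr - E k i *
                (if \<rho> / real (Suc k) \<le> norm (A i t) then norm (A i t) powr - E k i else 0) \<le>
                (if 1 \<le> norm (A i t *v x) then norm (A i t *v x) powr - E k i else 0)"
              proof (cases "\<rho> / real (Suc k) \<le> norm (A i t)")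
                case True
                let ?v = "norm (A i t) * norm x" and ?u = "norm (A i t *v x)"
                have "\<rho> / \<kappa> * \<kappa> \<le> ?v"
                  using True x\<kappa> \<kappa> \<rho> by (intro mult_mono) (auto simp: \<kappa>_def)
                then have "\<rho> * 1 \<le> \<rho> * ?u" using nb(5)[of x] \<kappa> by simp
                then have u1: "1 \<le> ?u" using \<rho> by (subst (asm) mult_le_cancel_left_pos) auto
                have "?u \<le> \<rho> * ?v"
                  using nb(4)[of x] mult_right_mono[OF \<rho>, of ?v] by simp
                then have "?v powr - E k i \<le> \<rho> powr \<bar>- E k i\<bar> * ?u powr - E k i"
                  using nb(1) x u1 nb(5)[of x] by (intro powr_comparable) auto
                also have "\<dots> \<le> \<rho> powr (\<bar>\<alpha> i\<bar> + 1) * ?u powr - E k i"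
                  using \<rho> E_abs[OF i] by (intro mult_right_mono powr_mono) auto
                finally have "\<rho> powr - (\<bar>\<alpha> i\<bar> + 1) * ?v powr - E k i \<le>
                    \<rho> powr - (\<bar>\<alpha> i\<bar> + 1) * (\<rho> powr (\<bar>\<alpha> i\<bar> + 1) * ?u powr - E k i)"
                  by (rule mult_left_mono) simp
                also have "\<dots> = ?u powr - E k i"
                  using \<rho> by (simp add: mult.assoc[symmetric] powr_add[symmetric])
                finally show ?thesis using True u1 nb(1) x by (simp add: powr_mult mult_ac)
              qed simp
            qed
            then have "(K t * norm x powr \<Gamma>) * ((\<Prod>i\<in>I. \<rho> powr - (\<bar>\<alpha> i\<bar> + 1) * norm x powr - E k i) *
                (\<Prod>i\<in>I. if \<rho> / real (Suc k) \<le> norm (A i t) then norm (A i t) powr - E k i else 0)) \<le>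
                (K t * norm x powr \<Gamma>) * (\<Prod>i\<in>I. if 1 \<le> norm (A i t *v x) then norm (A i t *v x) powr - E k i else 0)"
              by (rule mult_left_mono) (simp add: K0)
            then show ?thesis unfolding Bx X_def g_def by (simp only: mult_ac)
          qed (simp add: X_def g_def K_def)
        qed
        have "ennreal (1 / c * B x) * (\<integral>\<^sup>+t. ennreal (X k t) \<partial>?L) = (\<integral>\<^sup>+t. ennreal ((1 / c * B x) * X k t) \<partial>?L)"
        proof -
          have cB: "0 \<le> 1 / c * B x" using c by (simp add: B_def)
          have "ennreal (1 / c * B x) * (\<integral>\<^sup>+t. ennreal (X k t) \<partial>?L) =
              (\<integral>\<^sup>+t. ennreal (1 / c * B x) * ennreal (X k t) \<partial>?L)"
            by (rule nn_integral_cmult[symmetric]) measurable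
          also have "\<dots> = (\<integral>\<^sup>+t. ennreal ((1 / c * B x) * X k t) \<partial>?L)"
            by (intro nn_integral_cong ennreal_mult[symmetric] cB X0)
          finally show ?thesis .
        qed
        also have "\<dots> \<le> (\<integral>\<^sup>+t. ennreal (g t) * ennreal (norm x powr \<Gamma>) \<partial>?L)"
        proof (rule nn_integral_mono_AE, use le_g in eventually_elim)
          fix t assume "(1 / c * B x) * X k t \<le> g t * norm x powr \<Gamma>"
          then show "ennreal ((1 / c * B x) * X k t) \<le> ennreal (g t) * ennreal (norm x powr \<Gamma>)"
            by (subst ennreal_mult[symmetric]) (auto simp: g0 ennreal_leI)
        qed
        also have "\<dots> = ennreal (norm (?G x)) * ennreal (norm x powr \<Gamma>)"
          using ig by (subst nn_integral_multc) (auto simp: gG)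
        also have "\<dots> = ennreal (norm (?G x) * norm x powr \<Gamma>)" by (rule ennreal_mult[symmetric]) auto
        finally show "ennreal (1 / c * B x) * (\<integral>\<^sup>+t. ennreal (X k t) \<partial>?L) \<le> ennreal (norm (?G x) * norm x powr \<Gamma>)" .
      qed
    qed
    \<comment> \<open>Otherwise the image would be infinite almost everywhere outside a ball.\<close>
    have "(\<integral>\<^sup>+t. ennreal (X k t) \<partial>?L) \<noteq> \<infinity>"
    proof
      assume inf: "(\<integral>\<^sup>+t. ennreal (X k t) \<partial>?L) = \<infinity>"
      have "AE x in ?L. norm x < \<kappa>"
        using ptw
      proof eventually_elim
        case (elim x)
        show ?case
        proof (rule ccontr)
          assume "\<not> norm x < \<kappa>"
          then have x: "\<kappa> \<le> norm x" "x \<noteq> 0" using \<kappa> by auto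
          then have "0 < 1 / c * B x" using c by (simp add: B_def)
          then have "ennreal (1 / c * B x) * \<infinity> = \<infinity>"
            using c by (auto simp: ennreal_mult_top zero_less_divide_iff)
          then show False using elim x inf by (simp add: top_unique)
        qed
      qed
      then show False using AE_not_outside_ball[of \<kappa>, where 'a = "real^'n"] by (simp add: AE_completion_iff)
    qed
    then obtain r where r: "(\<integral>\<^sup>+t. ennreal (X k t) \<partial>?L) = ennreal r" "0 \<le> r"
      by (cases "\<integral>\<^sup>+t. ennreal (X k t) \<partial>?L") auto
    have qf: "q x \<noteq> \<infinity>" for x by (simp add: q)
    have qP: "enn2real (q x) = P" for x using P by (simp add: q)
    define Z where "Z = r / c * J powr (1 / P) * \<kappa> powr - (\<epsilon> / P)"
    have "ennreal Z \<le> wvar_norm q (power_weight \<Gamma>) ?G"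
      unfolding wvar_norm_eq_luxemburg[OF qf] luxemburg_def
    proof (rule Inf_greatest, safe)
      fix \<eta> :: real
      assume \<eta>: "0 < \<eta>" "modular lebesgue (\<lambda>x. enn2real (q x)) (\<lambda>x. norm (?G x) * norm x powr \<Gamma> / \<eta>) \<le> 1"
      let ?T = "\<lambda>x::real^'n. if \<kappa> \<le> norm x then norm x powr - (real DIM(real^'n) + \<epsilon>) else 0"
      have "ennreal ((r / c / \<eta>) powr P) * norm_powr_tail TYPE(real^'n) \<kappa> \<epsilon> =
          (\<integral>\<^sup>+x. ennreal ((r / c / \<eta>) powr P) * ennreal (?T x) \<partial>?L)"
        unfolding norm_powr_tail_def nn_integral_completion by (rule nn_integral_cmult[symmetric]) measurable
      also have "\<dots> = (\<integral>\<^sup>+x. ennreal ((r / c / \<eta>) powr P * ?T x) \<partial>?L)"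
        by (intro nn_integral_cong ennreal_mult[symmetric]) auto
      also have "\<dots> \<le> modular lebesgue (\<lambda>x. enn2real (q x)) (\<lambda>x. norm (?G x) * norm x powr \<Gamma> / \<eta>)"
        unfolding modular_def qP
      proof (rule nn_integral_mono_AE, use ptw in eventually_elim)
        fix x assume x: "\<kappa> \<le> norm x \<longrightarrow>
          ennreal (1 / c * B x) * (\<integral>\<^sup>+t. ennreal (X k t) \<partial>?L) \<le> ennreal (norm (?G x) * norm x powr \<Gamma>)"
        show "ennreal ((r / c / \<eta>) powr P * ?T x) \<le> ennreal ((norm (?G x) * norm x powr \<Gamma> / \<eta>) powr P)"
        proof (cases "\<kappa> \<le> norm x")
          case True
          have B0: "0 \<le> B x" by (simp add: B_def)
          have "ennreal (1 / c * B x * r) \<le> ennreal (norm (?G x) * norm x powr \<Gamma>)"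
            using x[rule_format, OF True] c B0 unfolding r(1)
            by (subst ennreal_mult) (auto simp: r(2))
          then have le: "1 / c * B x * r \<le> norm (?G x) * norm x powr \<Gamma>" by simp
          have "(r / c / \<eta>) powr P * norm x powr - (?n + \<epsilon>) = (r / c / \<eta> * B x) powr P"
            using r c \<eta> P B0 by (subst powr_mult) (auto simp: B_def powr_powr)
          also have "\<dots> \<le> (norm (?G x) * norm x powr \<Gamma> / \<eta>) powr P"
            using le r c \<eta> P B0 divide_right_mono[OF le, of \<eta>]
            by (intro powr_mono2) (auto simp: mult_ac)
          finally show ?thesis using True by (simp add: ennreal_leI)
        qed simp
      qed
      also note \<eta>(2)
      finally have "ennreal ((r / c / \<eta>) powr P) * norm_powr_tail TYPE(real^'n) \<kappa> \<epsilon> \<le> 1" .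
      then have "ennreal ((r / c / \<eta>) powr P) * (ennreal (\<kappa> powr - \<epsilon>) * ennreal J) \<le> 1"
        using mult_left_mono[OF norm_powr_tail_scale[OF \<kappa>(2), of \<epsilon>, where 'a = "real^'n"], of "ennreal ((r / c / \<eta>) powr P)"]
        unfolding J(1) by simp
      then have "(r / c / \<eta>) powr P * (\<kappa> powr - \<epsilon> * J) \<le> 1"
        using J by (simp add: ennreal_mult[symmetric])
      moreover have "(r / c / \<eta>) powr P * (\<kappa> powr - \<epsilon> * J) = (Z / \<eta>) powr P"
      proof -
        have "(Z / \<eta>) powr P = (r / c / \<eta> * (\<kappa> powr - (\<epsilon> / P) * J powr (1 / P))) powr P"
          by (simp add: Z_def mult_ac)
        also have "\<dots> = (r / c / \<eta>) powr P * ((\<kappa> powr - (\<epsilon> / P)) powr P * (J powr (1 / P)) powr P)"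
          by (simp only: powr_mult)
        also have "\<dots> = (r / c / \<eta>) powr P * (\<kappa> powr - \<epsilon> * J)"
          using P J by (simp add: powr_powr)
        finally show ?thesis ..
      qed
      ultimately have "(Z / \<eta>) powr P \<le> 1" by simp
      have "Z / \<eta> \<le> 1"
      proof (rule ccontr)
        assume "\<not> Z / \<eta> \<le> 1"
        then have "1 < (Z / \<eta>) powr P" using P by (intro gr_one_powr) auto
        with \<open>(Z / \<eta>) powr P \<le> 1\<close> show False by simp
      qed
      then show "ennreal Z \<le> ennreal \<eta>" using \<eta>(1) by (intro ennreal_leI) (simp add: divide_le_eq_1)
    qed
    also note G_le
    finally have "Z \<le> C * J powr (1 / P)" using C by simp
    then have "(r / c * \<kappa> powr - (\<epsilon> / P)) * J powr (1 / P) \<le> C * J powr (1 / P)"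
      by (simp add: Z_def mult_ac)
    then have rC: "r / c * \<kappa> powr - (\<epsilon> / P) \<le> C" using J(2) by (subst (asm) mult_le_cancel_right_pos) auto
    have "exp (- 1) \<le> \<kappa> powr - (\<epsilon> / P)"
    proof -
      have "\<epsilon> / P * ln \<kappa> \<le> \<epsilon> / P * \<kappa>"
        using ln_le_minus_one[OF \<kappa>(2)] \<epsilon> P by (intro mult_left_mono) auto
      also have "\<dots> \<le> 1" using \<kappa> P by (simp add: \<epsilon>_def)
      finally show ?thesis using \<kappa> by (simp add: powr_def)
    qed
    then have "r / c * exp (- 1) \<le> r / c * \<kappa> powr - (\<epsilon> / P)"
      using r c by (intro mult_left_mono) auto
    with rC have "r / c * exp (- 1) \<le> C" by simp
    then have "r \<le> c * exp 1 * C" using c by (simp add: exp_minus field_simps)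
    then show ?thesis by (simp add: r ennreal_leI)
  qed

  \<comment> \<open>As \<open>k\<close> grows the truncation disappears and \<open>E\<^sub>i\<close> tends to \<open>\<alpha>\<^sub>i\<close>.\<close>
  define Y where "Y t = K t * (\<Prod>i\<in>I. norm (A i t) powr - \<alpha> i)" for t
  have lim: "AE t in ?L. (\<lambda>k. X k t) \<longlonglongrightarrow> Y t"
    using good
  proof eventually_elim
    case (elim t)
    show ?case
    proof (cases "\<Phi> t = 0")
      case False
      have "(\<lambda>k. if \<rho> / real (Suc k) \<le> norm (A i t) then norm (A i t) powr - E k i else 0) \<longlonglongrightarrow> norm (A i t) powr - \<alpha> i"
        if i: "i \<in> I" for i
      proof -
        have a: "0 < norm (A i t)" using norm_bounds_invertible(1)[of "A i t" \<rho>] elim False i by auto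
        have z: "(\<lambda>k. 1 / real (Suc k)) \<longlonglongrightarrow> 0" using LIMSEQ_Suc[OF lim_1_over_n] by simp
        have "(\<lambda>k. \<rho> * (1 / real (Suc k))) \<longlonglongrightarrow> \<rho> * 0" by (intro tendsto_intros z)
        then have "eventually (\<lambda>k. \<rho> * (1 / real (Suc k)) < norm (A i t)) sequentially"
          using a by (intro order_tendstoD) auto
        then have ev: "eventually (\<lambda>k. norm (A i t) powr - E k i =
            (if \<rho> / real (Suc k) \<le> norm (A i t) then norm (A i t) powr - E k i else 0)) sequentially"
          by eventually_elim simp
        have "(\<lambda>k. - (\<alpha> i + 1 / real (Suc k) * (1 / p i))) \<longlonglongrightarrow> - (\<alpha> i + 0 * (1 / p i))"
          by (intro tendsto_intros z)
        then have "(\<lambda>k. - E k i) \<longlonglongrightarrow> - \<alpha> i" by (simp add: E_def)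
        then have "(\<lambda>k. norm (A i t) powr - E k i) \<longlonglongrightarrow> norm (A i t) powr - \<alpha> i"
          using a by (intro tendsto_powr tendsto_const) auto
        then show ?thesis using ev by (rule Lim_transform_eventually)
      qed
      then show ?thesis unfolding X_def Y_def by (intro tendsto_intros)
    qed (simp add: X_def Y_def K_def)
  qed
  define d where "d = \<rho> powr (\<Sum>i\<in>I. \<bar>\<alpha> i\<bar>)"
  have "(\<integral>\<^sup>+t. ennreal (K t) * (\<Prod>i\<in>I. ennreal (norm (matrix_inv (A i t)) powr \<alpha> i)) \<partial>?L) \<le>
      (\<integral>\<^sup>+t. liminf (\<lambda>k. ennreal d * ennreal (X k t)) \<partial>?L)"
  proof (rule nn_integral_mono_AE, use good lim in eventually_elim)
    fix t
    assume t: "\<Phi> t \<noteq> 0 \<longrightarrow> (\<forall>i\<in>I. invertible (A i t) \<and> norm (A i t) * norm (matrix_inv (A i t)) \<le> \<rho>)"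
      and lim: "(\<lambda>k. X k t) \<longlonglongrightarrow> Y t"
    have "(\<lambda>k. ennreal (d * X k t)) \<longlonglongrightarrow> ennreal (d * Y t)"
      by (intro tendsto_ennrealI tendsto_intros lim)
    then have "liminf (\<lambda>k. ennreal (d * X k t)) = ennreal (d * Y t)"
      by (intro lim_imp_Liminf) auto
    then have L: "liminf (\<lambda>k. ennreal d * ennreal (X k t)) = ennreal (d * Y t)"
      using X0 \<rho> by (simp add: ennreal_mult d_def)
    have "K t * (\<Prod>i\<in>I. norm (matrix_inv (A i t)) powr \<alpha> i) \<le> d * Y t"
    proof (cases "\<Phi> t = 0")
      case False
      have "norm (matrix_inv (A i t)) powr \<alpha> i \<le> \<rho> powr \<bar>\<alpha> i\<bar> * norm (A i t) powr - \<alpha> i" if i: "i \<in> I" for i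
      proof -
        have inv: "invertible (A i t)" "norm (A i t) * norm (matrix_inv (A i t)) \<le> \<rho>"
          using t False i by auto
        note nb = norm_bounds_invertible[OF inv]
        have "1 \<le> \<rho> * (norm (A i t) * norm (matrix_inv (A i t)))"
          using mult_mono[OF \<rho> nb(3)] \<rho> by simp
        then have "(norm (A i t) * norm (matrix_inv (A i t))) powr \<alpha> i \<le> \<rho> powr \<bar>\<alpha> i\<bar> * 1 powr \<alpha> i"
          using nb(1,2) inv(2) by (intro powr_comparable) auto
        then have "norm (A i t) powr \<alpha> i * norm (matrix_inv (A i t)) powr \<alpha> i \<le> \<rho> powr \<bar>\<alpha> i\<bar>"
          by (simp add: powr_mult)
        then have "norm (A i t) powr - \<alpha> i * (norm (A i t) powr \<alpha> i * norm (matrix_inv (A i t)) powr \<alpha> i) \<le>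
            norm (A i t) powr - \<alpha> i * \<rho> powr \<bar>\<alpha> i\<bar>"
          by (rule mult_left_mono) simp
        then show ?thesis
          using nb(1) by (simp add: mult.assoc[symmetric] powr_add[symmetric] mult.commute)
      qed
      then have "(\<Prod>i\<in>I. norm (matrix_inv (A i t)) powr \<alpha> i) \<le> (\<Prod>i\<in>I. \<rho> powr \<bar>\<alpha> i\<bar> * norm (A i t) powr - \<alpha> i)"
        by (intro prod_mono) auto
      also have "\<dots> = d * (\<Prod>i\<in>I. norm (A i t) powr - \<alpha> i)"
        using \<rho> by (simp add: prod.distrib d_def prod_powr_eq_powr_sum)
      finally have "K t * (\<Prod>i\<in>I. norm (matrix_inv (A i t)) powr \<alpha> i) \<le> K t * (d * (\<Prod>i\<in>I. norm (A i t) powr - \<alpha> i))"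
        using K0 by (intro mult_left_mono) auto
      then show ?thesis by (simp add: Y_def mult_ac)
    qed (simp add: Y_def K_def)
    then show "ennreal (K t) * (\<Prod>i\<in>I. ennreal (norm (matrix_inv (A i t)) powr \<alpha> i)) \<le>
        liminf (\<lambda>k. ennreal d * ennreal (X k t))"
      unfolding L using K0 by (simp add: prod_ennreal ennreal_mult[symmetric] prod_nonneg ennreal_leI)
  qed
  also have "\<dots> \<le> liminf (\<lambda>k. \<integral>\<^sup>+t. ennreal d * ennreal (X k t) \<partial>?L)"
    by (intro nn_integral_liminf) measurable
  also have "\<dots> \<le> liminf (\<lambda>k::nat. ennreal (d * (c * exp 1 * C)))"
  proof (intro Liminf_mono always_eventually allI)
    fix k
    have "(\<integral>\<^sup>+t. ennreal d * ennreal (X k t) \<partial>?L) = ennreal d * (\<integral>\<^sup>+t. ennreal (X k t) \<partial>?L)"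
      by (rule nn_integral_cmult) measurable
    also have "\<dots> \<le> ennreal d * ennreal (c * exp 1 * C)" by (intro mult_left_mono test) simp
    also have "\<dots> = ennreal (d * (c * exp 1 * C))"
      using c C by (intro ennreal_mult[symmetric]) (auto simp: d_def)
    finally show "(\<integral>\<^sup>+t. ennreal d * ennreal (X k t) \<partial>?L) \<le> ennreal (d * (c * exp 1 * C))" .
  qed
  also have "\<dots> = ennreal (d * (c * exp 1 * C))" by (simp add: Liminf_const)
  also have "d * (c * exp 1 * C) = exp 1 * \<rho> powr (\<Sum>i\<in>I. 2 * \<bar>\<alpha> i\<bar> + 1) * C"
  proof -
    have "(\<Sum>i\<in>I. 2 * \<bar>\<alpha> i\<bar> + 1) = (\<Sum>i\<in>I. \<bar>\<alpha> i\<bar>) + (\<Sum>i\<in>I. \<bar>\<alpha> i\<bar> + 1)"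
      unfolding sum.distrib[symmetric] by (intro sum.cong) auto
    then show ?thesis by (simp only: powr_add d_def c_def mult_ac)
  qed
  finally show ?thesis unfolding K_def I_def .
qed

text \<open>
  Everywhere \<open>1/q\<^sub>+ \<le> 1/q = \<Sum>1/q\<^sub>i \<le> \<Sum>1/q\<^sub>i\<^sub>-\<close>, and the two ends agree. So all the inequalities \<open>1/q\<^sub>i \<le> 1/q\<^sub>i\<^sub>-\<close> are
  equalities, at every point.
\<close>
lemma extremal_exponents_constant:
  fixes qs :: "'i \<Rightarrow> real^'n \<Rightarrow> ennreal"
  assumes I: "finite I" and qs: "\<And>i. i \<in> I \<Longrightarrow> qs i \<in> bdd_var_exponents" and q: "q \<in> bdd_var_exponents"
    and sum_q: "\<And>x. (\<Sum>i\<in>I. 1 / qs i x) = 1 / q x"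
    and ext: "(\<Sum>i\<in>I. 1 / essinf lebesgue (qs i)) = 1 / esssup lebesgue q"
  shows "i \<in> I \<Longrightarrow> qs i x = essinf lebesgue (qs i)" and "q x = esssup lebesgue q"
proof -
  define l where "l i = enn2real (essinf lebesgue (qs i))" for i
  define u where "u = enn2real (esssup lebesgue q)"
  define p where "p i = enn2real (qs i x)" for i
  define r where "r = enn2real (q x)"
  have l: "essinf lebesgue (qs i) = ennreal (l i)" "qs i x = ennreal (p i)" "1 < l i" "l i \<le> p i" if "i \<in> I" for i
    unfolding l_def p_def by (rule bdd_var_exponentsD(8,3,4,5)[OF qs[OF that]])+
  have u: "esssup lebesgue q = ennreal u" "q x = ennreal r" "r \<le> u" "1 \<le> r"
    unfolding u_def r_def by (rule bdd_var_exponentsD(9,3,6,7)[OF q])+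
  have pos: "0 < l i" "0 < p i" if "i \<in> I" for i using l(3,4)[OF that] by linarith+
  have "(\<Sum>i\<in>I. 1 / ennreal (l i)) = 1 / ennreal u" using ext l(1) u(1) by simp
  then have sl: "(\<Sum>i\<in>I. 1 / l i) = 1 / u"
    using pos u by (subst (asm) sum_inverse_ennreal_iff) auto
  have "(\<Sum>i\<in>I. 1 / ennreal (p i)) = 1 / ennreal r" using sum_q[of x] l(2) u(2) by simp
  then have sp: "(\<Sum>i\<in>I. 1 / p i) = 1 / r"
    using pos u by (subst (asm) sum_inverse_ennreal_iff) auto
  have le: "1 / p i \<le> 1 / l i" if "i \<in> I" for i
    using l(4)[OF that] pos[OF that] by (intro divide_left_mono) auto
  have "1 / u \<le> 1 / r" using u by (intro divide_left_mono) auto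
  moreover have "1 / r \<le> 1 / u" unfolding sl[symmetric] sp[symmetric] by (intro sum_mono le)
  ultimately have ru: "1 / r = 1 / u" by simp
  then have "r = u" by simp
  then show "q x = esssup lebesgue q" using u by simp
  show "qs i x = essinf lebesgue (qs i)" if i: "i \<in> I"
  proof -
    have "1 / p i = 1 / l i"
      by (rule sum_mono_inv[OF _ le i I]) (simp_all add: sl sp ru)
    then show ?thesis using l(1,2)[OF i] by simp
  qed
qed

text \<open>
  The bound for constant exponents holds for every admissible operator bound \<open>C\<close> with the same factor \<open>D\<close>, hence for their infimum.
\<close>
theorem hausdorff_lower_bound:
  fixes \<Phi> :: "real^'n \<Rightarrow> real" and A :: "nat \<Rightarrow> real^'n \<Rightarrow> real^'n^'n"
    and qs :: "nat \<Rightarrow> real^'n \<Rightarrow> ennreal" and q :: "real^'n \<Rightarrow> ennreal" and \<gamma> :: "nat \<Rightarrow> real"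
  assumes \<rho>: "1 \<le> \<rho>"
    and qs: "\<And>i. i \<in> {1..m} \<Longrightarrow> qs i \<in> bdd_var_exponents" and q: "q \<in> bdd_var_exponents"
    and sum_q: "\<And>x. (\<Sum>i=1..m. 1 / qs i x) = 1 / q x"
    and \<Phi>: "\<Phi> \<in> borel_measurable lebesgue" and \<Phi>0: "\<And>t. 0 \<le> \<Phi> t"
    and A: "\<And>i. i \<in> {1..m} \<Longrightarrow> A i \<in> borel_measurable lebesgue"
    and Ainv: "AE t in lebesgue. \<Phi> t \<noteq> 0 \<longrightarrow> (\<forall>i\<in>{1..m}. invertible (A i t))"
    and A\<rho>: "AE t in lebesgue. \<forall>i\<in>{1..m}. invertible (A i t) \<longrightarrow>
       norm (A i t) * norm (matrix_inv (A i t)) \<le> \<rho>"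
    and bdd: "hausdorff_bounded m \<Phi> A qs (\<lambda>i. power_weight (\<gamma> i)) q (power_weight (\<Sum>i=1..m. \<gamma> i))"
    and ext: "(\<Sum>i=1..m. 1 / essinf lebesgue (qs i)) = 1 / esssup lebesgue q"
  defines "D \<equiv> exp 1 * \<rho> powr (\<Sum>i=1..m. 2 * \<bar>CARD('n) / enn2real (essinf lebesgue (qs i)) + \<gamma> i\<bar> + 1)"
  shows "C2_star_const m \<Phi> A qs \<gamma> < \<infinity>"
    and "C2_star_const m \<Phi> A qs \<gamma> \<le> ennreal D *
      hausdorff_norm m \<Phi> A qs (\<lambda>i. power_weight (\<gamma> i)) q (power_weight (\<Sum>i=1..m. \<gamma> i))"
proof -
  define p where "p i = enn2real (essinf lebesgue (qs i))" for i
  define P where "P = enn2real (esssup lebesgue q)"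
  have D: "0 < D" using \<rho> by (simp add: D_def)
  note const = extremal_exponents_constant[of "{1..m}" qs q, OF _ qs q sum_q ext]
  have qs_p: "qs i x = ennreal (p i)" "1 \<le> p i" if i: "i \<in> {1..m}" for i x
    using const(1)[OF _ _ i, of x] bdd_var_exponentsD(8)[OF qs[OF i]] bdd_var_exponentsD(4)[OF qs[OF i]]
    unfolding p_def by simp_all
  have q_P: "q x = ennreal P" for x
    using const(2)[of x] bdd_var_exponentsD(9)[OF q] unfolding P_def by simp
  have P1: "1 \<le> P" using bdd_var_exponentsD(7,6)[OF q] unfolding P_def by (rule order_trans)
  have sum_p: "(\<Sum>i=1..m. 1 / p i) = 1 / P"
  proof -
    have "(\<Sum>i=1..m. 1 / ennreal (p i)) = 1 / ennreal P" using sum_q[of 0] qs_p(1) q_P by simp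
    then show ?thesis using qs_p(2) P1 by (subst (asm) sum_inverse_ennreal_iff) (auto intro: less_le_trans[OF zero_less_one])
  qed
  have ess: "enn2real (esssup lebesgue (qs i)) = p i" if i: "i \<in> {1..m}" for i
  proof -
    have "qs i = (\<lambda>_. ennreal (p i))" using qs_p(1)[OF i] by auto
    then have "esssup lebesgue (qs i) = ennreal (p i)" by (simp add: esssup_const)
    then show ?thesis using qs_p(2)[OF i] by simp
  qed
  have star: "C2_star_const m \<Phi> A qs \<gamma> = (\<integral>\<^sup>+t. ennreal (\<Phi> t / norm t ^ CARD('n)) *
      (\<Prod>i=1..m. ennreal (norm (matrix_inv (A i t)) powr (CARD('n) / p i + \<gamma> i))) \<partial>lebesgue)"
    unfolding C2_star_const_def
    by (intro nn_integral_cong arg_cong2[of _ _ _ _ "(*)"] refl prod.cong) (simp add: ess p_def[symmetric])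
  have defd: "hausdorff_defined m \<Phi> A f" if "\<And>i. i \<in> {1..m} \<Longrightarrow> f i \<in> wvar_Lp (qs i) (power_weight (\<gamma> i))" for f
    using bdd that unfolding hausdorff_bounded_def by blast
  have key: "C2_star_const m \<Phi> A qs \<gamma> \<le> ennreal (D * C)"
    if "0 \<le> C" and "\<forall>f. (\<forall>i\<in>{1..m}. f i \<in> wvar_Lp (qs i) (power_weight (\<gamma> i))) \<longrightarrow>
        wvar_norm q (power_weight (\<Sum>i=1..m. \<gamma> i)) (hausdorff_op m \<Phi> A f)
          \<le> ennreal C * (\<Prod>i=1..m. wvar_norm (qs i) (power_weight (\<gamma> i)) (f i))" for C
    unfolding star D_def p_def[symmetric]
    by (rule hausdorff_lower_bound_const_exponents[OF \<rho> qs qs_p q_P P1 sum_p \<Phi> \<Phi>0 A Ainv A\<rho> that(1) defd that(2)[rule_format]])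
      simp_all
  obtain C0 where "0 \<le> C0" "\<forall>f. (\<forall>i\<in>{1..m}. f i \<in> wvar_Lp (qs i) (power_weight (\<gamma> i))) \<longrightarrow>
        wvar_norm q (power_weight (\<Sum>i=1..m. \<gamma> i)) (hausdorff_op m \<Phi> A f)
          \<le> ennreal C0 * (\<Prod>i=1..m. wvar_norm (qs i) (power_weight (\<gamma> i)) (f i))"
    using bdd unfolding hausdorff_bounded_def by blast
  from key[OF this] show "C2_star_const m \<Phi> A qs \<gamma> < \<infinity>" by (rule le_less_trans) simp
  have "ennreal (1 / D) * C2_star_const m \<Phi> A qs \<gamma> \<le>
      hausdorff_norm m \<Phi> A qs (\<lambda>i. power_weight (\<gamma> i)) q (power_weight (\<Sum>i=1..m. \<gamma> i))"
    unfolding hausdorff_norm_def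
  proof (rule Inf_greatest, elim CollectE exE conjE)
    fix y C
    assume y: "y = ennreal C" and C: "0 \<le> C" "\<forall>f. (\<forall>i\<in>{1..m}. f i \<in> wvar_Lp (qs i) (power_weight (\<gamma> i))) \<longrightarrow>
        wvar_norm q (power_weight (\<Sum>i=1..m. \<gamma> i)) (hausdorff_op m \<Phi> A f)
          \<le> ennreal C * (\<Prod>i=1..m. wvar_norm (qs i) (power_weight (\<gamma> i)) (f i))"
    have "ennreal (1 / D) * C2_star_const m \<Phi> A qs \<gamma> \<le> ennreal (1 / D) * ennreal (D * C)"
      by (rule mult_left_mono[OF key[OF C]]) simp
    also have "\<dots> = y" using D C(1) by (simp add: y ennreal_mult[symmetric])
    finally show "ennreal (1 / D) * C2_star_const m \<Phi> A qs \<gamma> \<le> y" .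
  qed
  then have "ennreal D * (ennreal (1 / D) * C2_star_const m \<Phi> A qs \<gamma>) \<le> ennreal D *
      hausdorff_norm m \<Phi> A qs (\<lambda>i. power_weight (\<gamma> i)) q (power_weight (\<Sum>i=1..m. \<gamma> i))"
    by (rule mult_left_mono) simp
  moreover have "ennreal D * ennreal (1 / D) = 1" using D by (simp add: ennreal_mult[symmetric])
  ultimately show "C2_star_const m \<Phi> A qs \<gamma> \<le> ennreal D *
      hausdorff_norm m \<Phi> A qs (\<lambda>i. power_weight (\<gamma> i)) q (power_weight (\<Sum>i=1..m. \<gamma> i))"
    by (simp add: mult.assoc[symmetric])
qed

theorem theorem3p2:
  fixes m :: nat and \<rho> :: real and \<gamma> :: "nat \<Rightarrow> real"
    and qs :: "nat \<Rightarrow> real^'n \<Rightarrow> ennreal" and q :: "real^'n \<Rightarrow> ennreal"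
  assumes "m \<ge> 1" and "\<rho> \<ge> 1"
    and "\<forall>i\<in>{1..m}. qs i \<in> bdd_var_exponents" and "q \<in> bdd_var_exponents"
    and "\<forall>x. (\<Sum>i=1..m. 1 / qs i x) = 1 / q x"
  shows "\<exists>C>0. \<forall>(\<Phi> :: real^'n \<Rightarrow> real) (A :: nat \<Rightarrow> real^'n \<Rightarrow> real^'n^'n) (\<zeta> :: real).
    \<Phi> \<in> borel_measurable lebesgue \<and> (\<forall>t. 0 \<le> \<Phi> t) \<and>
    (\<forall>i\<in>{1..m}. A i \<in> borel_measurable lebesgue) \<and>
    (AE t in lebesgue. \<Phi> t \<noteq> 0 \<longrightarrow> (\<forall>i\<in>{1..m}. invertible (A i t))) \<and>
    (AE t in lebesgue. \<forall>i\<in>{1..m}. invertible (A i t) \<longrightarrow>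
       norm (A i t) * norm (matrix_inv (A i t)) \<le> \<rho>) \<and>
    \<zeta> > 0 \<and>
    (AE t in lebesgue. \<Phi> t \<noteq> 0 \<longrightarrow> (\<forall>i\<in>{1..m}.
       (\<forall>x. qs i (matrix_inv (A i t) *v x) \<le> ennreal \<zeta> * qs i x) \<and>
       var_norm (quot_exponent \<zeta> (qs i) (A i t)) (\<lambda>_. 1) < \<infinity>)) \<and>
    C1_const m \<Phi> A qs \<gamma> \<zeta> < \<infinity> \<and>
    (AE t in lebesgue. \<Phi> t \<noteq> 0 \<longrightarrow> (\<forall>i\<in>{1..m}.
       (\<forall>x. qs i (matrix_inv (A i t) *v x) \<le> qs i x) \<and>
       var_norm (quot_exponent 1 (qs i) (A i t)) (\<lambda>_. 1) < \<infinity>))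
    \<longrightarrow>
    (C2_const m \<Phi> A qs \<gamma> < \<infinity> \<longrightarrow>
       (\<forall>f. (\<forall>i\<in>{1..m}. f i \<in> wvar_Lp (qs i) (power_weight (\<gamma> i))) \<longrightarrow>
          hausdorff_defined m \<Phi> A f \<and>
          hausdorff_op m \<Phi> A f \<in> wvar_Lp q (power_weight (\<Sum>i=1..m. \<gamma> i)) \<and>
          wvar_norm q (power_weight (\<Sum>i=1..m. \<gamma> i)) (hausdorff_op m \<Phi> A f)
            \<le> ennreal C * C2_const m \<Phi> A qs \<gamma> *
              (\<Prod>i=1..m. wvar_norm (qs i) (power_weight (\<gamma> i)) (f i)))) \<and>
    (hausdorff_bounded m \<Phi> A qs (\<lambda>i. power_weight (\<gamma> i)) q (power_weight (\<Sum>i=1..m. \<gamma> i)) \<and>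
     (\<Sum>i=1..m. 1 / essinf lebesgue (qs i)) = 1 / esssup lebesgue q \<longrightarrow>
       C2_star_const m \<Phi> A qs \<gamma> < \<infinity> \<and>
       C2_star_const m \<Phi> A qs \<gamma> \<le> ennreal C *
         hausdorff_norm m \<Phi> A qs (\<lambda>i. power_weight (\<gamma> i)) q (power_weight (\<Sum>i=1..m. \<gamma> i)))"
proof -
  define D1 where "D1 = real m * (\<Prod>i=1..m. 2 * \<rho> powr \<bar>\<gamma> i\<bar>)"
  define D2 where "D2 = exp 1 * \<rho> powr (\<Sum>i=1..m. 2 * \<bar>CARD('n) / enn2real (essinf lebesgue (qs i)) + \<gamma> i\<bar> + 1)"
  have D1: "0 \<le> D1" unfolding D1_def by (intro mult_nonneg_nonneg prod_nonneg) auto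
  have D2: "0 < D2" using assms(2) by (simp add: D2_def)
  note qs = assms(3)[rule_format] and q = assms(4) and sum_q = assms(5)[rule_format]
  have weaken: "y \<le> ennreal (D1 + D2) * a" if "y \<le> ennreal d * a" "d \<le> D1 + D2" for y a :: ennreal and d
    by (rule order_trans[OF that(1) mult_right_mono[OF ennreal_leI[OF that(2)]]]) simp
  \<comment> \<open>One constant serves both parts, hence the sum. In cases 2 to 4 the premises on \<open>C2_const\<close> and \<open>f\<close> come
    before those on \<open>\<Phi>\<close> and \<open>A\<close>. In cases 5 and 6 those of part (b) are facts 2 and 3.\<close>
  show ?thesis
  proof ((rule exI[of _ "D1 + D2"], intro conjI allI impI; (elim conjE)?), goal_cases)
    case 1
    show ?case using D1 D2 by simp
  next
    case (2 \<Phi> A \<zeta> f)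
    show ?case
      by (rule hausdorff_upper_bound(1)[OF assms(1,2) qs q sum_q 2(3) 2(4)[rule_format] 2(5)[rule_format]
        2(6) 2(7) 2(11) 2(1) 2(2)[rule_format]])
  next
    case (3 \<Phi> A \<zeta> f)
    show ?case
      by (rule hausdorff_upper_bound(2)[OF assms(1,2) qs q sum_q 3(3) 3(4)[rule_format] 3(5)[rule_format]
        3(6) 3(7) 3(11) 3(1) 3(2)[rule_format]])
  next
    case (4 \<Phi> A \<zeta> f)
    have "wvar_norm q (power_weight (\<Sum>i=1..m. \<gamma> i)) (hausdorff_op m \<Phi> A f) \<le>
        ennreal D1 * C2_const m \<Phi> A qs \<gamma> * (\<Prod>i=1..m. wvar_norm (qs i) (power_weight (\<gamma> i)) (f i))"
      unfolding D1_def
      by (rule hausdorff_upper_bound(3)[OF assms(1,2) qs q sum_q 4(3) 4(4)[rule_format] 4(5)[rule_format]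
        4(6) 4(7) 4(11) 4(1) 4(2)[rule_format]])
    then show ?case unfolding mult.assoc by (rule weaken) (use D2 in simp)
  next
    case (5 \<Phi> A \<zeta>)
    show ?case
      by (rule hausdorff_lower_bound(1)[OF assms(2) qs q sum_q 5(1) 5(4)[rule_format] 5(5)[rule_format]
        5(6) 5(7) 5(2) 5(3)])
  next
    case (6 \<Phi> A \<zeta>)
    have "C2_star_const m \<Phi> A qs \<gamma> \<le> ennreal D2 *
        hausdorff_norm m \<Phi> A qs (\<lambda>i. power_weight (\<gamma> i)) q (power_weight (\<Sum>i=1..m. \<gamma> i))"
      unfolding D2_def
      by (rule hausdorff_lower_bound(2)[OF assms(2) qs q sum_q 6(1) 6(4)[rule_format] 6(5)[rule_format]
        6(6) 6(7) 6(2) 6(3)])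
    then show ?case by (rule weaken) (use D1 in simp)
  qed
qed

end
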